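(* (1) For any $\alpha\in(0,\infty)\setminus\{1\}$ and any $p,q>0$ there exist $A,B\in\mathbb{M}_2^{++}$ such that $\widetilde{SG}_{\alpha,p}(A,B)\not\prec_{\log}G_{\alpha,q}(A,B)$. (2) Let $0<\alpha\le1/2$. For any $p,q>0$ we have $G_{\alpha,q}(A,B)\prec_{\log}\widetilde{SG}_{\alpha,p}(A,B)$ for all $A,B\ge0$ with $s(A)\ge s(B)$. (3) Let $\alpha>1$ and $p,q>0$. If $q/p\le\min\bigl\{1/2,\frac{\alpha-1}{\alpha}\bigr\}$, then $G_{\alpha,q}(A,B)\prec_{\log}\widetilde{SG}_{\alpha,p}(A,B)$ for all $A,B\ge0$ with $s(A)\ge s(B)$.
   Context: Notation: $\mathbb{M}_n$ is the set of $n\times n$ complex matrices, $\mathbb{M}_n^+$ (resp. $\mathbb{M}_n^{++}$) the positive semidefinite (resp. positive definite) ones. $A\ge0$ (resp. $A>0$) means $A\in\mathbb{M}_n^+$ (resp. $A\in\mathbb{M}_n^{++}$) for some $n\in\mathbb{N}$; matrices appearing together have the same size. $s(A)$ is the support projection of $A\ge0$. $A^{-1}$ denotes the generalized inverse (the inverse on the support of $A$, zero on the kernel), and $A^r:=(A^{-1})^{-r}$ for $r<0$. For $\alpha>0$ and $A,B\ge0$ with $s(A)\ge s(B)$, $A\#_\alpha B:=A^{1/2}(A^{-1/2}BA^{-1/2})^{\alpha}A^{1/2}$. For $s(A)\ge s(B)$: $G_{\alpha,p}(A,B):=(A^p\#_\alpha B^p)^{1/p}$ and $\widetilde{SG}_{\alpha,p}(A,B):=\bigl((A^{-p}\#_\alpha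 B^p)^{1/2}A^{2(1-\alpha)p}(A^{-p}\#_\alpha B^p)^{1/2}\bigr)^{1/p}$. Log-majorization: for $X,Y\in\mathbb{M}_n^+$ with eigenvalues $\lambda_1(\cdot)\ge\dots\ge\lambda_n(\cdot)$ counted with multiplicity, $X\prec_{\log}Y$ means $\prod_{i=1}^k\lambda_i(X)\le\prod_{i=1}^k\lambda_i(Y)$ for $1\le k\le n$, with equality for $k=n$. *)

theory Defs
  imports
    Complex_Main
    "Jordan_Normal_Form.Schur_Decomposition"
    "Jordan_Normal_Form.Matrix_Kernel"
begin

text \<open>
  Inequalities between complex numbers are those of \<open>HOL-Library.Complex_Order\<close>:
  \<open>0 \<le> z\<close> means that \<open>z\<close> is real and nonnegative.
\<close>

definition psd :: "nat \<Rightarrow> complex mat set" where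
  "psd n = {A \<in> carrier_mat n n. mat_adjoint A = A \<and>
              (\<forall>v \<in> carrier_vec n. 0 \<le> (A *\<^sub>v v) \<bullet>c v)}"

definition pd :: "nat \<Rightarrow> complex mat set" where
  "pd n = {A \<in> carrier_mat n n. mat_adjoint A = A \<and>
              (\<forall>v \<in> carrier_vec n. v \<noteq> 0\<^sub>v n \<longrightarrow> 0 < (A *\<^sub>v v) \<bullet>c v)}"

definition loewner_le :: "complex mat \<Rightarrow> complex mat \<Rightarrow> bool" where
  "loewner_le A B \<longleftrightarrow> A \<in> carrier_mat (dim_row B) (dim_col B) \<and> B - A \<in> psd (dim_row B)"

text \<open>The orthogonal projection onto the orthogonal complement of the kernel.\<close>

definition supp_proj :: "complex mat \<Rightarrow> complex mat" where
  "supp_proj A = (THE P. P \<in> carrier_mat (dim_row A) (dim_row A) \<and> mat_adjoint P = P \<and>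
                     P * P = P \<and> mat_kernel P = mat_kernel A)"

text \<open>
  Functional calculus for Hermitian matrices, through any unitary diagonalization; the result
  does not depend on the diagonalization. On other matrices the value is unspecified.
\<close>

definition mat_fun :: "(real \<Rightarrow> real) \<Rightarrow> complex mat \<Rightarrow> complex mat" where
  "mat_fun f A = (THE C. \<exists>U d. U \<in> carrier_mat (dim_row A) (dim_row A) \<and>
      U * mat_adjoint U = 1\<^sub>m (dim_row A) \<and>
      A = U * mat_diag (dim_row A) (\<lambda>i. complex_of_real (d i)) * mat_adjoint U \<and>
      C = U * mat_diag (dim_row A) (\<lambda>i. complex_of_real (f (d i))) * mat_adjoint U)"

text \<open>
  Since \<open>inverse 0 = 0\<close>, this is the inverse on the support and zero on the kernel.
\<close>

definition ginv :: "complex mat \<Rightarrow> complex mat" where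
  "ginv A = mat_fun inverse A"

text \<open>Since \<open>0 powr r = 0\<close> for every \<open>r\<close>, all powers vanish on the kernel of the matrix.\<close>

definition mat_rpow :: "complex mat \<Rightarrow> real \<Rightarrow> complex mat" where
  "mat_rpow A r = (if r < 0 then mat_fun (\<lambda>x. x powr (- r)) (ginv A)
                   else mat_fun (\<lambda>x. x powr r) A)"

definition geo_mean :: "real \<Rightarrow> complex mat \<Rightarrow> complex mat \<Rightarrow> complex mat" where
  "geo_mean \<alpha> A B =
     mat_rpow A (1/2) * mat_rpow (mat_rpow A (-1/2) * B * mat_rpow A (-1/2)) \<alpha> * mat_rpow A (1/2)"

definition G_mean :: "real \<Rightarrow> real \<Rightarrow> complex mat \<Rightarrow> complex mat \<Rightarrow> complex mat" where
  "G_mean \<alpha> p A B = mat_rpow (geo_mean \<alpha> (mat_rpow A p) (mat_rpow B p)) (1/p)"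

definition SG_mean :: "real \<Rightarrow> real \<Rightarrow> complex mat \<Rightarrow> complex mat \<Rightarrow> complex mat" where
  "SG_mean \<alpha> p A B =
     (let M = mat_rpow (geo_mean \<alpha> (mat_rpow A (-p)) (mat_rpow B p)) (1/2)
      in mat_rpow (M * mat_rpow A (2 * (1 - \<alpha>) * p) * M) (1/p))"

text \<open>
  Eigenvalues with algebraic multiplicity, in decreasing order. For a Hermitian matrix all roots
  of the characteristic polynomial are real, so \<open>Re\<close> loses nothing.
\<close>

definition eigs_desc :: "complex mat \<Rightarrow> real list" where
  "eigs_desc A = rev (sorted_list_of_multiset (image_mset Re (proots (char_poly A))))"

text \<open>Used for \<open>X, Y \<in> psd n\<close> only; list indices start at 0.\<close>

definition log_maj :: "nat \<Rightarrow> complex mat \<Rightarrow> complex mat \<Rightarrow> bool" where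
  "log_maj n X Y \<longleftrightarrow>
     (\<forall>k\<in>{1..n}. (\<Prod>i<k. eigs_desc X ! i) \<le> (\<Prod>i<k. eigs_desc Y ! i)) \<and>
     (\<Prod>i<n. eigs_desc X ! i) = (\<Prod>i<n. eigs_desc Y ! i)"

end

(*
  For positive definite A everything reduces to operator inequalities: by homogeneity and compound
  matrices, G \<prec> SG follows once SG \<le> 1 implies G \<le> 1 for the largest eigenvalue, in every
  dimension.  With a = A^p, b = B^p, r = q/p these two bounds read
    (a^(1/2) b a^(1/2))^\<alpha> \<le> a^(2\<alpha>-1)   and   (a^(-r/2) b^r a^(-r/2))^\<alpha> \<le> a^(-r).
  If \<alpha> \<le> 1/2, the Furuta inequality turns the first one into b^(2\<alpha>) \<le> a^(-2(1-\<alpha>)); the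
  Loewner-Heinz inequality then gives the second one for r \<le> 2\<alpha>, and the Ando-Hiai inequality
  extends it to all larger r.  If \<alpha> > 1, the Loewner-Heinz inequality gives b \<le> a^((\<alpha>-1)/\<alpha>),
  and the powers of X = a^(-r/2) b^r a^(-r/2) are bounded successively through
  X^(t+2) = X X^t X.  For (1), take A = diag(a,1) with small a and B close to the projection onto
  the span of (1,1).
*)
theory Submission
  imports Defs "HOL-Analysis.Elementary_Metric_Spaces"
begin

section \<open>Spectral theorem for Hermitian matrices\<close>

text \<open>Singular matrices are the main obstacle, since the Furuta and Ando-Hiai arguments invert
  matrices. A singular \<open>A\<close> is made definite on its kernel without changing either mean,
  because \<open>B\<close> lives on the support of \<open>A\<close>. A singular \<open>B\<close> can
  only be shifted by a small multiple of the identity, and this shift has a cost. Therefore the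
  transfer from SG to G starts from a bound with a factor \<open>k < 1\<close> to spare, and the
  loss vanishes in a limit of scalars in \<open>eigs_prod_le\<close>. The threshold for \<alpha> > 1
  reflects the exponent range [0,1] of Loewner-Heinz. Since (\<alpha>-1)/\<alpha> \<le> 1/2 exactly
  when \<alpha> \<le> 2, the minimum splits there. For \<alpha> \<ge> 2 the iteration meets
  exponents of B up to 2r, whence r \<le> 1/2. For 1 < \<alpha> \<le> 2 no iteration is made:
  X^\<alpha> = Z (Z^H Z)^(\<alpha>-1) Z^H (with ^H for the adjoint) has an inner exponent of at most
  1, and A^(-r) is bounded by the power -r/\<beta> of the shifted B, with \<beta> =
  (\<alpha>-1)/\<alpha>, whence r \<le> \<beta>. Equality of the full eigenvalue products is a
  determinant computation.\<close>

lemma adjoint_carrier [simp]: "A \<in> carrier_mat n m \<Longrightarrow> mat_adjoint A \<in> carrier_mat m n"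
  unfolding mat_adjoint_def by auto

lemma adjoint_index [simp]:
  fixes A :: "complex mat"
  assumes "i < dim_col A" "j < dim_row A"
  shows "mat_adjoint A $$ (i,j) = cnj (A $$ (j,i))"
  using assms unfolding mat_adjoint_def by (simp add: mat_of_rows_index)

lemma adjoint_dim [simp]:
  "dim_row (mat_adjoint A) = dim_col A" "dim_col (mat_adjoint A) = dim_row A"
  unfolding mat_adjoint_def by auto

lemma adjoint_adjoint [simp]: "mat_adjoint (mat_adjoint A) = (A :: complex mat)"
  by (rule eq_matI) auto

lemma adjoint_mult:
  fixes A B :: "complex mat"
  assumes "A \<in> carrier_mat n m" "B \<in> carrier_mat m k"
  shows "mat_adjoint (A * B) = mat_adjoint B * mat_adjoint A"
proof (rule eq_matI)
  fix i j assume "i < dim_row (mat_adjoint B * mat_adjoint A)" "j < dim_col (mat_adjoint B * mat_adjoint A)"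
  then have ij: "i < k" "j < n" using assms by auto
  have "mat_adjoint (A * B) $$ (i,j) = cnj (\<Sum>l<m. A $$ (j,l) * B $$ (l,i))"
    using ij assms by (auto simp: scalar_prod_def atLeast0LessThan)
  also have "\<dots> = (\<Sum>l<m. mat_adjoint B $$ (i,l) * mat_adjoint A $$ (l,j))"
    using ij assms by (simp add: mult.commute)
  also have "\<dots> = (mat_adjoint B * mat_adjoint A) $$ (i,j)"
    using ij assms by (auto simp: scalar_prod_def atLeast0LessThan)
  finally show "mat_adjoint (A * B) $$ (i,j) = (mat_adjoint B * mat_adjoint A) $$ (i,j)" .
qed (use assms in auto)

lemma adjoint_one [simp]: "mat_adjoint (1\<^sub>m n) = (1\<^sub>m n :: complex mat)"
  by (rule eq_matI) auto

lemma adjoint_four_block: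
  fixes A :: "complex mat"
  assumes "A \<in> carrier_mat r1 c1" "B \<in> carrier_mat r1 c2" "C \<in> carrier_mat r2 c1" "D \<in> carrier_mat r2 c2"
  shows "mat_adjoint (four_block_mat A B C D)
       = four_block_mat (mat_adjoint A) (mat_adjoint C) (mat_adjoint B) (mat_adjoint D)"
  by (rule eq_matI) (use assms in auto)

text \<open>Complete \<open>v\<close> to a basis and apply Gram-Schmidt, which keeps the first
  vector and produces orthogonal but unnormalised columns. Dividing by the norms rescales
  \<open>v\<close>, hence the factor \<open>c\<close>.\<close>

lemma exists_unitary_first_col:
  assumes v: "v \<in> carrier_vec n" and v0: "v \<noteq> 0\<^sub>v n" and n: "n \<noteq> 0"
  shows "\<exists>V c. V \<in> carrier_mat n n \<and> mat_adjoint V * V = 1\<^sub>m n \<and> (c::complex) \<noteq> 0 \<and> col V 0 = c \<cdot>\<^sub>v v"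
proof -
  interpret cof_vec_space n "TYPE(complex)" .
  define b where "b = basis_completion v"
  define ws where "ws = gram_schmidt n b"
  from basis_completion[OF v v0, folded b_def]
  have dist_b: "distinct b" and indep: "\<not> lin_dep (set b)" and b: "set b \<subseteq> carrier_vec n"
    and hdb: "hd b = v" and len_b: "length b = n" by auto
  from hdb len_b n obtain vs where bv: "b = v # vs" by (cases b, auto)
  from gram_schmidt_result[OF b dist_b indep refl, folded ws_def]
  have ws: "set ws \<subseteq> carrier_vec n" "corthogonal ws" "length ws = n"
    by (auto simp: len_b)
  have wsi: "i < n \<Longrightarrow> ws ! i \<in> carrier_vec n" for i using ws by auto
  from gram_schmidt_hd[OF v, of vs, folded bv] have hdws: "ws ! 0 = v"
    unfolding ws_def[symmetric] using ws n by (cases ws, auto)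
  define s where "s j = sqrt (Re (ws ! j \<bullet>c ws ! j))" for j
  have pos: "ws ! j \<bullet>c ws ! j > 0" if "j < n" for j
  proof -
    have "ws ! j \<bullet>c ws ! j \<noteq> 0" using ws that by (auto simp: corthogonal_def)
    moreover have "ws ! j \<bullet>c ws ! j \<ge> 0" by (rule conjugate_square_ge_0_vec)
    ultimately show ?thesis by simp
  qed
  have s2: "complex_of_real (s j) * complex_of_real (s j) = ws ! j \<bullet>c ws ! j" "s j > 0" if "j < n" for j
    using pos[OF that] by (auto simp: s_def less_complex_def complex_eq_iff)
  define V where "V = mat n n (\<lambda>(i,j). (ws ! j) $ i / complex_of_real (s j))"
  have V: "V \<in> carrier_mat n n" by (simp add: V_def)
  have "mat_adjoint V * V = 1\<^sub>m n"
  proof (rule eq_matI)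
    fix i j assume "i < dim_row (1\<^sub>m n)" "j < dim_col (1\<^sub>m n)"
    then have ij: "i < n" "j < n" by auto
    have "(mat_adjoint V * V) $$ (i,j) = (\<Sum>k<n. mat_adjoint V $$ (i,k) * V $$ (k,j))"
      using ij V by (simp add: scalar_prod_def atLeast0LessThan)
    also have "\<dots> = (\<Sum>k<n. cnj (ws ! i $ k) / s i * ((ws ! j) $ k / complex_of_real (s j)))"
      using ij V by (intro sum.cong) (auto simp: V_def)
    also have "\<dots> = (ws ! j \<bullet>c ws ! i) / (complex_of_real (s i) * complex_of_real (s j))"
      using ij wsi[OF ij(1)] wsi[OF ij(2)]
      by (simp add: scalar_prod_def atLeast0LessThan sum_divide_distrib field_simps carrier_vecD)
    also have "\<dots> = 1\<^sub>m n $$ (i,j)"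
      using ij ws s2[of i] by (cases "i = j") (auto simp: corthogonal_def)
    finally show "(mat_adjoint V * V) $$ (i,j) = 1\<^sub>m n $$ (i,j)" .
  qed (use V in auto)
  moreover have "col V 0 = (1 / complex_of_real (s 0)) \<cdot>\<^sub>v v"
    using n v hdws by (intro eq_vecI) (auto simp: V_def)
  moreover have "1 / complex_of_real (s 0) \<noteq> 0" using s2[of 0] n by simp
  ultimately show ?thesis using V by blast
qed

text \<open>Induction on the dimension. The fundamental theorem of algebra yields one eigenvector;
  in a unitary basis that starts with it the first column is zero below the diagonal, and Hermitian
  symmetry clears the first row and makes the eigenvalue real. The remaining block is Hermitian of
  size \<open>m\<close>.\<close>

theorem hermitian_spectral:
  fixes A :: "complex mat"
  assumes "A \<in> carrier_mat n n" "mat_adjoint A = A"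
  shows "\<exists>U d. U \<in> carrier_mat n n \<and> U * mat_adjoint U = 1\<^sub>m n \<and>
           A = U * mat_diag n (\<lambda>i. complex_of_real (d i)) * mat_adjoint U"
  using assms
proof (induction n arbitrary: A)
  case 0
  then show ?case by (intro exI[of _ "1\<^sub>m 0"] exI[of _ "\<lambda>_. 0"]) auto
next
  case (Suc m)
  let ?n = "Suc m"
  note A = Suc.prems(1)
  have "degree (char_poly A) = ?n" using degree_monic_char_poly[OF A] by simp
  then have "\<not> constant (poly (char_poly A))" by (simp add: constant_degree)
  then obtain e where "poly (char_poly A) e = 0" using fundamental_theorem_of_algebra by blast
  then have "eigenvalue A e" using eigenvalue_root_char_poly[OF A] by simp
  then obtain v where v: "v \<in> carrier_vec ?n" "v \<noteq> 0\<^sub>v ?n" "A *\<^sub>v v = e \<cdot>\<^sub>v v"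
    using A unfolding eigenvalue_def eigenvector_def by auto
  obtain V c where V: "V \<in> carrier_mat ?n ?n" "mat_adjoint V * V = 1\<^sub>m ?n" and c: "c \<noteq> 0"
    and col: "col V 0 = c \<cdot>\<^sub>v v"
    using exists_unitary_first_col[OF v(1,2)] by auto
  have VV: "V * mat_adjoint V = 1\<^sub>m ?n"
    using mat_mult_left_right_inverse[OF _ V(1) V(2)] V(1) by simp
  define B where "B = mat_adjoint V * A * V"
  have B: "B \<in> carrier_mat ?n ?n" using V A by (auto simp: B_def)
  have aV: "mat_adjoint V \<in> carrier_mat ?n ?n" using V by simp
  have Badj: "mat_adjoint B = B"
    unfolding B_def using A V Suc.prems(2) aV
    by (simp add: adjoint_mult[of _ ?n ?n _ ?n] assoc_mult_mat[of _ ?n ?n _ ?n _ ?n])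
  have AV: "A = V * B * mat_adjoint V"
  proof -
    have "V * B * mat_adjoint V = (V * mat_adjoint V) * A * (V * mat_adjoint V)"
      unfolding B_def using A V(1) aV
      by (simp add: assoc_mult_mat[of _ ?n ?n _ ?n _ ?n] mult_carrier_mat[of _ ?n ?n _ ?n])
    then show ?thesis using VV A by simp
  qed
  have col0: "col B 0 = e \<cdot>\<^sub>v unit_vec ?n 0"
  proof -
    have "col B 0 = (mat_adjoint V * A) *\<^sub>v col V 0"
      unfolding B_def using V A by (subst col_mult2) (auto intro!: mult_carrier_mat)
    also have "\<dots> = mat_adjoint V *\<^sub>v (A *\<^sub>v (c \<cdot>\<^sub>v v))"
      unfolding col using V A v by (auto intro: assoc_mult_mat_vec)
    also have "A *\<^sub>v (c \<cdot>\<^sub>v v) = e \<cdot>\<^sub>v col V 0"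
      unfolding col using A v by (simp add: mult_mat_vec[of _ ?n ?n] smult_smult_assoc mult.commute)
    also have "mat_adjoint V *\<^sub>v (e \<cdot>\<^sub>v col V 0) = e \<cdot>\<^sub>v (mat_adjoint V *\<^sub>v col V 0)"
      using V by (auto intro: mult_mat_vec)
    also have "mat_adjoint V *\<^sub>v col V 0 = col (mat_adjoint V * V) 0"
      using V by (subst col_mult2) auto
    also have "\<dots> = unit_vec ?n 0" using V by simp
    finally show ?thesis .
  qed
  have B0: "i < ?n \<Longrightarrow> B $$ (i,0) = (if i = 0 then e else 0)" for i
    using arg_cong[OF col0, of "\<lambda>v. v $ i"] B by (auto simp: unit_vec_def)
  have Bc: "i < ?n \<Longrightarrow> j < ?n \<Longrightarrow> B $$ (i,j) = cnj (B $$ (j,i))" for i j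
    using adjoint_index[of i B j] B Badj by auto
  have e: "e = complex_of_real (Re e)" using Bc[of 0 0] B0[of 0]
    by (simp add: complex_eq_iff)
  define C where "C = mat m m (\<lambda>(i,j). B $$ (Suc i, Suc j))"
  have C: "C \<in> carrier_mat m m" "mat_adjoint C = C"
    by (auto simp: C_def intro!: eq_matI Bc[symmetric])
  obtain U d where U: "U \<in> carrier_mat m m" "U * mat_adjoint U = 1\<^sub>m m"
    and CU: "C = U * mat_diag m (\<lambda>i. complex_of_real (d i)) * mat_adjoint U"
    using Suc.IH[OF C] by blast
  let ?D = "mat_diag m (\<lambda>i. complex_of_real (d i))"
  let ?E = "mat 1 1 (\<lambda>_. e)"
  have Bblock: "B = four_block_mat ?E (0\<^sub>m 1 m) (0\<^sub>m m 1) C"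
  proof (rule eq_matI)
    fix i j assume "i < dim_row (four_block_mat ?E (0\<^sub>m 1 m) (0\<^sub>m m 1) C)"
      "j < dim_col (four_block_mat ?E (0\<^sub>m 1 m) (0\<^sub>m m 1) C)"
    then have ij: "i < ?n" "j < ?n" using C by auto
    show "B $$ (i,j) = four_block_mat ?E (0\<^sub>m 1 m) (0\<^sub>m m 1) C $$ (i,j)"
      using ij C B0[of i] B0[of j] Bc[of i j] by (cases i; cases j) (auto simp: C_def)
  qed (use B C in auto)
  define U1 where "U1 = four_block_mat (1\<^sub>m 1) (0\<^sub>m 1 m) (0\<^sub>m m 1) U"
  define D1 where "D1 = four_block_mat ?E (0\<^sub>m 1 m) (0\<^sub>m m 1) ?D"
  have D: "?D \<in> carrier_mat m m" by simp
  have U1: "U1 \<in> carrier_mat ?n ?n" "mat_adjoint U1 = four_block_mat (1\<^sub>m 1) (0\<^sub>m 1 m) (0\<^sub>m m 1) (mat_adjoint U)"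
  proof -
    show "U1 \<in> carrier_mat ?n ?n" using U unfolding U1_def by (auto simp: four_block_carrier_mat[of _ 1 1 _ m m])
    have z: "mat_adjoint (0\<^sub>m a b) = (0\<^sub>m b a :: complex mat)" for a b by (rule eq_matI) auto
    show "mat_adjoint U1 = four_block_mat (1\<^sub>m 1) (0\<^sub>m 1 m) (0\<^sub>m m 1) (mat_adjoint U)"
      unfolding U1_def using U by (subst adjoint_four_block[of _ 1 1 _ m _ m]) (auto simp: z)
  qed
  have aU: "mat_adjoint U \<in> carrier_mat m m" using U by simp
  have U1u: "U1 * mat_adjoint U1 = 1\<^sub>m ?n"
    unfolding U1(2) unfolding U1_def using U aU
    by (subst mult_four_block_mat[of _ 1 1 _ m _ m]) (auto simp: four_block_one_mat)
  have D1: "D1 = mat_diag ?n (\<lambda>i. complex_of_real (case i of 0 \<Rightarrow> Re e | Suc k \<Rightarrow> d k))"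
  proof (rule eq_matI)
    fix i j assume "i < dim_row (mat_diag ?n (\<lambda>i. complex_of_real (case i of 0 \<Rightarrow> Re e | Suc k \<Rightarrow> d k)))"
      "j < dim_col (mat_diag ?n (\<lambda>i. complex_of_real (case i of 0 \<Rightarrow> Re e | Suc k \<Rightarrow> d k)))"
    then have ij: "i < ?n" "j < ?n" by (auto simp: mat_diag_def)
    then show "D1 $$ (i,j) = mat_diag ?n (\<lambda>i. complex_of_real (case i of 0 \<Rightarrow> Re e | Suc k \<Rightarrow> d k)) $$ (i,j)"
      unfolding D1_def mat_diag_def using e by (cases i; cases j) auto
  qed (auto simp: D1_def mat_diag_def)
  have D1c: "D1 \<in> carrier_mat ?n ?n" unfolding D1 by simp
  have BU: "B = U1 * D1 * mat_adjoint U1"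
  proof -
    have "U1 * D1 = four_block_mat ?E (0\<^sub>m 1 m) (0\<^sub>m m 1) (U * ?D)"
      unfolding U1_def D1_def using U D
      by (subst mult_four_block_mat[of _ 1 1 _ m _ m]) (auto intro!: cong_four_block_mat simp: left_mult_zero_mat[OF D])
    then have "U1 * D1 * mat_adjoint U1 = four_block_mat ?E (0\<^sub>m 1 m) (0\<^sub>m m 1) (U * ?D * mat_adjoint U)"
      unfolding U1(2) using U D aU
      by (simp, subst mult_four_block_mat[of _ 1 1 _ m _ m]) (auto intro!: cong_four_block_mat mult_carrier_mat)
    then show ?thesis unfolding Bblock CU by simp
  qed
  define W where "W = V * U1"
  have W: "W \<in> carrier_mat ?n ?n" using V U1 by (simp add: W_def)
  have aU1: "mat_adjoint U1 \<in> carrier_mat ?n ?n" using U1(1) by simp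
  have aW: "mat_adjoint W = mat_adjoint U1 * mat_adjoint V"
    unfolding W_def using V(1) U1(1) by (rule adjoint_mult)
  note ass = assoc_mult_mat[of _ ?n ?n _ ?n _ ?n]
  have "W * mat_adjoint W = V * (U1 * mat_adjoint U1) * mat_adjoint V"
    unfolding aW unfolding W_def using V U1(1) aU1 aV by (simp add: ass mult_carrier_mat[of _ ?n ?n _ ?n])
  then have "W * mat_adjoint W = 1\<^sub>m ?n" using U1u VV V by simp
  moreover have "A = W * D1 * mat_adjoint W"
    unfolding AV BU unfolding aW unfolding W_def using V(1) U1(1) aU1 aV D1c by (simp add: ass mult_carrier_mat[of _ ?n ?n _ ?n])
  ultimately show ?case using W unfolding D1 by blast
qed

section \<open>Functional calculus and the Loewner order\<close>

text \<open>The form of a Hermitian matrix is real, so the real part loses nothing and the order can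
  be handled with real inequalities.\<close>

definition qf :: "complex mat \<Rightarrow> complex vec \<Rightarrow> real" where
  "qf A v = Re ((A *\<^sub>v v) \<bullet>c v)"

definition nsq :: "complex vec \<Rightarrow> real" where
  "nsq v = Re (v \<bullet>c v)"

lemma nsq_sum: "nsq v = (\<Sum>i<dim_vec v. (cmod (v $ i))\<^sup>2)"
  by (simp add: nsq_def scalar_prod_def atLeast0LessThan cmod_power2 sum.distrib)
     (simp add: power2_eq_square)

lemma nsq_nonneg: "0 \<le> nsq v" by (simp add: nsq_sum sum_nonneg)

lemma nsq_pos: "v \<in> carrier_vec n \<Longrightarrow> v \<noteq> 0\<^sub>v n \<Longrightarrow> 0 < nsq v"
  using conjugate_square_greater_0_vec[of v n] by (simp add: nsq_def less_complex_def)

text \<open>The dimension is the only parameter, so that the same theory serves both the given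
  matrices and their compounds, which have another size.\<close>

locale sqmat = fixes n :: nat
begin

abbreviation M :: "complex mat set" where "M \<equiv> carrier_mat n n"
abbreviation dg :: "(nat \<Rightarrow> real) \<Rightarrow> complex mat" where
  "dg d \<equiv> mat_diag n (\<lambda>i. complex_of_real (d i))"
definition sc :: "real \<Rightarrow> complex mat" where "sc c = complex_of_real c \<cdot>\<^sub>m 1\<^sub>m n"
definition unitary :: "complex mat \<Rightarrow> bool" where
  "unitary U \<longleftrightarrow> U \<in> M \<and> U * mat_adjoint U = 1\<^sub>m n"
definition ud :: "complex mat \<Rightarrow> (nat \<Rightarrow> real) \<Rightarrow> complex mat" where
  "ud U d = U * dg d * mat_adjoint U"
definition herm :: "complex mat \<Rightarrow> bool" where
  "herm A \<longleftrightarrow> A \<in> M \<and> mat_adjoint A = A"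
text \<open>Hermiticity is part of the relation, so chains of inequalities carry it along.\<close>

definition le :: "complex mat \<Rightarrow> complex mat \<Rightarrow> bool" (infix "\<preceq>" 50) where
  "X \<preceq> Y \<longleftrightarrow> herm X \<and> herm Y \<and> (\<forall>v\<in>carrier_vec n. qf X v \<le> qf Y v)"

lemma mclosed [simp]: "A \<in> M \<Longrightarrow> B \<in> M \<Longrightarrow> A * B \<in> M" by (rule mult_carrier_mat)
lemma massoc [simp]: "A \<in> M \<Longrightarrow> B \<in> M \<Longrightarrow> C \<in> M \<Longrightarrow> A * B * C = A * (B * C)"
  by (rule assoc_mult_mat)
lemma adjm [simp]: "A \<in> M \<Longrightarrow> B \<in> M \<Longrightarrow> mat_adjoint (A * B) = mat_adjoint B * mat_adjoint A"
  by (rule adjoint_mult)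
lemma mvec [simp]: "A \<in> M \<Longrightarrow> v \<in> carrier_vec n \<Longrightarrow> A *\<^sub>v v \<in> carrier_vec n"
  by (rule mult_mat_vec_carrier)
lemma mvec_assoc [simp]:
  "A \<in> M \<Longrightarrow> B \<in> M \<Longrightarrow> v \<in> carrier_vec n \<Longrightarrow> (A * B) *\<^sub>v v = A *\<^sub>v (B *\<^sub>v v)"
  by (rule assoc_mult_mat_vec)
lemma msmult_left [simp]: "A \<in> M \<Longrightarrow> B \<in> M \<Longrightarrow> (k \<cdot>\<^sub>m A) * B = k \<cdot>\<^sub>m (A * B)"
  by (rule mult_smult_assoc_mat)
lemma msmult_right [simp]: "A \<in> M \<Longrightarrow> B \<in> M \<Longrightarrow> A * (k \<cdot>\<^sub>m B) = k \<cdot>\<^sub>m (A * B)"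
  by (rule mult_smult_distrib)
lemma mone_left [simp]: "A \<in> M \<Longrightarrow> 1\<^sub>m n * A = A" by simp
lemma mone_right [simp]: "A \<in> M \<Longrightarrow> A * 1\<^sub>m n = A" by simp
text \<open>The simplifier brackets products to the right, so a rule for \<open>A * B\<close> also
  has to be stated in front of a further factor \<open>X\<close>.\<close>

lemma mult_collapse:
  assumes "A * B = C" "A \<in> M" "B \<in> M" "X \<in> M"
  shows "A * (B * X) = C * X"
  unfolding massoc[OF assms(2-4), symmetric] assms(1) ..
lemma mat_zero_vec: "A \<in> M \<Longrightarrow> A *\<^sub>v 0\<^sub>v n = 0\<^sub>v n"
  by (rule eq_vecI) auto
lemma sc_closed [simp]: "sc c \<in> M" by (simp add: sc_def)
lemma sc_mult [simp]: "A \<in> M \<Longrightarrow> sc c * A = complex_of_real c \<cdot>\<^sub>m A"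
  "A \<in> M \<Longrightarrow> A * sc c = complex_of_real c \<cdot>\<^sub>m A" by (simp_all add: sc_def)
lemma sc_one: "sc 1 = 1\<^sub>m n" by (rule eq_matI) (auto simp: sc_def)
lemma adj_smult [simp]: "A \<in> M \<Longrightarrow> mat_adjoint (complex_of_real c \<cdot>\<^sub>m A) = complex_of_real c \<cdot>\<^sub>m mat_adjoint A"
  by (rule eq_matI) auto
lemma adj_dg [simp]: "mat_adjoint (dg d) = dg d" by (rule eq_matI) (auto simp: mat_diag_def)

lemma unitaryD [simp]: "unitary U \<Longrightarrow> U \<in> M" "unitary U \<Longrightarrow> U * mat_adjoint U = 1\<^sub>m n"
  "unitary U \<Longrightarrow> mat_adjoint U * U = 1\<^sub>m n"
  unfolding unitary_def by (auto intro: mat_mult_left_right_inverse[of U n])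
lemma unitaryD' [simp]: 
  "unitary U \<Longrightarrow> A \<in> M \<Longrightarrow> U * (mat_adjoint U * A) = A"
  "unitary U \<Longrightarrow> A \<in> M \<Longrightarrow> mat_adjoint U * (U * A) = A"
  by (simp_all add: mult_collapse[OF unitaryD(2)] mult_collapse[OF unitaryD(3)])

lemma inner_adj:
  assumes "A \<in> M" "v \<in> carrier_vec n" "w \<in> carrier_vec n"
  shows "(A *\<^sub>v v) \<bullet>c w = v \<bullet>c (mat_adjoint A *\<^sub>v w)"
proof -
  have "(A *\<^sub>v v) \<bullet>c w = (\<Sum>i<n. \<Sum>j<n. A $$ (i,j) * v $ j * cnj (w $ i))"
    using assms by (simp add: scalar_prod_def atLeast0LessThan sum_distrib_right carrier_vecD)
  also have "\<dots> = (\<Sum>j<n. \<Sum>i<n. A $$ (i,j) * v $ j * cnj (w $ i))" by (rule sum.swap)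
  also have "\<dots> = v \<bullet>c (mat_adjoint A *\<^sub>v w)"
    using assms by (simp add: scalar_prod_def atLeast0LessThan sum_distrib_left carrier_vecD mult_ac)
  finally show ?thesis .
qed

lemma hermI: "A \<in> M \<Longrightarrow> mat_adjoint A = A \<Longrightarrow> herm A" by (simp add: herm_def)
lemma hermD [simp]: "herm A \<Longrightarrow> A \<in> M" "herm A \<Longrightarrow> mat_adjoint A = A" by (auto simp: herm_def)

lemma inner_cnj:
  fixes v w :: "complex vec"
  assumes "v \<in> carrier_vec n" "w \<in> carrier_vec n"
  shows "v \<bullet>c w = cnj (w \<bullet>c v)"
  using assms by (simp add: scalar_prod_def carrier_vecD mult.commute)

lemma psd_iff: "A \<in> psd n \<longleftrightarrow> herm A \<and> (\<forall>v\<in>carrier_vec n. 0 \<le> qf A v)"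
proof -
  have "(0 \<le> (A *\<^sub>v v) \<bullet>c v) = (0 \<le> qf A v)" if "herm A" "v \<in> carrier_vec n" for v
  proof -
    have "(A *\<^sub>v v) \<bullet>c v = v \<bullet>c (A *\<^sub>v v)" using inner_adj[of A v v] that by simp
    also have "\<dots> = cnj ((A *\<^sub>v v) \<bullet>c v)"
      by (rule inner_cnj) (use that in simp_all)
    finally have "Im ((A *\<^sub>v v) \<bullet>c v) = 0" by (simp add: complex_eq_iff)
    then show ?thesis by (simp add: qf_def less_eq_complex_def)
  qed
  then show ?thesis unfolding psd_def herm_def by auto
qed

lemma pd_iff: "A \<in> pd n \<longleftrightarrow> herm A \<and> (\<forall>v\<in>carrier_vec n. v \<noteq> 0\<^sub>v n \<longrightarrow> 0 < qf A v)"
proof -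
  have "(0 < (A *\<^sub>v v) \<bullet>c v) = (0 < qf A v)" if "herm A" "v \<in> carrier_vec n" for v
  proof -
    have "(A *\<^sub>v v) \<bullet>c v = v \<bullet>c (A *\<^sub>v v)" using inner_adj[of A v v] that by simp
    also have "\<dots> = cnj ((A *\<^sub>v v) \<bullet>c v)"
      by (rule inner_cnj) (use that in simp_all)
    finally have "Im ((A *\<^sub>v v) \<bullet>c v) = 0" by (simp add: complex_eq_iff)
    then show ?thesis by (simp add: qf_def less_complex_def)
  qed
  then show ?thesis unfolding pd_def herm_def by auto
qed

lemma ud_closed [simp]: "unitary U \<Longrightarrow> ud U d \<in> M" by (simp add: ud_def)
lemma herm_ud [simp]: "unitary U \<Longrightarrow> herm (ud U d)" by (rule hermI) (simp_all add: ud_def)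

lemma ud_mult [simp]: "unitary U \<Longrightarrow> ud U d * ud U e = ud U (\<lambda>i. d i * e i)"
proof -
  assume U: "unitary U"
  have "dg d * (dg e * mat_adjoint U) = dg (\<lambda>i. d i * e i) * mat_adjoint U"
    by (rule mult_collapse) (use U in simp_all)
  then show ?thesis using U by (simp add: ud_def)
qed

lemma dg_cong: "(\<And>i. i < n \<Longrightarrow> d i = e i) \<Longrightarrow> dg d = dg e"
  by (rule eq_matI) (auto simp: mat_diag_def)

lemma ud_cong: "(\<And>i. i < n \<Longrightarrow> d i = e i) \<Longrightarrow> ud U d = ud U e"
  unfolding ud_def by (simp cong: dg_cong)

lemma ud_const: "unitary U \<Longrightarrow> ud U (\<lambda>i. c) = sc c"
proof -
  assume U: "unitary U"
  have "dg (\<lambda>i. c) = sc c" by (rule eq_matI) (auto simp: mat_diag_def sc_def)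
  then show ?thesis using U by (simp add: ud_def sc_def)
qed

lemma ud_smult: "unitary U \<Longrightarrow> complex_of_real c \<cdot>\<^sub>m ud U d = ud U (\<lambda>i. c * d i)"
  using ud_mult[of U "\<lambda>_. c" d] by (simp add: ud_const)

lemma ud_add: "unitary U \<Longrightarrow> ud U d + ud U e = ud U (\<lambda>i. d i + e i)"
proof -
  assume U: "unitary U"
  have "dg (\<lambda>i. d i + e i) = dg d + dg e" by (rule eq_matI) (auto simp: mat_diag_def)
  then have "ud U (\<lambda>i. d i + e i) = U * (dg d + dg e) * mat_adjoint U" by (simp add: ud_def)
  also have "\<dots> = ud U d + ud U e"
    using U by (simp add: ud_def mult_add_distrib_mat[of _ n n _ n] add_mult_distrib_mat[of _ n n _ _ n])
  finally show ?thesis by simp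
qed

text \<open>In the two eigenbases \<open>K\<close> becomes \<open>W\<close> with
  \<open>W_ij d_j = e_i W_ij\<close>. A nonzero entry forces \<open>d_j = e_i\<close>, and then
  \<open>f\<close> takes the same value at both.\<close>

lemma ud_intertwine:
  assumes U: "unitary U" and V: "unitary V" and K: "K \<in> M"
    and eq: "K * ud U d = ud V e * K"
  shows "K * ud U (\<lambda>i. f (d i)) = ud V (\<lambda>i. f (e i)) * K"
proof -
  define W where "W = mat_adjoint V * (K * U)"
  have W: "W \<in> M" using U V K by (simp add: W_def)
  have KU: "K = V * (W * mat_adjoint U)" using U V K by (simp add: W_def)
  have Wd: "W * dg d = mat_adjoint V * (K * ud U d) * U"
    using U V K by (simp add: W_def ud_def)
  have We: "dg e * W = mat_adjoint V * (ud V e * K) * U"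
    using U V K by (simp add: W_def ud_def)
  have eqW: "W * dg d = dg e * W" unfolding Wd We eq ..
  have "W $$ (i,j) * complex_of_real (f (d j)) = complex_of_real (f (e i)) * W $$ (i,j)"
    if "i < n" "j < n" for i j
  proof -
    have "W $$ (i,j) * complex_of_real (d j) = complex_of_real (e i) * W $$ (i,j)"
      using arg_cong[OF eqW, of "\<lambda>X. X $$ (i,j)"] that
      by (simp add: mat_diag_mult_left[OF W] mat_diag_mult_right[OF W])
    then show ?thesis by (cases "W $$ (i,j) = 0") auto
  qed
  then have eq2: "W * dg (\<lambda>i. f (d i)) = dg (\<lambda>i. f (e i)) * W"
    by (intro eq_matI) (simp_all add: mat_diag_mult_left[OF W] mat_diag_mult_right[OF W])
  have "K * ud U (\<lambda>i. f (d i)) = V * (W * dg (\<lambda>i. f (d i))) * mat_adjoint U"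
    unfolding KU using U V W by (simp add: ud_def)
  also have "\<dots> = V * (dg (\<lambda>i. f (e i)) * W) * mat_adjoint U" unfolding eq2 ..
  also have "\<dots> = ud V (\<lambda>i. f (e i)) * K" unfolding KU using U V W by (simp add: ud_def)
  finally show ?thesis .
qed

text \<open>The description in \<open>mat_fun\<close> is well defined: the identity intertwines any
  two diagonalizations of the same matrix.\<close>

lemma mat_fun_ud:
  assumes U: "unitary U"
  shows "mat_fun f (ud U d) = ud U (\<lambda>i. f (d i))"
  unfolding mat_fun_def
proof (rule the_equality)
  have [simp]: "dim_row (ud U d) = n" using ud_closed[OF U, of d] by auto
  show "\<exists>Ua da. Ua \<in> carrier_mat (dim_row (ud U d)) (dim_row (ud U d)) \<and>
      Ua * mat_adjoint Ua = 1\<^sub>m (dim_row (ud U d)) \<and>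
      ud U d = Ua * mat_diag (dim_row (ud U d)) (\<lambda>i. complex_of_real (da i)) * mat_adjoint Ua \<and>
      ud U (\<lambda>i. f (d i)) = Ua * mat_diag (dim_row (ud U d)) (\<lambda>i. complex_of_real (f (da i))) * mat_adjoint Ua"
    unfolding \<open>dim_row (ud U d) = n\<close>
    using U by (intro exI[of _ U] exI[of _ d]) (simp add: ud_def)
  fix C assume "\<exists>Ua da. Ua \<in> carrier_mat (dim_row (ud U d)) (dim_row (ud U d)) \<and>
      Ua * mat_adjoint Ua = 1\<^sub>m (dim_row (ud U d)) \<and>
      ud U d = Ua * mat_diag (dim_row (ud U d)) (\<lambda>i. complex_of_real (da i)) * mat_adjoint Ua \<and>
      C = Ua * mat_diag (dim_row (ud U d)) (\<lambda>i. complex_of_real (f (da i))) * mat_adjoint Ua"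
  then obtain V e where V: "unitary V" and eq: "ud U d = ud V e" and C: "C = ud V (\<lambda>i. f (e i))"
    unfolding \<open>dim_row (ud U d) = n\<close> unfolding unitary_def by (metis ud_def)
  have "1\<^sub>m n * ud V (\<lambda>i. f (e i)) = ud U (\<lambda>i. f (d i)) * 1\<^sub>m n"
    by (rule ud_intertwine) (use U V eq in simp_all)
  then show "C = ud U (\<lambda>i. f (d i))" using U V by (simp add: C)
qed

lemma qf_conj:
  assumes "K \<in> M" "X \<in> M" "v \<in> carrier_vec n"
  shows "qf (mat_adjoint K * (X * K)) v = qf X (K *\<^sub>v v)"
  using assms inner_adj[of "mat_adjoint K" "X *\<^sub>v (K *\<^sub>v v)" v] by (simp add: qf_def)

lemma qf_gram: "K \<in> M \<Longrightarrow> v \<in> carrier_vec n \<Longrightarrow> qf (mat_adjoint K * K) v = nsq (K *\<^sub>v v)"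
  using qf_conj[of K "1\<^sub>m n" v] by (simp add: qf_def nsq_def)

lemma qf_smult: "A \<in> M \<Longrightarrow> v \<in> carrier_vec n \<Longrightarrow> qf (complex_of_real c \<cdot>\<^sub>m A) v = c * qf A v"
proof -
  assume A: "A \<in> M" and v: "v \<in> carrier_vec n"
  have "(complex_of_real c \<cdot>\<^sub>m A) *\<^sub>v v = complex_of_real c \<cdot>\<^sub>v (A *\<^sub>v v)"
    using A v by (intro eq_vecI) (auto simp: scalar_prod_def sum_distrib_left mult.assoc)
  then show ?thesis using A v by (simp add: qf_def)
qed

lemma qf_add: "A \<in> M \<Longrightarrow> B \<in> M \<Longrightarrow> v \<in> carrier_vec n \<Longrightarrow> qf (A + B) v = qf A v + qf B v"
  unfolding qf_def by (simp add: add_mult_distrib_mat_vec[of _ n n] add_scalar_prod_distrib[of _ n])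

lemma qf_sc: "v \<in> carrier_vec n \<Longrightarrow> qf (sc c) v = c * nsq v"
  unfolding sc_def by (simp add: qf_smult) (simp add: qf_def nsq_def)

lemma qf_ud:
  assumes U: "unitary U" and v: "v \<in> carrier_vec n"
  shows "qf (ud U d) v = (\<Sum>i<n. d i * (cmod ((mat_adjoint U *\<^sub>v v) $ i))\<^sup>2)"
proof -
  let ?w = "mat_adjoint U *\<^sub>v v"
  have w: "?w \<in> carrier_vec n" using U v by simp
  have D: "(dg d *\<^sub>v ?w) $ i = complex_of_real (d i) * ?w $ i" if "i < n" for i
  proof -
    have "(dg d *\<^sub>v w) $ i = (\<Sum>j<n. (if i = j then complex_of_real (d j) else 0) * w $ j)"
      if "w \<in> carrier_vec n" for w
      using that \<open>i < n\<close> by (simp add: scalar_prod_def atLeast0LessThan mat_diag_def carrier_vecD)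
    then have "(dg d *\<^sub>v ?w) $ i = (\<Sum>j<n. (if i = j then complex_of_real (d j) else 0) * ?w $ j)"
      using w by blast
    also have "\<dots> = (\<Sum>j<n. if j = i then complex_of_real (d i) * ?w $ i else 0)"
      by (rule sum.cong) auto
    also have "\<dots> = complex_of_real (d i) * ?w $ i" using that by simp
    finally show ?thesis .
  qed
  have "qf (ud U d) v = qf (dg d) ?w"
    using qf_conj[of "mat_adjoint U" "dg d" v] U v by (simp add: ud_def)
  also have "\<dots> = Re (\<Sum>i<n. (dg d *\<^sub>v ?w) $ i * cnj (?w $ i))"
    unfolding qf_def scalar_prod_def[of _ "conjugate _"] dim_vec_conjugate carrier_vecD[OF w] atLeast0LessThan
    using w by (intro arg_cong[of _ _ Re] sum.cong refl arg_cong2[of _ _ _ _ "(*)"]) (simp del: index_mult_mat_vec add: carrier_matD[OF unitaryD(1)[OF U]])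
  also have "\<dots> = Re (\<Sum>i<n. complex_of_real (d i) * ?w $ i * cnj (?w $ i))"
    by (intro arg_cong[of _ _ Re] sum.cong refl arg_cong2[of _ _ _ _ "(*)"]) (rule D, simp)
  also have "\<dots> = (\<Sum>i<n. d i * (cmod (?w $ i))\<^sup>2)"
    by (simp del: index_mult_mat_vec add: cmod_power2 sum.distrib ring_distribs)
      (simp del: index_mult_mat_vec add: power2_eq_square mult.assoc)
  finally show ?thesis .
qed

lemma qf_ud_col:
  assumes U: "unitary U" and i: "i < n"
  shows "qf (ud U d) (col U i) = d i" and "nsq (col U i) = 1" and "col U i \<noteq> 0\<^sub>v n"
    and "ud U d *\<^sub>v col U i = complex_of_real (d i) \<cdot>\<^sub>v col U i"
proof -
  have c: "col U i \<in> carrier_vec n" using U i by auto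
  have e: "mat_adjoint U *\<^sub>v col U i = unit_vec n i"
  proof -
    have "mat_adjoint U *\<^sub>v col U i = col (mat_adjoint U * U) i"
      using i U by (subst col_mult2[of _ n n _ n]) auto
    then show ?thesis using U i by simp
  qed
  have q: "qf (ud U d) (col U i) = d i" for d
  proof -
    have "qf (ud U d) (col U i) = (\<Sum>j<n. if j = i then d i else 0)"
      unfolding qf_ud[OF U c] e using i by (intro sum.cong) auto
    then show ?thesis using i by simp
  qed
  show "qf (ud U d) (col U i) = d i" by (rule q)
  show 1: "nsq (col U i) = 1" using q[of "\<lambda>_. 1"] c by (simp add: ud_const[OF U] qf_sc)
  then show "col U i \<noteq> 0\<^sub>v n" by (auto simp: nsq_def)
  have "ud U d *\<^sub>v col U i = U *\<^sub>v (dg d *\<^sub>v unit_vec n i)"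
    unfolding ud_def using U c e by simp
  also have "dg d *\<^sub>v unit_vec n i = complex_of_real (d i) \<cdot>\<^sub>v unit_vec n i"
    using i by (intro eq_vecI) (auto simp: mat_diag_def)
  also have "U *\<^sub>v (complex_of_real (d i) \<cdot>\<^sub>v unit_vec n i) = complex_of_real (d i) \<cdot>\<^sub>v (U *\<^sub>v unit_vec n i)"
    using U by (intro mult_mat_vec[of _ n n]) auto
  also have "U *\<^sub>v unit_vec n i = col U i" 
    using U i by (intro eq_vecI) (auto simp: carrier_matD[OF unitaryD(1)])
  finally show "ud U d *\<^sub>v col U i = complex_of_real (d i) \<cdot>\<^sub>v col U i" .
qed

lemma ud_le: "unitary U \<Longrightarrow> ud U d \<preceq> ud U e \<longleftrightarrow> (\<forall>i<n. d i \<le> e i)"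
proof
  assume U: "unitary U"
  show "\<forall>i<n. d i \<le> e i" if "ud U d \<preceq> ud U e"
  proof (intro allI impI)
    fix i assume i: "i < n"
    have "col U i \<in> carrier_vec n" using U i by auto
    then have "qf (ud U d) (col U i) \<le> qf (ud U e) (col U i)" using that by (auto simp: le_def)
    then show "d i \<le> e i" using qf_ud_col(1)[OF U i] by simp
  qed
  show "ud U d \<preceq> ud U e" if "\<forall>i<n. d i \<le> e i"
    unfolding le_def using U that by (auto simp: qf_ud intro!: sum_mono mult_right_mono)
qed

lemma psd_ud: "unitary U \<Longrightarrow> ud U d \<in> psd n \<longleftrightarrow> (\<forall>i<n. 0 \<le> d i)"
proof -
  assume U: "unitary U"
  have z: "ud U (\<lambda>_. 0) = sc 0" using ud_const[OF U, of 0] by simp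
  have "ud U d \<in> psd n \<longleftrightarrow> ud U (\<lambda>_. 0) \<preceq> ud U d"
    using U herm_ud[OF U, of "\<lambda>_. 0"] unfolding psd_iff le_def z by (simp add: qf_sc)
  then show ?thesis using ud_le[OF U] by simp
qed

lemma pd_ud: "unitary U \<Longrightarrow> ud U d \<in> pd n \<longleftrightarrow> (\<forall>i<n. 0 < d i)"
proof
  assume U: "unitary U"
  show "\<forall>i<n. 0 < d i" if "ud U d \<in> pd n"
  proof (intro allI impI)
    fix i assume i: "i < n"
    have "col U i \<in> carrier_vec n" using U i by auto
    then show "0 < d i" using that qf_ud_col[OF U i] by (auto simp: pd_iff)
  qed
  show "ud U d \<in> pd n" if d: "\<forall>i<n. 0 < d i"
    unfolding pd_iff
  proof (intro conjI ballI impI)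
    fix v :: "complex vec" assume v: "v \<in> carrier_vec n" "v \<noteq> 0\<^sub>v n"
    let ?w = "mat_adjoint U *\<^sub>v v"
    have w: "?w \<in> carrier_vec n" using U v by simp
    have "U *\<^sub>v ?w = v" using U v mvec_assoc[of U "mat_adjoint U" v] by simp
    then have "?w \<noteq> 0\<^sub>v n" using v U mat_zero_vec[of U] by auto
    then obtain i where i: "i < n" "?w $ i \<noteq> 0" using w by (metis carrier_vecD eq_vecI index_zero_vec)
    have "0 < (\<Sum>i<n. d i * (cmod (?w $ i))\<^sup>2)"
      using i d by (intro sum_pos2[of _ i]) (auto intro: mult_pos_pos mult_nonneg_nonneg less_imp_le)
    then show "0 < qf (ud U d) v" using qf_ud[OF U v(1)] by simp
  qed (use U in simp)
qed

lemma herm_spectral: "herm A \<Longrightarrow> \<exists>U d. unitary U \<and> A = ud U d"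
  using hermitian_spectral[of A n] unfolding herm_def unitary_def ud_def by blast

lemma psd_spectral: assumes "A \<in> psd n" obtains U d where "unitary U" "A = ud U d" "\<And>i. 0 \<le> d i"
proof -
  obtain U d where U: "unitary U" "A = ud U d" using herm_spectral[of A] assms unfolding psd_iff by auto
  \<comment> \<open>Indices from \<open>n\<close> on do not enter \<open>ud\<close>; the filler 1
    gives the sign condition for every index.\<close>
  let ?d = "\<lambda>i. if i < n then d i else 1"
  have "A = ud U ?d" using U by (auto intro: ud_cong)
  moreover have "0 \<le> ?d i" for i using assms psd_ud[OF U(1)] U by auto
  ultimately show ?thesis using that U by blast
qed

lemma pd_spectral: assumes "A \<in> pd n" obtains U d where "unitary U" "A = ud U d" "\<And>i. 0 < d i"
proof -
  obtain U d where U: "unitary U" "A = ud U d" using herm_spectral[of A] assms unfolding pd_iff by auto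
  let ?d = "\<lambda>i. if i < n then d i else 1"
  have "A = ud U ?d" using U by (auto intro: ud_cong)
  moreover have "0 < ?d i" for i using assms pd_ud[OF U(1)] U by auto
  ultimately show ?thesis using that U by blast
qed

lemma pd_psd [simp]: "A \<in> pd n \<Longrightarrow> A \<in> psd n"
  by (metis pd_spectral psd_ud less_imp_le)

lemma psdD [simp]: "A \<in> psd n \<Longrightarrow> A \<in> M" "A \<in> psd n \<Longrightarrow> mat_adjoint A = A" "A \<in> psd n \<Longrightarrow> herm A"
  unfolding psd_def herm_def by blast+

section \<open>Real powers of semidefinite matrices\<close>

lemma pw_ud:
  assumes U: "unitary U" and d: "\<And>i. i < n \<Longrightarrow> 0 \<le> d i"
  shows "mat_rpow (ud U d) r = ud U (\<lambda>i. d i powr r)"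
proof (cases "r < 0")
  case True
  have "mat_rpow (ud U d) r = ud U (\<lambda>i. inverse (d i) powr (- r))"
    using True U by (simp add: mat_rpow_def ginv_def mat_fun_ud)
  also have "\<dots> = ud U (\<lambda>i. d i powr r)"
  proof (rule ud_cong)
    fix i assume "i < n"
    show "inverse (d i) powr (- r) = d i powr r"
    proof (cases "d i = 0")
      case False
      then have "d i > 0" using d[OF \<open>i < n\<close>] by simp
      then show ?thesis by (simp add: powr_def ln_inverse)
    qed simp
  qed
  finally show ?thesis .
qed (use U in \<open>simp add: mat_rpow_def mat_fun_ud\<close>)

lemma pw_psd [simp]: "A \<in> psd n \<Longrightarrow> mat_rpow A r \<in> psd n"
  by (erule psd_spectral) (simp add: pw_ud psd_ud)
lemma pw_pd [simp]: "A \<in> pd n \<Longrightarrow> mat_rpow A r \<in> pd n"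
  by (erule pd_spectral) (simp add: pw_ud pd_ud less_imp_le, metis less_irrefl)
text \<open>The exponents may have any sign and \<open>A\<close> may be singular, because every
  power vanishes on the kernel. The price is that \<open>A^0\<close> is the support projection,
  which equals the identity for definite \<open>A\<close> (\<open>pw_0\<close>).\<close>

lemma pw_mult [simp]: "A \<in> psd n \<Longrightarrow> mat_rpow A r * mat_rpow A s = mat_rpow A (r + s)"
  by (erule psd_spectral) (simp add: pw_ud powr_add)
lemma pw_mult' [simp]: "A \<in> psd n \<Longrightarrow> B \<in> M \<Longrightarrow> mat_rpow A r * (mat_rpow A s * B) = mat_rpow A (r + s) * B"
  by (rule mult_collapse[OF pw_mult]) simp_all
lemma pw_pw [simp]: "A \<in> psd n \<Longrightarrow> mat_rpow (mat_rpow A r) s = mat_rpow A (r * s)"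
  by (erule psd_spectral) (simp add: pw_ud powr_powr)
lemma pw_1 [simp]: "A \<in> psd n \<Longrightarrow> mat_rpow A 1 = A"
  by (erule psd_spectral) (simp add: pw_ud)
lemma pw_0 [simp]: "A \<in> pd n \<Longrightarrow> mat_rpow A 0 = 1\<^sub>m n"
proof (erule pd_spectral)
  fix U d assume U: "unitary U" and A: "A = ud U d" and d: "\<And>i. 0 < d i"
  have "d i \<noteq> 0" for i using d[of i] by simp
  then show "mat_rpow A 0 = 1\<^sub>m n"
    unfolding A using U d by (simp add: pw_ud less_imp_le ud_const sc_one)
qed

lemma psd_gram [simp]: assumes "K \<in> M" "X \<in> psd n" shows "mat_adjoint K * (X * K) \<in> psd n"
  unfolding psd_iff
proof (intro conjI ballI)
  show "herm (mat_adjoint K * (X * K))" using assms by (intro hermI) simp_all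
  fix v :: "complex vec" assume "v \<in> carrier_vec n"
  then show "0 \<le> qf (mat_adjoint K * (X * K)) v" using assms by (simp add: qf_conj) (simp add: psd_iff)
qed

lemma psd_one [simp]: "1\<^sub>m n \<in> psd n" using psd_ud[of "1\<^sub>m n" "\<lambda>_. 1"] ud_const[of "1\<^sub>m n" 1] by (simp add: unitary_def sc_one)
lemma psd_gram1: "K \<in> M \<Longrightarrow> mat_adjoint K * K \<in> psd n" using psd_gram[of K "1\<^sub>m n"] by simp

lemma le_trans [trans]: "X \<preceq> Y \<Longrightarrow> Y \<preceq> Z \<Longrightarrow> X \<preceq> Z" unfolding le_def by fastforce
lemma le_refl: "herm X \<Longrightarrow> X \<preceq> X" by (simp add: le_def)
lemma le_conj: "X \<preceq> Y \<Longrightarrow> K \<in> M \<Longrightarrow> mat_adjoint K * (X * K) \<preceq> mat_adjoint K * (Y * K)"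
  unfolding le_def by (auto simp: qf_conj intro!: hermI)
lemma le_conj_herm: "X \<preceq> Y \<Longrightarrow> herm K \<Longrightarrow> K * (X * K) \<preceq> K * (Y * K)"
  using le_conj[of X Y K] by simp
lemma herm_sc [simp]: "herm (sc c)" by (rule hermI) (simp_all add: sc_def)

lemma pd_le: assumes A: "A \<in> pd n" and "A \<preceq> B" shows "B \<in> pd n"
  using assms unfolding pd_iff le_def by fastforce

text \<open>\<open>Z\<close> intertwines \<open>mat_adjoint Z * Z\<close> with
  \<open>Z * mat_adjoint Z\<close>, hence also their powers. This trades an exponent in [0,1] for
  one in [-1,0], where powers reverse the order; the Furuta and Ando-Hiai arguments live on this
  exchange.\<close>

lemma pw_gram:
  assumes Z: "Z \<in> M"
  shows "Z * (mat_rpow (mat_adjoint Z * Z) t * mat_adjoint Z) = mat_rpow (Z * mat_adjoint Z) (t + 1)"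
proof -
  have a: "mat_adjoint Z * Z \<in> psd n" "Z * mat_adjoint Z \<in> psd n"
    using psd_gram1[of Z] psd_gram1[of "mat_adjoint Z"] Z by auto
  obtain U d where U: "unitary U" "mat_adjoint Z * Z = ud U d" "\<And>i. 0 \<le> d i" using a psd_spectral by metis
  obtain V e where V: "unitary V" "Z * mat_adjoint Z = ud V e" "\<And>i. 0 \<le> e i" using a psd_spectral by metis
  have "Z * ud U d = ud V e * Z" using Z by (simp flip: U(2) V(2))
  then have "Z * ud U (\<lambda>i. d i powr t) = ud V (\<lambda>i. e i powr t) * Z"
    by (rule ud_intertwine[OF U(1) V(1) Z])
  then have "Z * mat_rpow (mat_adjoint Z * Z) t = mat_rpow (Z * mat_adjoint Z) t * Z"
    using U V by (simp add: pw_ud)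
  then have "Z * (mat_rpow (mat_adjoint Z * Z) t * mat_adjoint Z) = mat_rpow (Z * mat_adjoint Z) t * (Z * mat_adjoint Z)"
    using Z a by (simp flip: massoc)
  also have "\<dots> = mat_rpow (Z * mat_adjoint Z) t * mat_rpow (Z * mat_adjoint Z) 1" using a by (simp del: pw_mult)
  also have "\<dots> = mat_rpow (Z * mat_adjoint Z) (t + 1)" using a by (simp del: pw_1)
  finally show ?thesis .
qed

text \<open>Conjugating the hypothesis by the adjoint of \<open>K\<close> gives
  \<open>P * P \<preceq> c P\<close> for P = \<open>K * mat_adjoint K\<close>, so each eigenvalue
  satisfies \<open>e * e \<le> c * e\<close>.\<close>

lemma contraction_swap:
  assumes K: "K \<in> M" and le: "mat_adjoint K * K \<preceq> sc c" and c: "0 \<le> c"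
  shows "K * mat_adjoint K \<preceq> sc c"
proof -
  have "K * mat_adjoint K \<in> psd n" using psd_gram1[of "mat_adjoint K"] K by simp
  then obtain V e where V: "unitary V" "K * mat_adjoint K = ud V e" using psd_spectral by metis
  have "mat_adjoint (mat_adjoint K) * ((mat_adjoint K * K) * mat_adjoint K) \<preceq> mat_adjoint (mat_adjoint K) * (sc c * mat_adjoint K)"
    using le K by (intro le_conj) auto
  then have "(K * mat_adjoint K) * (K * mat_adjoint K) \<preceq> complex_of_real c \<cdot>\<^sub>m (K * mat_adjoint K)" using K by simp
  then have "ud V (\<lambda>i. e i * e i) \<preceq> ud V (\<lambda>i. c * e i)" using V(1) by (simp add: V(2) ud_smult)
  then have "i < n \<Longrightarrow> e i * e i \<le> c * e i" for i using ud_le[OF V(1)] by simp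
  then have "i < n \<Longrightarrow> e i \<le> c" for i using c 
    by (metis linorder_not_le mult_le_cancel_right order_le_less_trans)
  then show ?thesis unfolding V(2) using ud_le[OF V(1), of e "\<lambda>_. c"] ud_const[OF V(1)] by simp
qed

end

section \<open>Operator inequalities\<close>

context sqmat begin

section \<open>Monotonicity of powers: the Loewner-Heinz inequality\<close>

lemma pw_mult1 [simp]:
  assumes "A \<in> psd n"
  shows "A * mat_rpow A s = mat_rpow A (1 + s)" "mat_rpow A s * A = mat_rpow A (s + 1)"
  using pw_mult[OF assms, of 1 s] pw_mult[OF assms, of s 1] assms by (simp_all del: pw_mult)

lemma pw_mult1' [simp]:
  assumes "A \<in> psd n" "X \<in> M"
  shows "A * (mat_rpow A s * X) = mat_rpow A (1 + s) * X" "mat_rpow A s * (A * X) = mat_rpow A (s + 1) * X"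
  using assms by (auto intro!: mult_collapse)

text \<open>A zero eigenvalue contributes the constant 0, even at exponent 0, by the convention
  \<open>0 powr t = 0\<close>.\<close>

lemma continuous_qf_pw:
  assumes A: "A \<in> psd n" and v: "v \<in> carrier_vec n"
  shows "continuous_on UNIV (\<lambda>t. qf (mat_rpow A t) v)"
proof -
  obtain U d where U: "unitary U" "A = ud U d" "\<And>i. 0 \<le> d i" using psd_spectral[OF A] by metis
  have c: "continuous_on UNIV (\<lambda>t. d i powr t)" for i
    by (cases "d i = 0") (auto intro!: continuous_intros)
  have "continuous_on UNIV (\<lambda>t. \<Sum>i<n. d i powr t * (cmod ((mat_adjoint U *\<^sub>v v) $ i))\<^sup>2)"
    by (intro continuous_intros c)
  then show ?thesis using U v by (simp add: pw_ud qf_ud)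
qed

lemma ud_le_sc: "unitary U \<Longrightarrow> ud U d \<preceq> sc c \<longleftrightarrow> (\<forall>i<n. d i \<le> c)"
  using ud_le[of U d "\<lambda>_. c"] by (simp add: ud_const)

lemma sc_le_ud: "unitary U \<Longrightarrow> sc c \<preceq> ud U d \<longleftrightarrow> (\<forall>i<n. c \<le> d i)"
  using ud_le[of U "\<lambda>_. c" d] by (simp add: ud_const)

text \<open>
  With \<open>S, T\<close> the contractions coming from the two hypotheses, \<open>T\<^sup>* S\<close> is similar to
  the positive matrix that has to be bounded, so its eigenvalues are at most 1.
\<close>

lemma loewner_heinz_midpoint:
  assumes A: "A \<in> psd n" and B: "B \<in> pd n"
    and s: "mat_rpow A s \<preceq> mat_rpow B s" and t: "mat_rpow A t \<preceq> mat_rpow B t"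
  shows "mat_rpow A ((s + t) / 2) \<preceq> mat_rpow B ((s + t) / 2)"
proof -
  have B': "B \<in> psd n" using B by simp
  let ?c = "\<lambda>s. mat_rpow A (s/2) * mat_rpow B (- s/2)"
  have contr: "mat_adjoint (?c s) * ?c s \<preceq> sc 1" if "mat_rpow A s \<preceq> mat_rpow B s" for s
    using le_conj_herm[OF that, of "mat_rpow B (- s/2)"] A B by (simp add: sc_one)
  define S where "S = ?c s"
  define T where "T = ?c t"
  have ST [simp]: "S \<in> M" "T \<in> M" using A B by (simp_all add: S_def T_def)
  have "mat_adjoint S * S \<preceq> sc 1" "T * mat_adjoint T \<preceq> sc 1"
    using contr[OF s] contraction_swap[of T 1] contr[OF t, folded T_def] unfolding S_def[symmetric] by simp_all
  define K where "K = mat_adjoint T * S"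
  have K [simp]: "K \<in> M" by (simp add: K_def)
  have "mat_adjoint K * K = mat_adjoint S * ((T * mat_adjoint T) * S)" by (simp add: K_def)
  also have "\<dots> \<preceq> mat_adjoint S * (sc 1 * S)"
    by (rule le_conj) (use \<open>T * mat_adjoint T \<preceq> sc 1\<close> in simp_all)
  also have "mat_adjoint S * (sc 1 * S) \<preceq> sc 1" using \<open>mat_adjoint S * S \<preceq> sc 1\<close> by (simp add: sc_one)
  finally have KK: "mat_adjoint K * K \<preceq> sc 1" .
  let ?b = "mat_rpow B (- (s + t) / 4)"
  \<comment> \<open>\<open>H\<close> is the matrix to be bounded by 1: conjugating with B^((s+t)/4)
    turns this bound into the claim.\<close>
  define H where "H = ?b * (mat_rpow A ((s + t)/2) * ?b)"
  define G where "G = mat_rpow B ((s - t) / 4)"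
  have G [simp]: "G \<in> M" using B by (simp add: G_def)
  have H: "H \<in> psd n" using psd_gram[of ?b "mat_rpow A ((s + t)/2)"] A B by (simp add: H_def)
  have GH: "G * H = K * G"
  proof -
    have "G * H = mat_rpow B (- t/2) * (mat_rpow A ((s+t)/2) * ?b)"
      using A B by (simp add: G_def H_def add_divide_distrib diff_divide_distrib)
    moreover have "K * G = mat_rpow B (- t/2) * (mat_rpow A ((s+t)/2) * ?b)"
      using A B by (simp add: G_def K_def S_def T_def add_divide_distrib diff_divide_distrib add.commute)
    ultimately show ?thesis by simp
  qed
  obtain W h where W: "unitary W" "H = ud W h" "\<And>i. 0 \<le> h i" using psd_spectral[OF H] by metis
  have h1: "h i \<le> 1" if i: "i < n" for i
  proof -
    \<comment> \<open>\<open>G\<close> carries an eigenvector of \<open>H\<close> to an eigenvector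
      \<open>y\<close> of \<open>K\<close> with the same eigenvalue, and \<open>K\<close> is a
      contraction.\<close>
    define y where "y = G *\<^sub>v col W i"
    have cW: "col W i \<in> carrier_vec n" using W i by auto
    have y: "y \<in> carrier_vec n" unfolding y_def using cW by simp
    have "mat_rpow B (- ((s - t) / 4)) * G = 1\<^sub>m n" unfolding G_def pw_mult[OF B'] using B by simp
    then have "mat_rpow B (- ((s - t) / 4)) *\<^sub>v y = col W i"
      unfolding y_def using B' cW by (simp flip: mvec_assoc)
    then have "y \<noteq> 0\<^sub>v n" using qf_ud_col(3)[OF W(1) i] mat_zero_vec[of "mat_rpow B (- ((s - t) / 4))"] B' by auto
    then have ny: "0 < nsq y" using nsq_pos y by blast
    have "K *\<^sub>v y = (G * H) *\<^sub>v col W i" unfolding GH y_def using cW by simp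
    also have "\<dots> = G *\<^sub>v (complex_of_real (h i) \<cdot>\<^sub>v col W i)"
      using cW H qf_ud_col(4)[OF W(1) i, of h] by (simp add: W(2))
    also have "\<dots> = complex_of_real (h i) \<cdot>\<^sub>v y" unfolding y_def using G cW by (rule mult_mat_vec)
    finally have Ky: "K *\<^sub>v y = complex_of_real (h i) \<cdot>\<^sub>v y" .
    have "nsq (K *\<^sub>v y) \<le> nsq y" using KK y by (auto simp: le_def qf_gram qf_sc)
    also have "nsq (K *\<^sub>v y) = (h i)\<^sup>2 * nsq y" unfolding Ky
      by (simp add: nsq_sum norm_mult power_mult_distrib sum_distrib_left)
    finally have "(h i)\<^sup>2 \<le> 1\<^sup>2" using ny by simp
    then show ?thesis by (rule power2_le_imp_le) simp
  qed
  then have "H \<preceq> sc 1" unfolding W(2) using ud_le_sc[OF W(1)] by simp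
  define g where "g = (s + t) / 4"
  have g: "- (s + t) / 4 = - g" "g + g = (s + t) / 2" by (simp_all add: g_def field_simps)
  have "mat_rpow B g * (H * mat_rpow B g) \<preceq> mat_rpow B g * (sc 1 * mat_rpow B g)"
    by (rule le_conj_herm[OF \<open>H \<preceq> sc 1\<close>]) (use B in simp)
  then show ?thesis using A B unfolding H_def g(1) by (simp add: g(2) sc_one)
qed

text \<open>The set of admissible exponents is closed by continuity, contains 0 and 1, and is stable
  under midpoints. If \<open>t\<close> were missing, the midpoint of the gap (u,w) around
  \<open>t\<close> would lie in the set.\<close>

theorem loewner_heinz:
  assumes A: "A \<in> psd n" and B: "B \<in> pd n" and le: "A \<preceq> B" and t: "0 \<le> t" "t \<le> 1"
  shows "mat_rpow A t \<preceq> mat_rpow B t"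
proof (rule ccontr)
  let ?g = "\<lambda>v t. qf (mat_rpow B t) v - qf (mat_rpow A t) v"
  define I where "I = {t. mat_rpow A t \<preceq> mat_rpow B t}"
  have B': "B \<in> psd n" using B by simp
  have "I = (\<Inter>v\<in>carrier_vec n. {t. 0 \<le> ?g v t})" using A B unfolding I_def le_def by auto
  moreover have "closed {t. 0 \<le> ?g v t}" if "v \<in> carrier_vec n" for v
    by (intro closed_Collect_le continuous_intros continuous_qf_pw A B' that)
  ultimately have cl: "closed I" by auto
  \<comment> \<open>For singular \<open>A\<close> this power is a projection, so only an inequality
    is available.\<close>
  have "mat_rpow A 0 \<preceq> sc 1"
  proof -
    obtain U d where U: "unitary U" "A = ud U d" "\<And>i. 0 \<le> d i" using psd_spectral[OF A] by metis
    then show ?thesis by (simp add: pw_ud ud_le_sc)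
  qed
  then have 0: "0 \<in> I" using B by (simp add: I_def sc_one)
  have 1: "1 \<in> I" using A B le by (simp add: I_def)
  assume "\<not> ?thesis"
  then have tI: "t \<notin> I" by (simp add: I_def)
  define u where "u = Sup (I \<inter> {0..t})"
  define w where "w = Inf (I \<inter> {t..1})"
  have "u \<in> I \<inter> {0..t}" unfolding u_def
    by (rule closed_contains_Sup) (use 0 t cl in auto)
  moreover have "w \<in> I \<inter> {t..1}" unfolding w_def
    by (rule closed_contains_Inf) (use 1 t cl in auto)
  ultimately have uw: "u \<in> I" "w \<in> I" "0 \<le> u" "u < t" "t < w" "w \<le> 1" using tI by (auto simp: less_le)
  then have m: "(u + w) / 2 \<in> I" using loewner_heinz_midpoint[OF A B, of u w] by (simp add: I_def)
  show False
  proof (cases "(u + w) / 2 \<le> t")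
    case True
    then have "(u + w) / 2 \<le> Sup (I \<inter> {0..t})" using m uw by (intro cSup_upper) auto
    then show False using uw by (simp flip: u_def)
  next
    case False
    then have "Inf (I \<inter> {t..1}) \<le> (u + w) / 2" using m uw by (intro cInf_lower) auto
    then show False using uw by (simp flip: w_def)
  qed
qed

text \<open>Conjugation by B^(-1/2) makes K = A^(1/2) B^(-1/2) a contraction; the swapped bound
  A^(1/2) B^(-1) A^(1/2) \<le> 1 is the claim up to a conjugation by A^(-1/2).\<close>

lemma inverse_antimono:
  assumes A: "A \<in> pd n" and le: "A \<preceq> B"
  shows "mat_rpow B (-1) \<preceq> mat_rpow A (-1)"
proof -
  have B: "B \<in> pd n" using pd_le[OF A le] .
  have p: "A \<in> psd n" "B \<in> psd n" using A B by simp_all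
  define K where "K = mat_rpow A (1/2) * mat_rpow B (-1/2)"
  have K: "K \<in> M" using p by (simp add: K_def)
  have "mat_rpow B (-1/2) * (A * mat_rpow B (-1/2)) \<preceq> mat_rpow B (-1/2) * (B * mat_rpow B (-1/2))"
    by (rule le_conj_herm[OF le]) (use p in simp)
  then have "mat_adjoint K * K \<preceq> sc 1" using p B by (simp add: K_def sc_one)
  then have "K * mat_adjoint K \<preceq> sc 1" using K by (intro contraction_swap) simp_all
  then have "mat_rpow A (-1/2) * ((K * mat_adjoint K) * mat_rpow A (-1/2)) \<preceq> mat_rpow A (-1/2) * (sc 1 * mat_rpow A (-1/2))"
    by (rule le_conj_herm) (use p in simp)
  then show ?thesis using p A by (simp add: K_def sc_one)
qed

lemma power_antimono:
  assumes A: "A \<in> pd n" and le: "A \<preceq> B" and t: "-1 \<le> t" "t \<le> 0"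
  shows "mat_rpow B t \<preceq> mat_rpow A t"
proof -
  have B: "B \<in> pd n" using pd_le[OF A le] .
  have "mat_rpow (mat_rpow B (-1)) (- t) \<preceq> mat_rpow (mat_rpow A (-1)) (- t)"
    by (rule loewner_heinz) (use A B t inverse_antimono[OF A le] in simp_all)
  then show ?thesis using A B by simp
qed

section \<open>The Furuta inequality\<close>

lemma pd_conj:
  assumes A: "A \<in> pd n" and B: "B \<in> pd n"
  shows "mat_rpow A x * (B * mat_rpow A x) \<in> pd n"
  unfolding pd_iff
proof (intro conjI ballI impI)
  show "herm (mat_rpow A x * (B * mat_rpow A x))" by (rule hermI) (use A B in simp_all)
  fix v :: "complex vec" assume v: "v \<in> carrier_vec n" "v \<noteq> 0\<^sub>v n"
  have "mat_rpow A (- x) *\<^sub>v (mat_rpow A x *\<^sub>v v) = v"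
    using A v by (simp flip: mvec_assoc)
  then have "mat_rpow A x *\<^sub>v v \<noteq> 0\<^sub>v n" using v mat_zero_vec[of "mat_rpow A (- x)"] A by auto
  moreover have "qf (mat_rpow A x * (B * mat_rpow A x)) v = qf B (mat_rpow A x *\<^sub>v v)"
    using qf_conj[of "mat_rpow A x" B v] A B v by simp
  ultimately show "0 < qf (mat_rpow A x * (B * mat_rpow A x)) v"
    using B A v by (simp add: pd_iff)
qed

lemma psd_conj: "A \<in> psd n \<Longrightarrow> B \<in> psd n \<Longrightarrow> mat_rpow A x * (B * mat_rpow A x) \<in> psd n"
  using psd_gram[of "mat_rpow A x" B] by simp

text \<open>With Z = E^(r/2) F^(s/2), Loewner-Heinz for r \<le> 1 gives Z^H Z \<ge> F^(s+r). In (Z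
  Z^H)^\<theta> = Z (Z^H Z)^(\<theta>-1) Z^H the inner exponent lies in [-1,0] and reverses this
  bound. The value of \<theta> is the one for which the powers of \<open>F\<close> add up to
  exponent 1, so that \<open>F \<preceq> E\<close> applies.\<close>

lemma furuta_01:
  assumes E: "E \<in> pd n" and F: "F \<in> pd n" and le: "F \<preceq> E"
    and r: "0 \<le> r" "r \<le> 1" and s: "1 \<le> s"
  shows "mat_rpow (mat_rpow E (r/2) * (mat_rpow F s * mat_rpow E (r/2))) ((1 + r) / (s + r)) \<preceq> mat_rpow E (1 + r)"
proof -
  define \<theta> where "\<theta> = (1 + r) / (s + r)"
  have \<theta>: "0 < \<theta>" "\<theta> \<le> 1" and st: "(s + r) * \<theta> = 1 + r" using r s by (auto simp: \<theta>_def)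
  have p: "E \<in> psd n" "F \<in> psd n" using E F by simp_all
  define Z where "Z = mat_rpow E (r/2) * mat_rpow F (s/2)"
  have Z [simp]: "Z \<in> M" using p by (simp add: Z_def)
  have "mat_rpow F (s/2) * (mat_rpow F r * mat_rpow F (s/2)) \<preceq> mat_rpow F (s/2) * (mat_rpow E r * mat_rpow F (s/2))"
    by (intro le_conj_herm loewner_heinz) (use E p le r in simp_all)
  then have 1: "mat_rpow F (s + r) \<preceq> mat_adjoint Z * Z" using p by (simp add: Z_def add.commute)
  have 2: "mat_rpow (mat_adjoint Z * Z) (\<theta> - 1) \<preceq> mat_rpow (mat_rpow F (s + r)) (\<theta> - 1)"
    by (rule power_antimono) (use F 1 \<theta> in simp_all)
  have "mat_rpow (Z * mat_adjoint Z) \<theta> = mat_adjoint (mat_adjoint Z) * (mat_rpow (mat_adjoint Z * Z) (\<theta> - 1) * mat_adjoint Z)"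
    using pw_gram[of Z "\<theta> - 1"] by simp
  also have "\<dots> \<preceq> mat_adjoint (mat_adjoint Z) * (mat_rpow (mat_rpow F (s + r)) (\<theta> - 1) * mat_adjoint Z)"
    by (rule le_conj[OF 2]) simp
  also have "\<dots> = mat_rpow E (r/2) * (mat_rpow F (s/2 + (s + r) * (\<theta> - 1) + s/2) * mat_rpow E (r/2))"
    using p by (simp add: Z_def add_ac)
  also have "s/2 + (s + r) * (\<theta> - 1) + s/2 = 1" using st by (simp add: algebra_simps)
  also have "mat_rpow E (r/2) * (mat_rpow F 1 * mat_rpow E (r/2)) \<preceq> mat_rpow E (r/2) * (E * mat_rpow E (r/2))"
    by (rule le_conj_herm) (use p le in simp_all)
  also have "\<dots> = mat_rpow E (1 + r)" using p by (simp add: add_ac)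
  finally show ?thesis using p by (simp add: Z_def \<theta>_def)
qed

text \<open>Bootstrapping on the size of \<open>r\<close>: the inequality for \<open>q\<close> reads
  X^\<theta> \<le> E^(1+q). Applying the case of exponent 1 to this pair, with 1/\<theta> in the
  role of \<open>s\<close>, restores X and yields the inequality for r = 2q + 1.\<close>

theorem furuta:
  assumes E: "E \<in> pd n" and F: "F \<in> pd n" and le: "F \<preceq> E" and r: "0 \<le> r" and s: "1 \<le> s"
  shows "mat_rpow (mat_rpow E (r/2) * (mat_rpow F s * mat_rpow E (r/2))) ((1 + r) / (s + r)) \<preceq> mat_rpow E (1 + r)"
proof -
  have p: "E \<in> psd n" "F \<in> psd n" using E F by simp_all
  have "mat_rpow (mat_rpow E (r/2) * (mat_rpow F s * mat_rpow E (r/2))) ((1 + r) / (s + r)) \<preceq> mat_rpow E (1 + r)"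
    if "r \<le> 2 ^ m" "0 \<le> r" for m r
    using that
  proof (induction m arbitrary: r)
    case 0
    then show ?case using furuta_01[OF E F le] s by simp
  next
    case (Suc m)
    show ?case
    proof (cases "r \<le> 1")
      case True
      then show ?thesis using furuta_01[OF E F le] s Suc by simp
    next
      case False
      define q where "q = (r - 1) / 2"
      have q: "0 \<le> q" "q \<le> 2 ^ m" "r = 2 * q + 1" using Suc False by (auto simp: q_def field_simps)
      define \<theta> where "\<theta> = (1 + q) / (s + q)"
      have \<theta>: "0 < \<theta>" "\<theta> \<le> 1" using q s by (auto simp: \<theta>_def)
      define X where "X = mat_rpow E (q/2) * (mat_rpow F s * mat_rpow E (q/2))"
      have X: "X \<in> pd n" unfolding X_def using E F by (intro pd_conj) simp_all
      have "mat_rpow X \<theta> \<preceq> mat_rpow E (1 + q)" unfolding X_def \<theta>_def by (rule Suc.IH) (use q in simp_all)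
      then have "mat_rpow (mat_rpow (mat_rpow E (1 + q)) (1/2) * (mat_rpow (mat_rpow X \<theta>) (1/\<theta>) * mat_rpow (mat_rpow E (1 + q)) (1/2)))
          ((1 + 1) / (1/\<theta> + 1)) \<preceq> mat_rpow (mat_rpow E (1 + q)) (1 + 1)"
        by (intro furuta_01) (use E X \<theta> in simp_all)
      then have 1: "mat_rpow (mat_rpow E ((1 + q)/2) * (X * mat_rpow E ((1 + q)/2))) (2 / (1/\<theta> + 1)) \<preceq> mat_rpow E ((1 + q) * 2)"
        using p X \<theta> by simp
      have 2: "2 / (1/\<theta> + 1) = (1 + r) / (s + r)"
        unfolding \<theta>_def q(3) using q s by (simp add: field_simps)
      have e: "(1 + q)/2 + q/2 = r/2" "q/2 + (1 + q)/2 = r/2" unfolding q(3) by (simp_all add: field_simps)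
      have 3: "mat_rpow E ((1 + q)/2) * (X * mat_rpow E ((1 + q)/2)) = mat_rpow E (r/2) * (mat_rpow F s * mat_rpow E (r/2))"
        using p unfolding X_def by (simp add: e)
      have "(1 + q) * 2 = 1 + r" unfolding q(3) by simp
      with 1 show ?thesis unfolding 2 3 by (simp only:)
    qed
  qed
  moreover obtain m :: nat where "r < 2 ^ m" using real_arch_pow[of 2 r] by auto
  ultimately show ?thesis using r less_imp_le by blast
qed


section \<open>The Ando-Hiai inequality\<close>

text \<open>This is \<open>A #\<^sub>\<alpha> B \<le> 1\<close> with the outer factors moved to the right.\<close>

definition gm_le_one :: "real \<Rightarrow> complex mat \<Rightarrow> complex mat \<Rightarrow> bool" where
  "gm_le_one \<alpha> A B \<longleftrightarrow> mat_rpow (mat_rpow A (-1/2) * (B * mat_rpow A (-1/2))) \<alpha> \<preceq> mat_rpow A (-1)"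

text \<open>With C = A^(-1/2) B A^(-1/2) the hypothesis reads C^\<alpha> \<le> A^(-1), or A \<le>
  C^(-\<alpha>). It enters three times: to bound B^r, written as Z (Z^H Z)^(r-1) Z^H, by Z
  C^((1-\<alpha>)(r-1)) Z^H; to bound A^(1-r) from below by a power of C; and at the end to replace
  C^\<alpha> by A^(-1). The range of \<open>r\<close> keeps r - 1 in [0,1].\<close>

lemma ando_hiai_12:
  assumes A: "A \<in> pd n" and B: "B \<in> pd n" and \<alpha>: "0 < \<alpha>" "\<alpha> \<le> 1" and gm_le_one: "gm_le_one \<alpha> A B" and r: "1 \<le> r" "r \<le> 2"
  shows "gm_le_one \<alpha> (mat_rpow A r) (mat_rpow B r)"
proof -
  define C where "C = mat_rpow A (-1/2) * (B * mat_rpow A (-1/2))"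
  have C: "C \<in> pd n" unfolding C_def using A B by (rule pd_conj)
  have p: "A \<in> psd n" "B \<in> psd n" "C \<in> psd n" using A B C by simp_all
  have CA: "mat_rpow C \<alpha> \<preceq> mat_rpow A (-1)" using gm_le_one by (simp add: gm_le_one_def C_def)
  have "mat_rpow (mat_rpow A (-1)) (-1) \<preceq> mat_rpow (mat_rpow C \<alpha>) (-1)"
    by (rule inverse_antimono) (use C CA in simp_all)
  then have AC: "A \<preceq> mat_rpow C (-\<alpha>)" using p by simp
  define Z where "Z = mat_rpow A (1/2) * mat_rpow C (1/2)"
  have Z [simp]: "Z \<in> M" using p by (simp add: Z_def)
  have ZZ: "Z * mat_adjoint Z = B" using A p by (simp add: Z_def) (simp add: C_def)
  define Q where "Q = mat_rpow (mat_adjoint Z * Z) (r - 1)"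
  have Zpsd: "mat_adjoint Z * Z \<in> psd n" by (rule psd_gram1) simp
  have Q [simp]: "Q \<in> psd n" unfolding Q_def using Zpsd by simp
  have "mat_adjoint Z * Z = mat_rpow C (1/2) * (A * mat_rpow C (1/2))" using p by (simp add: Z_def)
  also have "\<dots> \<preceq> mat_rpow C (1/2) * (mat_rpow C (-\<alpha>) * mat_rpow C (1/2))"
    by (rule le_conj_herm[OF AC]) (use p in simp)
  also have "\<dots> = mat_rpow C (1 - \<alpha>)" using p by simp
  finally have "Q \<preceq> mat_rpow (mat_rpow C (1 - \<alpha>)) (r - 1)"
    unfolding Q_def by (intro loewner_heinz Zpsd) (use C r in simp_all)
  then have QC: "Q \<preceq> mat_rpow C ((1 - \<alpha>) * (r - 1))" using p by simp
  have Br: "mat_rpow B r = Z * (Q * mat_adjoint Z)"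
    using pw_gram[of Z "r - 1"] by (simp add: ZZ Q_def)
  \<comment> \<open>The bound on B^r turns A^(-r/2) B^r A^(-r/2) into at most A^a C^\<kappa> A^a.
    This \<kappa> satisfies \<kappa> + \<alpha>(r-1) = r and \<kappa> + r(\<alpha>-1) = \<alpha>,
    which makes the powers of \<open>C\<close> collapse in the two estimates below.\<close>
  define \<kappa> where "\<kappa> = 1 + (1 - \<alpha>) * (r - 1)"
  define a where "a = (1 - r) / 2"
  define K where "K = mat_rpow C (1/2) * mat_rpow A a"
  have K [simp]: "K \<in> M" using p by (simp add: K_def)
  have ea: "- r / 2 + 1/2 = a" "1/2 - r/2 = a" "1/2 + - (r/2) = a" by (simp_all add: a_def field_simps)
  have 1: "mat_rpow A (-r/2) * (mat_rpow B r * mat_rpow A (-r/2)) = mat_adjoint K * (Q * K)"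
    unfolding Br using p by (simp add: Z_def K_def ea)
  define Z2 where "Z2 = mat_rpow A a * mat_rpow C (\<kappa>/2)"
  have Z2 [simp]: "Z2 \<in> M" using p by (simp add: Z2_def)
  have "mat_adjoint K * (Q * K) \<preceq> mat_adjoint K * (mat_rpow C ((1 - \<alpha>) * (r - 1)) * K)"
    by (rule le_conj[OF QC]) simp
  also have "\<dots> = mat_rpow A a * (mat_rpow C (1/2 + ((1 - \<alpha>) * (r - 1) + 1/2)) * mat_rpow A a)"
    using p by (simp add: K_def)
  also have "1/2 + ((1 - \<alpha>) * (r - 1) + 1/2) = \<kappa>" by (simp add: \<kappa>_def)
  also have "mat_rpow A a * (mat_rpow C \<kappa> * mat_rpow A a) = Z2 * mat_adjoint Z2"
    using p by (simp add: Z2_def)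
  finally have 2: "mat_adjoint K * (Q * K) \<preceq> Z2 * mat_adjoint Z2" .
  have Z2pd: "Z2 * mat_adjoint Z2 \<in> pd n"
    using pd_conj[of A "mat_rpow C \<kappa>" a] A C p by (simp add: Z2_def)
  have KQK: "mat_adjoint K * (Q * K) \<in> psd n" by (rule psd_gram) simp_all
  have 3: "mat_rpow (mat_adjoint K * (Q * K)) \<alpha> \<preceq> mat_rpow (Z2 * mat_adjoint Z2) \<alpha>"
    by (rule loewner_heinz[OF KQK Z2pd 2]) (use \<alpha> in simp_all)
  have "mat_rpow (mat_rpow C (-\<alpha>)) (1 - r) \<preceq> mat_rpow A (1 - r)"
    by (rule power_antimono[OF A AC]) (use r in simp_all)
  then have "mat_rpow C (\<kappa>/2) * (mat_rpow (mat_rpow C (-\<alpha>)) (1 - r) * mat_rpow C (\<kappa>/2))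
      \<preceq> mat_rpow C (\<kappa>/2) * (mat_rpow A (1 - r) * mat_rpow C (\<kappa>/2))"
    by (rule le_conj_herm) (use p in simp)
  also have "mat_rpow C (\<kappa>/2) * (mat_rpow (mat_rpow C (-\<alpha>)) (1 - r) * mat_rpow C (\<kappa>/2))
      = mat_rpow C (\<kappa>/2 + (- \<alpha> * (1 - r) + \<kappa>/2))" using p by simp
  also have "\<kappa>/2 + (- \<alpha> * (1 - r) + \<kappa>/2) = r" by (simp add: \<kappa>_def algebra_simps)
  also have "mat_rpow C (\<kappa>/2) * (mat_rpow A (1 - r) * mat_rpow C (\<kappa>/2)) = mat_adjoint Z2 * Z2"
    using p by (simp add: Z2_def a_def)
  finally have 4: "mat_rpow C r \<preceq> mat_adjoint Z2 * Z2" .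
  have 5: "mat_rpow (mat_adjoint Z2 * Z2) (\<alpha> - 1) \<preceq> mat_rpow (mat_rpow C r) (\<alpha> - 1)"
    by (rule power_antimono) (use C 4 \<alpha> in simp_all)
  have "mat_rpow (Z2 * mat_adjoint Z2) \<alpha> = mat_adjoint (mat_adjoint Z2) * (mat_rpow (mat_adjoint Z2 * Z2) (\<alpha> - 1) * mat_adjoint Z2)"
    using pw_gram[of Z2 "\<alpha> - 1"] by simp
  also have "\<dots> \<preceq> mat_adjoint (mat_adjoint Z2) * (mat_rpow (mat_rpow C r) (\<alpha> - 1) * mat_adjoint Z2)"
    by (rule le_conj[OF 5]) simp
  also have "\<dots> = mat_rpow A a * (mat_rpow C (\<kappa>/2 + (r * (\<alpha> - 1) + \<kappa>/2)) * mat_rpow A a)"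
    using p by (simp add: Z2_def)
  also have "\<kappa>/2 + (r * (\<alpha> - 1) + \<kappa>/2) = \<alpha>" by (simp add: \<kappa>_def algebra_simps)
  also have "mat_rpow A a * (mat_rpow C \<alpha> * mat_rpow A a) \<preceq> mat_rpow A a * (mat_rpow A (-1) * mat_rpow A a)"
    by (rule le_conj_herm[OF CA]) (use p in simp)
  also have "\<dots> = mat_rpow A (a + (-1 + a))" using p by simp
  also have "a + (-1 + a) = - r" by (simp add: a_def)
  finally have "mat_rpow (mat_adjoint K * (Q * K)) \<alpha> \<preceq> mat_rpow A (- r)" using 3 le_trans by blast
  then show ?thesis using p 1 by (simp add: gm_le_one_def)
qed

text \<open>Repeated doubling: the case of exponent 2 is applied to the powers r/2 of both
  matrices.\<close>

theorem ando_hiai: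
  assumes A: "A \<in> pd n" and B: "B \<in> pd n" and \<alpha>: "0 < \<alpha>" "\<alpha> \<le> 1" and gm_le_one: "gm_le_one \<alpha> A B" and r: "1 \<le> r"
  shows "gm_le_one \<alpha> (mat_rpow A r) (mat_rpow B r)"
proof -
  have p: "A \<in> psd n" "B \<in> psd n" using A B by simp_all
  have "gm_le_one \<alpha> (mat_rpow A r) (mat_rpow B r)" if "r \<le> 2 ^ m" "1 \<le> r" for m r
    using that
  proof (induction m arbitrary: r)
    case 0
    then have "r = 1" by simp
    then show ?case using gm_le_one p by simp
  next
    case (Suc m)
    show ?case
    proof (cases "r \<le> 2")
      case True
      then show ?thesis using ando_hiai_12[OF A B \<alpha> gm_le_one] Suc by simp
    next
      case False
      then have "gm_le_one \<alpha> (mat_rpow A (r/2)) (mat_rpow B (r/2))" using Suc by simp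
      from ando_hiai_12[OF _ _ \<alpha> this, of 2]
      have "gm_le_one \<alpha> (mat_rpow (mat_rpow A (r/2)) 2) (mat_rpow (mat_rpow B (r/2)) 2)"
        using A B by (simp del: pw_pw)
      then show ?thesis using p by simp
    qed
  qed
  moreover obtain m :: nat where "r < 2 ^ m" using real_arch_pow[of 2 r] by auto
  ultimately show ?thesis using r less_imp_le by blast
qed

section \<open>From SG to G for \<alpha> at most 1/2\<close>

lemma unit_bound_le_half_pd:
  assumes A: "A \<in> pd n" and B: "B \<in> pd n" and \<alpha>: "0 < \<alpha>" "\<alpha> \<le> 1/2"
    and hyp: "mat_rpow (mat_rpow A (1/2) * (B * mat_rpow A (1/2))) \<alpha> \<preceq> mat_rpow A (2 * \<alpha> - 1)"
    and r: "0 < r"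
  shows "mat_rpow (mat_rpow A (-r/2) * (mat_rpow B r * mat_rpow A (-r/2))) \<alpha> \<preceq> mat_rpow A (- r)"
proof -
  define C where "C = mat_rpow A (1/2) * (B * mat_rpow A (1/2))"
  have C: "C \<in> pd n" unfolding C_def using A B by (rule pd_conj)
  have p: "A \<in> psd n" "B \<in> psd n" "C \<in> psd n" using A B C by simp_all
  have hypC: "mat_rpow C \<alpha> \<preceq> mat_rpow A (2 * \<alpha> - 1)" using hyp by (simp add: C_def)
  have BC: "mat_rpow A (-1/2) * (C * mat_rpow A (-1/2)) = B" using A p by (simp add: C_def)
  have 1: "mat_rpow B (2 * \<alpha>) \<preceq> mat_rpow A (- 2 * (1 - \<alpha>))"
  \<comment> \<open>At \<alpha> = 1/2 the exponent \<open>R\<close> below would be 1/0. Here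
    A^(2\<alpha>-1) is the identity, and squaring C^(1/2) \<le> 1 suffices.\<close>
  proof (cases "\<alpha> = 1/2")
    case True
    have "mat_rpow C (1/2) \<preceq> sc 1" using hypC True A by (simp add: sc_one)
    from le_conj_herm[OF this, of "mat_rpow C (1/4)"] this
    have "C \<preceq> sc 1" using p le_trans by (simp add: sc_one)
    from le_conj_herm[OF this, of "mat_rpow A (-1/2)"]
    have "B \<preceq> mat_rpow A (-1)" using p BC by (simp add: sc_one)
    moreover have "2 * \<alpha> = 1" "- 2 * (1 - \<alpha>) = -1" using True by simp_all
    ultimately show ?thesis using p by (simp only: pw_1)
  next
    case False
    \<comment> \<open>Furuta is applied to F = C^\<alpha> and E = A^(2\<alpha>-1). The exponent
      \<open>s\<close> recovers \<open>C\<close> from \<open>F\<close>, and \<open>R\<close> is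
      chosen so that E^(R/2) = A^(-1/2), which strips the factors A^(1/2) off \<open>C\<close> and
      leaves \<open>B\<close>. The outer exponent then equals 2\<alpha>.\<close>
    define s where "s = 1/\<alpha>"
    define R where "R = 1 / (1 - 2 * \<alpha>)"
    have s: "1 \<le> s" "\<alpha> * s = 1" and R: "0 < R" "(1 - 2 * \<alpha>) * R = 1"
      using \<alpha> False by (auto simp: s_def R_def)
    have e: "(1 + R) / (s + R) = 2 * \<alpha>" using \<alpha> False by (simp add: s_def R_def divide_simps)
    have e1: "(1 - 2 * \<alpha>) * (R / 2) = 1/2" using R by simp
    have e2: "(2 * \<alpha> - 1) * (R / 2) = -1/2" using e1 by (simp add: algebra_simps)
    have e3: "(2 * \<alpha> - 1) * (1 + R) = - 2 * (1 - \<alpha>)" using R by (simp add: algebra_simps)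
    have "mat_rpow (mat_rpow (mat_rpow A (2 * \<alpha> - 1)) (R/2) * (mat_rpow (mat_rpow C \<alpha>) s * mat_rpow (mat_rpow A (2 * \<alpha> - 1)) (R/2))) ((1 + R) / (s + R))
      \<preceq> mat_rpow (mat_rpow A (2 * \<alpha> - 1)) (1 + R)"
      by (rule furuta) (use A C hypC s R in simp_all)
    then show ?thesis unfolding e pw_pw[OF p(1)] pw_pw[OF p(3)] e2 e3 s(2) using p BC by simp
  qed
  have small: "mat_rpow (mat_rpow A (-r/2) * (mat_rpow B r * mat_rpow A (-r/2))) \<alpha> \<preceq> mat_rpow A (- r)"
    if r: "0 < r" "r \<le> 2 * \<alpha>" for r
  proof -
    have "mat_rpow (mat_rpow B (2 * \<alpha>)) (r / (2 * \<alpha>)) \<preceq> mat_rpow (mat_rpow A (- 2 * (1 - \<alpha>))) (r / (2 * \<alpha>))"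
      by (rule loewner_heinz) (use A p 1 r \<alpha> in simp_all)
    then have "mat_rpow B r \<preceq> mat_rpow A (- 2 * (1 - \<alpha>) * (r / (2 * \<alpha>)))" using p \<alpha> by simp
    also have "- 2 * (1 - \<alpha>) * (r / (2 * \<alpha>)) = r - r / \<alpha>" using \<alpha> by (simp add: field_simps)
    finally have "mat_rpow A (-r/2) * (mat_rpow B r * mat_rpow A (-r/2)) \<preceq> mat_rpow A (-r/2) * (mat_rpow A (r - r / \<alpha>) * mat_rpow A (-r/2))"
      by (rule le_conj_herm) (use p in simp)
    also have "\<dots> = mat_rpow A (-r/2 + ((r - r / \<alpha>) + -r/2))" using p by simp
    also have "-r/2 + ((r - r / \<alpha>) + -r/2) = - r / \<alpha>" by (simp add: field_simps)
    finally have "mat_rpow (mat_rpow A (-r/2) * (mat_rpow B r * mat_rpow A (-r/2))) \<alpha> \<preceq> mat_rpow (mat_rpow A (- r / \<alpha>)) \<alpha>"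
      by (intro loewner_heinz psd_conj) (use A p \<alpha> in simp_all)
    then show ?thesis using p \<alpha> by simp
  qed
  show ?thesis
  proof (cases "r \<le> 2 * \<alpha>")
    case True
    then show ?thesis by (rule small[OF r])
  next
    case False
    \<comment> \<open>Beyond Loewner-Heinz: the bound at the largest directly reachable exponent
      2\<alpha> is raised by the factor r/(2\<alpha>) > 1.\<close>
    have "gm_le_one \<alpha> (mat_rpow A (2 * \<alpha>)) (mat_rpow B (2 * \<alpha>))" using small[of "2 * \<alpha>"] \<alpha> p by (simp add: gm_le_one_def)
    from ando_hiai[OF _ _ _ _ this, of "r / (2 * \<alpha>)"]
    have "gm_le_one \<alpha> (mat_rpow (mat_rpow A (2 * \<alpha>)) (r / (2 * \<alpha>))) (mat_rpow (mat_rpow B (2 * \<alpha>)) (r / (2 * \<alpha>)))"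
      using A B \<alpha> False by (simp del: pw_pw)
    then show ?thesis using p \<alpha> by (simp add: gm_le_one_def)
  qed
qed

section \<open>Perturbing a singular B to a definite matrix\<close>

lemma psd_bounded: assumes "A \<in> psd n" obtains m where "0 < m" "A \<preceq> sc m"
proof -
  obtain U d where U: "unitary U" "A = ud U d" "\<And>i. 0 \<le> d i" using psd_spectral[OF assms] by metis
  \<comment> \<open>Inserting 1 keeps the maximum defined in dimension 0 and positive for the zero
    matrix.\<close>
  have "d i \<le> Max (insert 1 (d ` {..<n}))" if "i < n" for i using that by simp
  then have "A \<preceq> sc (Max (insert 1 (d ` {..<n})))" using U by (simp add: ud_le_sc)
  moreover have "0 < Max (insert 1 (d ` {..<n}))" by (subst Max_gr_iff) auto
  ultimately show ?thesis using that by blast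
qed

lemma pd_bounded_below: assumes "A \<in> pd n" obtains m where "0 < m" "sc m \<preceq> A"
proof -
  obtain U d where U: "unitary U" "A = ud U d" "\<And>i. 0 < d i" using pd_spectral[OF assms] by metis
  have "Min (insert 1 (d ` {..<n})) \<le> d i" if "i < n" for i using that by simp
  then have "sc (Min (insert 1 (d ` {..<n}))) \<preceq> A" using U by (simp add: sc_le_ud)
  moreover have "0 < Min (insert 1 (d ` {..<n}))" using U by (subst Min_gr_iff) auto
  ultimately show ?thesis using that by blast
qed

lemma adj_add [simp]: "A \<in> M \<Longrightarrow> B \<in> M \<Longrightarrow> mat_adjoint (A + B) = mat_adjoint A + mat_adjoint B"
  by (rule eq_matI) auto
lemma herm_add [simp]: "herm X \<Longrightarrow> herm Y \<Longrightarrow> herm (X + Y)" by (rule hermI) simp_all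
lemma herm_smult [simp]: "herm X \<Longrightarrow> herm (complex_of_real c \<cdot>\<^sub>m X)" by (rule hermI) simp_all

lemma le_add_mono: "X \<preceq> Y \<Longrightarrow> X' \<preceq> Y' \<Longrightarrow> X + X' \<preceq> Y + Y'"
  unfolding le_def
  by (auto simp: qf_add add_mono)

lemma le_smult: "X \<preceq> Y \<Longrightarrow> 0 \<le> c \<Longrightarrow> complex_of_real c \<cdot>\<^sub>m X \<preceq> complex_of_real c \<cdot>\<^sub>m Y"
  unfolding le_def by (auto simp: qf_smult mult_left_mono)

lemma pw_smult: "A \<in> psd n \<Longrightarrow> 0 \<le> c \<Longrightarrow> mat_rpow (complex_of_real c \<cdot>\<^sub>m A) r = complex_of_real (c powr r) \<cdot>\<^sub>m mat_rpow A r"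
  by (erule psd_spectral) (simp add: pw_ud ud_smult powr_mult)

text \<open>After scaling to u + (1-u) = 1 this is t \<le> t^a on (0,1), used for both
  summands.\<close>

lemma powr_add_le:
  fixes x y a :: real
  assumes "0 \<le> x" "0 < y" "0 \<le> a" "a \<le> 1"
  shows "(x + y) powr a \<le> x powr a + y powr a"
proof (cases "x = 0")
  case False
  then have x: "0 < x" using assms by simp
  define u where "u = x / (x + y)"
  have u: "0 < u" "u < 1" using x assms by (auto simp: u_def)
  have ge: "t \<le> t powr a" if "0 < t" "t < 1" for t :: real
    using powr_mono'[of a 1 t] that assms by simp
  have xy: "x = (x + y) * u" "y = (x + y) * (1 - u)" using x assms by (auto simp: u_def field_simps)
  have "(x + y) powr a * 1 \<le> (x + y) powr a * (u powr a + (1 - u) powr a)"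
    using ge[of u] ge[of "1 - u"] u by (intro mult_left_mono) auto
  also have "\<dots> = ((x + y) * u) powr a + ((x + y) * (1 - u)) powr a"
    using u x assms by (simp add: powr_mult distrib_left)
  also have "\<dots> = x powr a + y powr a" using xy by simp
  finally show ?thesis by simp
qed (use assms in simp)

lemma pd_shift: assumes "B \<in> psd n" "0 < \<delta>" shows "B + sc \<delta> \<in> pd n"
proof -
  obtain U d where U: "unitary U" "B = ud U d" "\<And>i. 0 \<le> d i" using psd_spectral[OF assms(1)] by metis
  have "B + sc \<delta> = ud U (\<lambda>i. d i + \<delta>)" using ud_add[OF U(1), of d "\<lambda>_. \<delta>"] U by (simp add: ud_const)
  then show ?thesis using U assms by (simp add: pd_ud add_nonneg_pos)
qed

lemma pw_shift:
  assumes "B \<in> psd n" "0 < \<delta>" "0 \<le> a"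
  shows "mat_rpow B a \<preceq> mat_rpow (B + sc \<delta>) a"
    and "a \<le> 1 \<Longrightarrow> mat_rpow (B + sc \<delta>) a \<preceq> mat_rpow B a + sc (\<delta> powr a)"
proof -
  obtain U d where U: "unitary U" "B = ud U d" "\<And>i. 0 \<le> d i" using psd_spectral[OF assms(1)] by metis
  have B: "B + sc \<delta> = ud U (\<lambda>i. d i + \<delta>)" using ud_add[OF U(1), of d "\<lambda>_. \<delta>"] U by (simp add: ud_const)
  have B2: "mat_rpow B a + sc (\<delta> powr a) = ud U (\<lambda>i. d i powr a + \<delta> powr a)"
    using ud_add[OF U(1), of "\<lambda>i. d i powr a" "\<lambda>_. \<delta> powr a"] U by (simp add: ud_const pw_ud)
  show "mat_rpow B a \<preceq> mat_rpow (B + sc \<delta>) a" unfolding B using U assms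
    by (simp add: pw_ud ud_le add_nonneg_nonneg powr_mono2)
  show "mat_rpow (B + sc \<delta>) a \<preceq> mat_rpow B a + sc (\<delta> powr a)" if "a \<le> 1"
    unfolding B B2 using U assms that by (simp add: pw_ud ud_le add_nonneg_nonneg powr_add_le)
qed

text \<open>Turns the multiplicative gap \<open>k < 1\<close> into additive room: \<epsilon> is 1 -
  k times a lower bound of \<open>Y\<close>.\<close>

lemma smult_add_sc_le:
  assumes Y: "Y \<in> pd n" and k: "k < 1"
  obtains \<epsilon> where "0 < \<epsilon>" "complex_of_real k \<cdot>\<^sub>m Y + sc \<epsilon> \<preceq> Y"
proof -
  obtain m where m: "0 < m" "sc m \<preceq> Y" using pd_bounded_below[OF Y] .
  have Y': "Y \<in> M" "herm Y" using Y by simp_all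
  define \<epsilon> where "\<epsilon> = (1 - k) * m"
  have "complex_of_real k \<cdot>\<^sub>m Y + sc \<epsilon> \<preceq> Y"
    unfolding le_def
  proof (intro conjI ballI)
    show "herm (complex_of_real k \<cdot>\<^sub>m Y + sc \<epsilon>)"
      using Y' by simp
    fix v :: "complex vec" assume v: "v \<in> carrier_vec n"
    have "m * nsq v \<le> qf Y v" using m v by (auto simp: le_def qf_sc)
    then have "(1 - k) * (m * nsq v) \<le> (1 - k) * qf Y v" using k by (intro mult_left_mono) auto
    then show "qf (complex_of_real k \<cdot>\<^sub>m Y + sc \<epsilon>) v \<le> qf Y v"
      using Y' v by (simp add: qf_add qf_smult qf_sc \<epsilon>_def algebra_simps)
  qed (use Y' in simp)
  moreover have "0 < \<epsilon>" using k m by (simp add: \<epsilon>_def)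
  ultimately show ?thesis using that by blast
qed

text \<open>Shifting \<open>B\<close> by \<delta> changes \<open>C\<close> to C + \<delta> A, at
  most C + \<delta> m. Subadditivity of the power \<alpha> \<le> 1 bounds the effect on C^\<alpha>
  by the scalar (\<delta> m)^\<alpha>, which the gap left by \<open>k\<close> absorbs. The definite
  case then applies, and its conclusion passes down to \<open>B\<close> by monotonicity.\<close>

theorem unit_bound_le_half:
  assumes A: "A \<in> pd n" and B: "B \<in> psd n" and \<alpha>: "0 < \<alpha>" "\<alpha> \<le> 1/2" and k: "k < 1"
    and hyp: "mat_rpow (mat_rpow A (1/2) * (B * mat_rpow A (1/2))) \<alpha> \<preceq> complex_of_real k \<cdot>\<^sub>m mat_rpow A (2 * \<alpha> - 1)"
    and r: "0 < r"
  shows "mat_rpow (mat_rpow A (-r/2) * (mat_rpow B r * mat_rpow A (-r/2))) \<alpha> \<preceq> mat_rpow A (- r)"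
proof -
  define C where "C = mat_rpow A (1/2) * (B * mat_rpow A (1/2))"
  have C: "C \<in> psd n" unfolding C_def using A B by (intro psd_conj) simp_all
  obtain m where m: "0 < m" "A \<preceq> sc m" using psd_bounded[of A] A by auto
  obtain \<epsilon> where \<epsilon>: "0 < \<epsilon>" "complex_of_real k \<cdot>\<^sub>m mat_rpow A (2 * \<alpha> - 1) + sc \<epsilon> \<preceq> mat_rpow A (2 * \<alpha> - 1)"
    using smult_add_sc_le[of "mat_rpow A (2 * \<alpha> - 1)" k] A k by auto
  \<comment> \<open>The solution of (\<delta> m)^\<alpha> = \<epsilon>.\<close>
  define \<delta> where "\<delta> = \<epsilon> powr (1/\<alpha>) / m"
  have \<delta>: "0 < \<delta>" "(\<delta> * m) powr \<alpha> = \<epsilon>" using \<epsilon> m \<alpha> by (auto simp: \<delta>_def powr_powr)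
  define B' where "B' = B + sc \<delta>"
  have B': "B' \<in> pd n" unfolding B'_def using B \<delta> by (intro pd_shift)
  have CB: "mat_rpow A (1/2) * (B' * mat_rpow A (1/2)) = C + complex_of_real \<delta> \<cdot>\<^sub>m A"
    unfolding C_def B'_def using A B
    by (simp add: add_mult_distrib_mat[of _ n n _ _ n] mult_add_distrib_mat[of _ n n _ n])
  have "complex_of_real \<delta> \<cdot>\<^sub>m A \<preceq> complex_of_real \<delta> \<cdot>\<^sub>m sc m" using m \<delta> by (intro le_smult) simp_all
  also have "complex_of_real \<delta> \<cdot>\<^sub>m sc m = sc (\<delta> * m)" by (rule eq_matI) (auto simp: sc_def)
  finally have "C + complex_of_real \<delta> \<cdot>\<^sub>m A \<preceq> C + sc (\<delta> * m)"
    using C by (intro le_add_mono le_refl) simp_all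
  then have "mat_rpow (C + complex_of_real \<delta> \<cdot>\<^sub>m A) \<alpha> \<preceq> mat_rpow (C + sc (\<delta> * m)) \<alpha>"
  proof (rule loewner_heinz[rotated 2])
    show "C + complex_of_real \<delta> \<cdot>\<^sub>m A \<in> psd n" unfolding CB[symmetric] using A B' by (intro psd_conj) simp_all
    show "C + sc (\<delta> * m) \<in> pd n" using C \<delta> m by (intro pd_shift) simp_all
  qed (use \<alpha> in simp_all)
  also have "\<dots> \<preceq> mat_rpow C \<alpha> + sc ((\<delta> * m) powr \<alpha>)" using C \<delta> m \<alpha> by (intro pw_shift) simp_all
  also have "\<dots> \<preceq> complex_of_real k \<cdot>\<^sub>m mat_rpow A (2 * \<alpha> - 1) + sc \<epsilon>"
    unfolding \<delta> using hyp by (intro le_add_mono le_refl) (simp_all add: C_def)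
  also note \<epsilon>(2)
  finally have "mat_rpow (mat_rpow A (-r/2) * (mat_rpow B' r * mat_rpow A (-r/2))) \<alpha> \<preceq> mat_rpow A (- r)"
    using A B' \<alpha> r by (intro unit_bound_le_half_pd) (simp_all add: CB)
  \<comment> \<open>\<open>B\<close> and its shift commute, so this also holds for r > 1, where
    Loewner-Heinz fails.\<close>
  moreover have "mat_rpow B r \<preceq> mat_rpow B' r" unfolding B'_def using B \<delta> r by (intro pw_shift) simp_all
  then have "mat_rpow A (-r/2) * (mat_rpow B r * mat_rpow A (-r/2)) \<preceq> mat_rpow A (-r/2) * (mat_rpow B' r * mat_rpow A (-r/2))"
    by (rule le_conj_herm) (use A in simp)
  then have "mat_rpow (mat_rpow A (-r/2) * (mat_rpow B r * mat_rpow A (-r/2))) \<alpha>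
     \<preceq> mat_rpow (mat_rpow A (-r/2) * (mat_rpow B' r * mat_rpow A (-r/2))) \<alpha>"
    by (intro loewner_heinz psd_conj pd_conj) (use A B B' \<alpha> in simp_all)
  ultimately show ?thesis using le_trans by blast
qed

section \<open>From SG to G for \<alpha> greater than 1\<close>

text \<open>
  The bound \<open>B\<^sup>u\<^sup>/\<^sup>2 A\<^sup>-\<^sup>\<beta>\<^sup>u B\<^sup>u\<^sup>/\<^sup>2 \<le> 1\<close> replaces \<open>A\<^sup>-\<^sup>\<beta>\<^sup>u \<le> B\<^sup>-\<^sup>u\<close>, which makes no sense for singular \<open>B\<close>.
\<close>

lemma sandwich_le_one:
  assumes A: "A \<in> pd n" and B: "B \<in> psd n" and le: "B \<preceq> mat_rpow A \<beta>" and u: "0 \<le> u" "u \<le> 1"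
  shows "mat_rpow B (u/2) * (mat_rpow A (- \<beta> * u) * mat_rpow B (u/2)) \<preceq> sc 1"
proof -
  have p: "A \<in> psd n" using A by simp
  define K where "K = mat_rpow B (u/2) * mat_rpow A (- \<beta> * u / 2)"
  have K: "K \<in> M" using B p by (simp add: K_def)
  have "mat_rpow B u \<preceq> mat_rpow (mat_rpow A \<beta>) u" by (rule loewner_heinz) (use A B le u in simp_all)
  then have "mat_rpow A (- \<beta> * u / 2) * (mat_rpow B u * mat_rpow A (- \<beta> * u / 2))
      \<preceq> mat_rpow A (- \<beta> * u / 2) * (mat_rpow (mat_rpow A \<beta>) u * mat_rpow A (- \<beta> * u / 2))"
    by (rule le_conj_herm) (use p in simp)
  also have "\<dots> = sc 1" using p A by (simp add: sc_one)
  finally have "mat_adjoint K * K \<preceq> sc 1" using p B by (simp add: K_def)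
  then have "K * mat_adjoint K \<preceq> sc 1" using K by (intro contraction_swap) simp_all
  then show ?thesis using p B by (simp add: K_def)
qed

text \<open>The invariant X^t \<le> A^(-rt/\<alpha>), which is the claim at t = \<alpha>, is carried
  from t to t + 2. In X X^t X the bound leaves B^r A^(-\<beta>u) B^r in the middle. The factors
  B^(u/2) on either side absorb the power of \<open>A\<close>, and the remaining B^(2r-u) is
  compared with A^(\<beta>(2r-u)).\<close>

lemma unit_bound_ge_two:
  assumes A: "A \<in> pd n" and B: "B \<in> psd n" and \<alpha>: "2 \<le> \<alpha>"
    and le: "B \<preceq> mat_rpow A ((\<alpha> - 1) / \<alpha>)" and r: "0 < r" "r \<le> 1/2"
  shows "mat_rpow (mat_rpow A (-r/2) * (mat_rpow B r * mat_rpow A (-r/2))) \<alpha> \<preceq> mat_rpow A (- r)"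
proof -
  define \<beta> where "\<beta> = (\<alpha> - 1) / \<alpha>"
  have \<beta>: "\<beta> * \<alpha> = \<alpha> - 1" using \<alpha> by (simp add: \<beta>_def)
  have p: "A \<in> psd n" using A by simp
  define X where "X = mat_rpow A (-r/2) * (mat_rpow B r * mat_rpow A (-r/2))"
  have X: "X \<in> psd n" unfolding X_def using A B by (intro psd_conj) simp_all
  have step: "mat_rpow X (t + 2) \<preceq> mat_rpow A (- r * (t + 2) / \<alpha>)"
    if le': "mat_rpow X t \<preceq> mat_rpow A (- r * t / \<alpha>)" and t: "0 \<le> t" "t \<le> \<alpha> - 2" for t
  proof -
    \<comment> \<open>Solves \<beta> u = r(\<alpha>+t)/\<alpha>, the exponent collected between the
      two factors B^r. The bound t \<le> \<alpha> - 2 gives u \<le> 2r, and r \<le> 1/2 then keeps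
      both u and 2r - u in [0,1].\<close>
    define u where "u = r * (\<alpha> + t) / (\<alpha> - 1)"
    have u: "0 \<le> u" "u \<le> 2 * r" "u \<le> 1" "u * (\<alpha> - 1) = r * (\<alpha> + t)"
    proof -
      show "0 \<le> u" "u * (\<alpha> - 1) = r * (\<alpha> + t)" using r t \<alpha> by (auto simp: u_def)
      have "r * (\<alpha> + t) \<le> r * (2 * (\<alpha> - 1))" using r t by (intro mult_left_mono) auto
      then show "u \<le> 2 * r" using \<alpha> by (simp add: u_def divide_le_eq mult_ac)
      then show "u \<le> 1" using r by simp
    qed
    have bu: "\<beta> * u * \<alpha> = r * (\<alpha> + t)" using u(4) \<beta> by (metis mult.assoc mult.commute)
    have e1: "- r/2 + (- r * t / \<alpha> + - r/2) = - \<beta> * u" using bu \<alpha> by (simp add: field_simps)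
    have "mat_rpow X (t + 2) = X * (mat_rpow X t * X)" using X by (simp add: add.commute)
    also have "\<dots> \<preceq> X * (mat_rpow A (- r * t / \<alpha>) * X)" by (rule le_conj_herm[OF le']) (use X in simp)
    also have "\<dots> = mat_rpow A (-r/2) * (mat_rpow B r * (mat_rpow A (- r/2 + (- r * t / \<alpha> + - r/2)) * (mat_rpow B r * mat_rpow A (-r/2))))"
      using p B by (simp add: X_def)
    also have "\<dots> = mat_adjoint (mat_rpow B (r - u/2) * mat_rpow A (-r/2)) *
        ((mat_rpow B (u/2) * (mat_rpow A (- \<beta> * u) * mat_rpow B (u/2))) * (mat_rpow B (r - u/2) * mat_rpow A (-r/2)))"
      unfolding e1 using p B by simp
    also have "\<dots> \<preceq> mat_adjoint (mat_rpow B (r - u/2) * mat_rpow A (-r/2)) *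
        (sc 1 * (mat_rpow B (r - u/2) * mat_rpow A (-r/2)))"
      by (rule le_conj, rule sandwich_le_one) (use A B le u in \<open>simp_all add: \<beta>_def\<close>)
    also have "\<dots> = mat_rpow A (-r/2) * (mat_rpow B ((r - u/2) + (r - u/2)) * mat_rpow A (-r/2))"
      using p B by (simp add: sc_one)
    also have "(r - u/2) + (r - u/2) = 2 * r - u" by simp
    also have "mat_rpow A (-r/2) * (mat_rpow B (2 * r - u) * mat_rpow A (-r/2))
       \<preceq> mat_rpow A (-r/2) * (mat_rpow (mat_rpow A \<beta>) (2 * r - u) * mat_rpow A (-r/2))"
      by (intro le_conj_herm loewner_heinz) (use A B le u r in \<open>simp_all add: \<beta>_def\<close>)
    also have "\<dots> = mat_rpow A (-r/2 + (\<beta> * (2 * r - u) + -r/2))" using p by simp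
    also have "-r/2 + (\<beta> * (2 * r - u) + -r/2) = - r * (t + 2) / \<alpha>"
    proof -
      have "(-r/2 + (\<beta> * (2 * r - u) + -r/2)) * \<alpha> = - r * \<alpha> + 2 * r * (\<beta> * \<alpha>) - \<beta> * u * \<alpha>"
        by (simp add: algebra_simps)
      also have "\<dots> = - r * (t + 2)" unfolding \<beta> bu by (simp add: algebra_simps)
      finally show ?thesis using \<alpha> by (subst eq_divide_eq) auto
    qed
    finally show ?thesis .
  qed
  have X2: "mat_rpow X 2 \<preceq> mat_rpow A (- r * 2 / \<alpha>)"
  proof -
    obtain U d where U: "unitary U" "X = ud U d" "\<And>i. 0 \<le> d i" using psd_spectral[OF X] by metis
    then have "mat_rpow X 0 \<preceq> sc 1" by (simp add: pw_ud ud_le_sc)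
    then show ?thesis using step[of 0] A \<alpha> by (simp add: sc_one)
  qed
  have base: "mat_rpow X t \<preceq> mat_rpow A (- r * t / \<alpha>)" if "0 \<le> t" "t \<le> 2" for t
  proof -
    have "mat_rpow (mat_rpow X 2) (t/2) \<preceq> mat_rpow (mat_rpow A (- r * 2 / \<alpha>)) (t/2)"
      by (rule loewner_heinz) (use A X X2 that in simp_all)
    then show ?thesis using X p by simp
  qed
  \<comment> \<open>The steps of length 2 end exactly at \<alpha> when started at the remainder
    \<open>t0\<close>, which lies in the range already covered by interpolating the square.\<close>
  define m where "m = nat \<lfloor>\<alpha> / 2\<rfloor>"
  define t0 where "t0 = \<alpha> - 2 * real m"
  have t0: "0 \<le> t0" "t0 \<le> 2" "\<alpha> = t0 + 2 * real m" unfolding t0_def m_def using \<alpha> by linarith+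
  have "mat_rpow X (t0 + 2 * real j) \<preceq> mat_rpow A (- r * (t0 + 2 * real j) / \<alpha>)" if "j \<le> m" for j
    using that
  proof (induction j)
    case 0
    then show ?case using base t0 by simp
  next
    case (Suc j)
    have "mat_rpow X (t0 + 2 * real j + 2) \<preceq> mat_rpow A (- r * (t0 + 2 * real j + 2) / \<alpha>)"
      by (rule step) (use Suc t0 in \<open>simp_all add: add_nonneg_nonneg\<close>)
    then show ?case by (simp add: algebra_simps)
  qed
  from this[of m] have "mat_rpow X \<alpha> \<preceq> mat_rpow A (- r * \<alpha> / \<alpha>)" unfolding t0(3)[symmetric] by simp
  then show ?thesis using \<alpha> by (simp add: X_def)
qed

text \<open>Write X = Z Z^H with Z = A^(-r/2) B^(r/2), so X^\<alpha> = Z (Z^H Z)^(\<alpha>-1) Z^H. A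
  shifted B' still satisfies B' \<le> A^\<beta>; as r \<le> \<beta>, this gives A^(-r) \<le>
  B'^(-r/\<beta>) and hence Z^H Z \<le> B'^(r-r/\<beta>). Since \<alpha> - 1 \<le> 1, Loewner-Heinz
  bounds the inner power by B'^(-r), because (r - r/\<beta>)(\<alpha>-1) = -r. The outer factors
  B^(r/2) then cancel it up to a contraction.\<close>

lemma unit_bound_between:
  assumes A: "A \<in> pd n" and B: "B \<in> psd n" and \<alpha>: "1 < \<alpha>" "\<alpha> \<le> 2" and k: "k < 1"
    and le: "B \<preceq> complex_of_real k \<cdot>\<^sub>m mat_rpow A ((\<alpha> - 1) / \<alpha>)" and r: "0 < r" "r \<le> (\<alpha> - 1) / \<alpha>"
  shows "mat_rpow (mat_rpow A (-r/2) * (mat_rpow B r * mat_rpow A (-r/2))) \<alpha> \<preceq> mat_rpow A (- r)"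
proof -
  define \<beta> where "\<beta> = (\<alpha> - 1) / \<alpha>"
  have \<beta>: "0 < \<beta>" "r / \<beta> \<le> 1" "(r - r / \<beta>) * (\<alpha> - 1) = - r"
    using \<alpha> r by (auto simp: \<beta>_def field_simps)
  have p: "A \<in> psd n" using A by simp
  obtain \<epsilon> where \<epsilon>: "0 < \<epsilon>" "complex_of_real k \<cdot>\<^sub>m mat_rpow A \<beta> + sc \<epsilon> \<preceq> mat_rpow A \<beta>"
    using smult_add_sc_le[of "mat_rpow A \<beta>" k] A k by auto
  define B' where "B' = B + sc \<epsilon>"
  have B': "B' \<in> pd n" unfolding B'_def using B \<epsilon> by (intro pd_shift)
  have p': "B' \<in> psd n" using B' by simp
  have "B' \<preceq> complex_of_real k \<cdot>\<^sub>m mat_rpow A \<beta> + sc \<epsilon>"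
    unfolding B'_def using le by (intro le_add_mono le_refl) (simp_all add: \<beta>_def)
  also note \<epsilon>(2)
  finally have "mat_rpow (mat_rpow A \<beta>) (- r/\<beta>) \<preceq> mat_rpow B' (- r/\<beta>)"
    by (rule power_antimono[OF B']) (use \<beta> r in simp_all)
  then have 1: "mat_rpow A (- r) \<preceq> mat_rpow B' (- r/\<beta>)" using p \<beta> by simp
  define Z where "Z = mat_rpow A (-r/2) * mat_rpow B (r/2)"
  have Z [simp]: "Z \<in> M" using p B by (simp add: Z_def)
  obtain U d where U: "unitary U" "B = ud U d" "\<And>i. 0 \<le> d i" using psd_spectral[OF B] by metis
  have UB': "B' = ud U (\<lambda>i. d i + \<epsilon>)" using ud_add[OF U(1), of d "\<lambda>_. \<epsilon>"] U by (simp add: ud_const B'_def)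
  have d: "0 < d i + \<epsilon>" "d i powr r \<le> (d i + \<epsilon>) powr r" for i using U(3)[of i] \<epsilon> r by (auto intro: powr_mono2)
  have "mat_adjoint Z * Z = mat_rpow B (r/2) * (mat_rpow A (- r) * mat_rpow B (r/2))"
    using p B by (simp add: Z_def)
  also have "\<dots> \<preceq> mat_rpow B (r/2) * (mat_rpow B' (- r/\<beta>) * mat_rpow B (r/2))"
    by (rule le_conj_herm[OF 1]) (use B in simp)
  also have "\<dots> \<preceq> mat_rpow B' (r - r/\<beta>)"
  proof -
    have "d i powr (r/2) * ((d i + \<epsilon>) powr (- r/\<beta>) * d i powr (r/2)) \<le> (d i + \<epsilon>) powr (r - r/\<beta>)" for i
    proof -
      have "d i powr (r/2) * ((d i + \<epsilon>) powr (- r/\<beta>) * d i powr (r/2)) = d i powr r * (d i + \<epsilon>) powr (- r/\<beta>)"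
        using powr_add[of "d i" "r/2" "r/2"] by simp
      also have "\<dots> \<le> (d i + \<epsilon>) powr r * (d i + \<epsilon>) powr (- r/\<beta>)" using d by (intro mult_right_mono) auto
      finally show ?thesis by (simp flip: powr_add)
    qed
    then show ?thesis unfolding UB' using U d(1)[THEN less_imp_le] by (simp add: pw_ud ud_le)
  qed
  finally have "mat_rpow (mat_adjoint Z * Z) (\<alpha> - 1) \<preceq> mat_rpow (mat_rpow B' (r - r/\<beta>)) (\<alpha> - 1)"
    by (intro loewner_heinz psd_gram1) (use B' \<alpha> in simp_all)
  then have 2: "mat_rpow (mat_adjoint Z * Z) (\<alpha> - 1) \<preceq> mat_rpow B' (- r)" using p' \<beta> by simp
  have 3: "mat_rpow B (r/2) * (mat_rpow B' (- r) * mat_rpow B (r/2)) \<preceq> sc 1"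
  proof -
    have "d i powr (r/2) * ((d i + \<epsilon>) powr (- r) * d i powr (r/2)) \<le> 1" for i
    proof -
      have "d i powr (r/2) * ((d i + \<epsilon>) powr (- r) * d i powr (r/2)) = d i powr r * (d i + \<epsilon>) powr (- r)"
        using powr_add[of "d i" "r/2" "r/2"] by simp
      also have "\<dots> \<le> (d i + \<epsilon>) powr r * (d i + \<epsilon>) powr (- r)" using d by (intro mult_right_mono) auto
      also have "\<dots> = 1" using d(1)[of i] by (simp flip: powr_add)
      finally show ?thesis .
    qed
    then show ?thesis unfolding UB' using U d(1)[THEN less_imp_le] by (simp add: pw_ud ud_le_sc)
  qed
  have "mat_rpow (mat_rpow A (-r/2) * (mat_rpow B r * mat_rpow A (-r/2))) \<alpha> = mat_rpow (Z * mat_adjoint Z) (\<alpha> - 1 + 1)"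
    using p B by (simp add: Z_def)
  also have "\<dots> = mat_adjoint (mat_adjoint Z) * (mat_rpow (mat_adjoint Z * Z) (\<alpha> - 1) * mat_adjoint Z)"
    using pw_gram[of Z "\<alpha> - 1"] by simp
  also have "\<dots> \<preceq> mat_adjoint (mat_adjoint Z) * (mat_rpow B' (- r) * mat_adjoint Z)" by (rule le_conj[OF 2]) simp
  also have "\<dots> = mat_rpow A (-r/2) * ((mat_rpow B (r/2) * (mat_rpow B' (- r) * mat_rpow B (r/2))) * mat_rpow A (-r/2))"
    using p p' B by (simp add: Z_def)
  also have "\<dots> \<preceq> mat_rpow A (-r/2) * (sc 1 * mat_rpow A (-r/2))" by (rule le_conj_herm[OF 3]) (use p in simp)
  also have "\<dots> = mat_rpow A (- r)" using p by (simp add: sc_one)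
  finally show ?thesis .
qed

theorem unit_bound_gt_one:
  assumes A: "A \<in> pd n" and B: "B \<in> psd n" and \<alpha>: "1 < \<alpha>" and k: "0 \<le> k" "k < 1"
    and hyp: "mat_rpow (mat_rpow A (1/2) * (B * mat_rpow A (1/2))) \<alpha> \<preceq> complex_of_real k \<cdot>\<^sub>m mat_rpow A (2 * \<alpha> - 1)"
    and r: "0 < r" "r \<le> 1/2" "r \<le> (\<alpha> - 1) / \<alpha>"
  shows "mat_rpow (mat_rpow A (-r/2) * (mat_rpow B r * mat_rpow A (-r/2))) \<alpha> \<preceq> mat_rpow A (- r)"
proof -
  define C where "C = mat_rpow A (1/2) * (B * mat_rpow A (1/2))"
  have C: "C \<in> psd n" unfolding C_def using A B by (intro psd_conj) simp_all
  have p: "A \<in> psd n" using A by simp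
  \<comment> \<open>\<open>k\<close> may be 0; the maximum with 1/2 makes the right-hand side
    definite for Loewner-Heinz with exponent 1/\<alpha>, and the root is still below 1.\<close>
  define k' where "k' = (max k (1/2)) powr (1/\<alpha>)"
  have k': "0 < k'" "k' < 1" using k \<alpha> powr_less_mono2[of "1/\<alpha>" "max k (1/2)" 1] by (auto simp: k'_def)
  have pdA: "complex_of_real (max k (1/2)) \<cdot>\<^sub>m mat_rpow A (2 * \<alpha> - 1) \<in> pd n"
  proof -
    obtain U d where U: "unitary U" "A = ud U d" "\<And>i. 0 < d i" using pd_spectral[OF A] by metis
    have "d i \<noteq> 0" for i using U(3)[of i] by simp
    then show ?thesis using U by (simp add: pw_ud less_imp_le ud_smult pd_ud)
  qed
  have "mat_rpow C \<alpha> \<preceq> complex_of_real (max k (1/2)) \<cdot>\<^sub>m mat_rpow A (2 * \<alpha> - 1)"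
  proof -
    have "complex_of_real k \<cdot>\<^sub>m mat_rpow A (2 * \<alpha> - 1) \<preceq> complex_of_real (max k (1/2)) \<cdot>\<^sub>m mat_rpow A (2 * \<alpha> - 1)"
    proof -
      obtain U d where U: "unitary U" "A = ud U d" "\<And>i. 0 \<le> d i" using psd_spectral[OF p] by metis
      then show ?thesis by (simp add: pw_ud ud_smult ud_le mult_right_mono)
    qed
    then show ?thesis using hyp le_trans unfolding C_def by blast
  qed
  then have "mat_rpow (mat_rpow C \<alpha>) (1/\<alpha>) \<preceq> mat_rpow (complex_of_real (max k (1/2)) \<cdot>\<^sub>m mat_rpow A (2 * \<alpha> - 1)) (1/\<alpha>)"
    by (intro loewner_heinz) (use C \<alpha> pdA in simp_all)
  then have "C \<preceq> complex_of_real k' \<cdot>\<^sub>m mat_rpow A ((2 * \<alpha> - 1) * (1/\<alpha>))"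
    using C \<alpha> p by (simp add: pw_smult k'_def)
  then have "mat_rpow A (-1/2) * (C * mat_rpow A (-1/2)) \<preceq> mat_rpow A (-1/2) * ((complex_of_real k' \<cdot>\<^sub>m mat_rpow A ((2 * \<alpha> - 1) * (1/\<alpha>))) * mat_rpow A (-1/2))"
    by (rule le_conj_herm) (use p in simp)
  also have "mat_rpow A (-1/2) * (C * mat_rpow A (-1/2)) = B" using A p B by (simp add: C_def)
  also have "mat_rpow A (-1/2) * ((complex_of_real k' \<cdot>\<^sub>m mat_rpow A ((2 * \<alpha> - 1) * (1/\<alpha>))) * mat_rpow A (-1/2))
     = complex_of_real k' \<cdot>\<^sub>m mat_rpow A (-1/2 + ((2 * \<alpha> - 1) * (1/\<alpha>) + -1/2))" using p by simp
  also have "-1/2 + ((2 * \<alpha> - 1) * (1/\<alpha>) + -1/2) = (\<alpha> - 1) / \<alpha>" using \<alpha> by (simp add: field_simps)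
  finally have 1: "B \<preceq> complex_of_real k' \<cdot>\<^sub>m mat_rpow A ((\<alpha> - 1) / \<alpha>)" .
  show ?thesis
  proof (cases "\<alpha> \<le> 2")
    case True
    then show ?thesis using unit_bound_between[OF A B \<alpha> _ k'(2) 1 r(1,3)] by simp
  next
    case False
    have "complex_of_real k' \<cdot>\<^sub>m mat_rpow A ((\<alpha> - 1) / \<alpha>) \<preceq> mat_rpow A ((\<alpha> - 1) / \<alpha>)"
    proof -
      obtain U d where U: "unitary U" "A = ud U d" "\<And>i. 0 \<le> d i" using psd_spectral[OF p] by metis
      then show ?thesis using k' by (simp add: pw_ud ud_smult ud_le mult_left_le_one_le)
    qed
    then show ?thesis using unit_bound_ge_two[OF A B _ le_trans[OF 1] r(1,2)] False by simp
  qed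
qed

end

section \<open>Compound matrices\<close>

context sqmat begin

lemma ud_index:
  assumes "U \<in> M" "i < n" "j < n"
  shows "(U * dg d * mat_adjoint U) $$ (i,j) = (\<Sum>l<n. U $$ (i,l) * complex_of_real (d l) * cnj (U $$ (j,l)))"
proof -
  have "U * dg d = mat n n (\<lambda>(i,j). U $$ (i,j) * complex_of_real (d j))"
    using assms by (simp add: mat_diag_mult_right)
  then show ?thesis using assms by (simp add: scalar_prod_def atLeast0LessThan)
qed

text \<open>Sorting the eigenvalues permutes the columns of the unitary, which only reorders the sum
  over columns in each entry.\<close>

lemma psd_spectral_sorted:
  assumes "A \<in> psd n"
  obtains U d where "unitary U" "A = ud U d" "\<And>i. 0 \<le> d i" "\<And>i j. i \<le> j \<Longrightarrow> j < n \<Longrightarrow> d j \<le> d i"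
proof -
  obtain V e where V: "unitary V" "A = ud V e" "\<And>i. 0 \<le> e i" using psd_spectral[OF assms] by metis
  define xs where "xs = map e [0..<n]"
  obtain p where p: "p permutes {..<n}" "permute_list p xs = rev (sort xs)"
    using mset_eq_permutation[of "rev (sort xs)" xs] by (auto simp: xs_def)
  have pn: "i < n \<Longrightarrow> p i < n" for i using permutes_in_image[OF p(1)] by auto
  define d where "d i = e (p i)" for i
  have dx: "rev (sort xs) ! i = d i" if "i < n" for i
    using that p pn[OF that] permute_list_nth[of p xs i] by (simp add: xs_def d_def)
  define U where "U = mat n n (\<lambda>(i,j). V $$ (i, p j))"
  have U: "U \<in> M" by (simp add: U_def)
  have eq: "U * dg (\<lambda>i. f (p i)) * mat_adjoint U = V * dg f * mat_adjoint V" for f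
  proof (rule eq_matI)
    fix i j assume "i < dim_row (V * dg f * mat_adjoint V)" "j < dim_col (V * dg f * mat_adjoint V)"
    then have ij: "i < n" "j < n" using unitaryD(1)[OF V(1)] by auto
    have "(U * dg (\<lambda>i. f (p i)) * mat_adjoint U) $$ (i,j)
       = (\<Sum>l<n. V $$ (i,p l) * complex_of_real (f (p l)) * cnj (V $$ (j,p l)))"
      unfolding ud_index[OF U ij] using ij by (intro sum.cong) (auto simp: U_def)
    also have "\<dots> = (\<Sum>l<n. V $$ (i,l) * complex_of_real (f l) * cnj (V $$ (j,l)))"
      using sum.permute[OF p(1), of "\<lambda>l. V $$ (i,l) * complex_of_real (f l) * cnj (V $$ (j,l))"] by (simp add: o_def)
    finally show "(U * dg (\<lambda>i. f (p i)) * mat_adjoint U) $$ (i,j) = (V * dg f * mat_adjoint V) $$ (i,j)"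
      unfolding ud_index[OF unitaryD(1)[OF V(1)] ij] .
  qed (use U carrier_matD[OF unitaryD(1)[OF V(1)]] in auto)
  have "unitary U" unfolding unitary_def using U eq[of "\<lambda>_. 1"] V(1) by simp
  moreover have "A = ud U d" unfolding V(2) ud_def using eq[of e] by (simp add: d_def)
  moreover have "d j \<le> d i" if "i \<le> j" "j < n" for i j
  proof -
    have "sorted (rev (rev (sort xs)))" by simp
    then have "rev (sort xs) ! j \<le> rev (sort xs) ! i"
      using that by (intro sorted_rev_nth_mono) (auto simp: xs_def)
    then show ?thesis using dx that by simp
  qed
  moreover have "0 \<le> d i" for i using V(3) by (simp add: d_def)
  ultimately show ?thesis using that[of U d] by metis
qed

lemma char_poly_ud:
  assumes "unitary U"
  shows "char_poly (ud U d) = (\<Prod>x\<leftarrow>map (\<lambda>i. complex_of_real (d i)) [0..<n]. [:- x, 1:])"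
proof -
  have "similar_mat_wit (ud U d) (dg d) U (mat_adjoint U)"
    using assms by (intro similar_mat_witI[of _ _ n]) (auto simp: ud_def)
  then have "char_poly (ud U d) = char_poly (dg d)" by (intro char_poly_similar) (auto simp: similar_mat_def)
  also have "\<dots> = (\<Prod>x\<leftarrow>diag_mat (dg d). [:- x, 1:])"
    by (rule char_poly_upper_triangular[of _ n]) (auto simp: mat_diag_def)
  also have "diag_mat (dg d) = map (\<lambda>i. complex_of_real (d i)) [0..<n]"
    by (auto simp: diag_mat_def mat_diag_def)
  finally show ?thesis .
qed

lemma eigs_desc_ud:
  assumes U: "unitary U" and mono: "\<And>i j. i \<le> j \<Longrightarrow> j < n \<Longrightarrow> d j \<le> d i"
  shows "eigs_desc (ud U d) = map d [0..<n]"
proof -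
  have "proots (\<Prod>x\<leftarrow>xs. [:- x, 1:]) = mset xs" for xs :: "complex list"
  proof (induction xs)
    case (Cons x xs)
    have "(\<Prod>x\<leftarrow>xs. [:- x, 1:]) \<noteq> 0" by (auto simp: prod_list_zero_iff)
    then have "proots ([:- x, 1:] * (\<Prod>x\<leftarrow>xs. [:- x, 1:])) = {#x#} + mset xs"
      using Cons by (subst proots_mult) auto
    then show ?case by (simp only: list.map prod_list.Cons mset.simps) simp
  qed simp
  note pr = this
  have "image_mset Re (proots (char_poly (ud U d))) = mset (map Re (map (\<lambda>i. complex_of_real (d i)) [0..<n]))"
    unfolding char_poly_ud[OF U] pr by (rule mset_map[symmetric])
  also have "map Re (map (\<lambda>i. complex_of_real (d i)) [0..<n]) = map d [0..<n]" by simp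
  finally have "image_mset Re (proots (char_poly (ud U d))) = mset (map d [0..<n])" .
  then have "eigs_desc (ud U d) = rev (sort (map d [0..<n]))"
    unfolding eigs_desc_def by (simp only: sorted_list_of_multiset_mset)
  also have "sort (map d [0..<n]) = rev (map d [0..<n])"
  proof (rule properties_for_sort)
    show "sorted (rev (map d [0..<n]))"
      by (simp add: sorted_rev_iff_nth_mono mono)
  qed simp
  finally show ?thesis by simp
qed

end

section \<open>Minors, the Cauchy-Binet formula and exterior powers\<close>

definition minor :: "nat \<Rightarrow> complex mat \<Rightarrow> (nat \<Rightarrow> nat) \<Rightarrow> (nat \<Rightarrow> nat) \<Rightarrow> complex" where
  "minor k A f g = det (mat k k (\<lambda>(a,b). A $$ (f a, g b)))"

definition el :: "nat set \<Rightarrow> nat \<Rightarrow> nat" where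
  "el I a = sorted_list_of_set I ! a"

definition ksubs :: "nat \<Rightarrow> nat \<Rightarrow> nat set list" where
  "ksubs n k = filter (\<lambda>I. card I = k) (map set (subseqs [0..<n]))"

text \<open>The matrix of the k-th exterior power of \<open>A\<close> in the basis of wedge products
  indexed by k-subsets; the order in which \<open>ksubs\<close> lists them is immaterial.\<close>

definition compound :: "nat \<Rightarrow> nat \<Rightarrow> complex mat \<Rightarrow> complex mat" where
  "compound n k A = mat (length (ksubs n k)) (length (ksubs n k))
     (\<lambda>(i,j). minor k A (el (ksubs n k ! i)) (el (ksubs n k ! j)))"

lemma set_ksubs: "set (ksubs n k) = {I. I \<subseteq> {..<n} \<and> card I = k}"
  using subseqs_powset[of "[0..<n]"] unfolding ksubs_def by (auto simp: atLeast0LessThan)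

lemma distinct_ksubs: "distinct (ksubs n k)"
  unfolding ksubs_def by (intro distinct_filter distinct_set_subseqs) simp

lemma el_bij: "finite I \<Longrightarrow> card I = k \<Longrightarrow> bij_betw (el I) {..<k} I"
  unfolding el_def using bij_betw_nth[of "sorted_list_of_set I" "{..<k}" I] by simp

text \<open>Makes {0,...,k-1} the subset with the largest product of decreasingly ordered
  eigenvalues.\<close>

lemma el_ge: "finite I \<Longrightarrow> a < card I \<Longrightarrow> a \<le> el I a"
proof (induction a)
  case (Suc a)
  have "el I a < el I (Suc a)"
    unfolding el_def using Suc.prems by (intro sorted_wrt_nth_less[OF strict_sorted_list_of_set]) auto
  then show ?case using Suc by simp
qed simp

text \<open>Multilinearity in the rows: \<open>h\<close> selects for each row which summand of the
  matrix product is taken. Rows are indexed by functions because repetitions and unsorted choices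
  occur here.\<close>

lemma minor_mult_expand:
  assumes A: "A \<in> carrier_mat m n" and B: "B \<in> carrier_mat n l"
    and f: "\<And>a. a < k \<Longrightarrow> f a < m" and g: "\<And>a. a < k \<Longrightarrow> g a < l"
  shows "minor k (A * B) f g = (\<Sum>h\<in>{..<k} \<rightarrow>\<^sub>E {..<n}. (\<Prod>a<k. A $$ (f a, h a)) * minor k B h g)"
proof -
  let ?P = "{p. p permutes {0..<k}}"
  have pk: "p a < k" if "p permutes {0..<k}" "a < k" for p a using permutes_in_image[OF that(1), of a] that by auto
  have "minor k (A * B) f g = (\<Sum>p\<in>?P. signof p * (\<Prod>a<k. (A * B) $$ (f a, g (p a))))"
    unfolding minor_def by (subst det_def'[of _ k]) (auto simp: atLeast0LessThan pk intro!: sum.cong prod.cong)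
  also have "\<dots> = (\<Sum>p\<in>?P. signof p * (\<Prod>a<k. \<Sum>j<n. A $$ (f a, j) * B $$ (j, g (p a))))"
    using A B f g pk by (intro sum.cong arg_cong2[of _ _ _ _ "(*)"] prod.cong refl) (auto simp: scalar_prod_def atLeast0LessThan)
  also have "\<dots> = (\<Sum>p\<in>?P. \<Sum>h\<in>{..<k} \<rightarrow>\<^sub>E {..<n}. (\<Prod>a<k. A $$ (f a, h a)) * (signof p * (\<Prod>a<k. B $$ (h a, g (p a)))))"
    by (intro sum.cong refl, subst prod_sum_PiE) (auto simp: sum_distrib_left prod.distrib mult_ac)
  also have "\<dots> = (\<Sum>h\<in>{..<k} \<rightarrow>\<^sub>E {..<n}. (\<Prod>a<k. A $$ (f a, h a)) * (\<Sum>p\<in>?P. signof p * (\<Prod>a<k. B $$ (h a, g (p a)))))"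
    by (subst sum.swap) (simp add: sum_distrib_left)
  also have "\<dots> = (\<Sum>h\<in>{..<k} \<rightarrow>\<^sub>E {..<n}. (\<Prod>a<k. A $$ (f a, h a)) * minor k B h g)"
    unfolding minor_def by (intro sum.cong arg_cong2[of _ _ _ _ "(*)"] refl, subst det_def'[of _ k])
      (auto simp: atLeast0LessThan pk intro!: sum.cong prod.cong)
  finally show ?thesis .
qed

lemma minor_permute:
  assumes p: "p permutes {0..<k}"
  shows "minor k B (\<lambda>a. e (p a)) g = signof p * minor k B e g"
proof -
  have "mat k k (\<lambda>(a,b). B $$ (e (p a), g b)) = mat k k (\<lambda>(a,b). mat k k (\<lambda>(a,b). B $$ (e a, g b)) $$ (p a, b))"
    using permutes_in_image[OF p] by (intro eq_matI) auto
  then show ?thesis unfolding minor_def using det_permute_rows[OF _ p, of "mat k k (\<lambda>(a,b). B $$ (e a, g b))"] by simp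
qed

lemma minor_cong: "(\<And>a. a < k \<Longrightarrow> f a = f' a) \<Longrightarrow> (\<And>a. a < k \<Longrightarrow> g a = g' a) \<Longrightarrow> minor k A f g = minor k A f' g'"
  unfolding minor_def by (intro arg_cong[of _ _ det] eq_matI) auto

lemma minor_eq_0: "a < k \<Longrightarrow> b < k \<Longrightarrow> a \<noteq> b \<Longrightarrow> f a = f b \<Longrightarrow> minor k A f g = 0"
  unfolding minor_def by (rule det_identical_rows[of _ k a b]) (auto intro!: eq_vecI)

text \<open>A selection \<open>h\<close> with a repeated value gives two equal rows and drops out.
  The others are grouped by their image \<open>R\<close>; each is \<open>el R\<close> after a
  permutation, whose sign comes out of the minor of \<open>B\<close> and reassembles the minor of
  \<open>A\<close>.\<close>

theorem cauchy_binet: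
  assumes A: "A \<in> carrier_mat m n" and B: "B \<in> carrier_mat n l"
    and f: "\<And>a. a < k \<Longrightarrow> f a < m" and g: "\<And>a. a < k \<Longrightarrow> g a < l"
  shows "minor k (A * B) f g = (\<Sum>R\<in>{R. R \<subseteq> {..<n} \<and> card R = k}. minor k A f (el R) * minor k B (el R) g)"
proof -
  let ?F = "{..<k} \<rightarrow>\<^sub>E {..<n}"
  let ?t = "\<lambda>h. (\<Prod>a<k. A $$ (f a, h a)) * minor k B h g"
  let ?S = "\<lambda>R. {h \<in> ?F. inj_on h {..<k} \<and> h ` {..<k} = R}"
  have finF: "finite ?F" by (intro finite_PiE) auto
  have "minor k (A * B) f g = (\<Sum>h\<in>?F. ?t h)" by (rule minor_mult_expand[OF A B f g])
  also have "\<dots> = (\<Sum>h\<in>{h\<in>?F. inj_on h {..<k}}. ?t h)"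
  proof (rule sum.mono_neutral_right[OF finF])
    show "\<forall>h\<in>?F - {h \<in> ?F. inj_on h {..<k}}. ?t h = 0"
      using minor_eq_0 by (fastforce simp: inj_on_def)
  qed auto
  also have "\<dots> = (\<Sum>R\<in>{R. R \<subseteq> {..<n} \<and> card R = k}. \<Sum>h\<in>{h\<in>{h\<in>?F. inj_on h {..<k}}. h ` {..<k} = R}. ?t h)"
  proof (rule sum.group[symmetric])
    show "finite {h\<in>?F. inj_on h {..<k}}" by (rule finite_subset[OF _ finF]) auto
    show "finite {R. R \<subseteq> {..<n} \<and> card R = k}" by (rule finite_subset[of _ "Pow {..<n}"]) auto
  qed (auto simp: card_image PiE_def Pi_def)
  also have "\<dots> = (\<Sum>R\<in>{R. R \<subseteq> {..<n} \<and> card R = k}. minor k A f (el R) * minor k B (el R) g)"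
  proof (rule sum.cong[OF refl])
    fix R assume "R \<in> {R. R \<subseteq> {..<n} \<and> card R = k}"
    then have R: "R \<subseteq> {..<n}" "card R = k" "finite R" by (auto intro: finite_subset)
    let ?e = "el R"
    have e: "bij_betw ?e {..<k} R" using el_bij R by blast
    then have inv: "inv_into {..<k} ?e (?e a) = a" "?e a \<in> R" if "a < k" for a
      using that by (auto simp: bij_betw_def)
    have inv': "?e (inv_into {..<k} ?e x) = x" "inv_into {..<k} ?e x < k" if "x \<in> R" for x
      using that e inv_into_into[of x ?e "{..<k}"] by (auto simp: bij_betw_def f_inv_into_f)
    have pk: "p a < k" if "p permutes {0..<k}" "a < k" for p a using permutes_in_image[OF that(1), of a] that by auto
    have "(\<Sum>h\<in>?S R. ?t h) = (\<Sum>p\<in>{p. p permutes {0..<k}}. (\<Prod>a<k. A $$ (f a, ?e (p a))) * (signof p * minor k B ?e g))"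
    proof (rule sum.reindex_bij_witness[where i = "\<lambda>p. \<lambda>a\<in>{..<k}. ?e (p a)"
          and j = "\<lambda>h a. if a < k then inv_into {..<k} ?e (h a) else a"])
      fix h assume h: "h \<in> ?S R"
      then have hR: "h a \<in> R" if "a < k" for a using that by auto
      show "(\<lambda>a\<in>{..<k}. ?e (if a < k then inv_into {..<k} ?e (h a) else a)) = h"
        using h hR by (intro ext) (auto simp: inv' PiE_def extensional_def)
      have "inj_on (\<lambda>a. inv_into {..<k} ?e (h a)) {0..<k}"
        using h hR inv' by (intro inj_onI) (metis (no_types, lifting) atLeast0LessThan inj_onD lessThan_iff mem_Collect_eq)
      then have "(\<lambda>a. inv_into {..<k} ?e (h a)) ` {0..<k} = {0..<k}"
        by (intro endo_inj_surj) (auto simp: inv' hR)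
      then have "bij_betw (\<lambda>a. if a < k then inv_into {..<k} ?e (h a) else a) {0..<k} {0..<k}"
        using \<open>inj_on _ {0..<k}\<close> by (subst bij_betw_cong[where g = "\<lambda>a. inv_into {..<k} ?e (h a)"]) (auto simp: bij_betw_def)
      then show perm: "(\<lambda>a. if a < k then inv_into {..<k} ?e (h a) else a) \<in> {p. p permutes {0..<k}}"
        by (auto intro: bij_imp_permutes)
      have "minor k B h g = minor k B (\<lambda>a. ?e (if a < k then inv_into {..<k} ?e (h a) else a)) g"
        by (intro minor_cong) (auto simp: inv' hR)
      also have "\<dots> = signof (\<lambda>a. if a < k then inv_into {..<k} ?e (h a) else a) * minor k B ?e g"
        using perm by (intro minor_permute) simp
      finally show "(\<Prod>a<k. A $$ (f a, ?e (if a < k then inv_into {..<k} ?e (h a) else a))) *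
           (signof (\<lambda>a. if a < k then inv_into {..<k} ?e (h a) else a) * minor k B ?e g) = ?t h"
        by (simp add: inv' hR)
    next
      fix p assume "p \<in> {p. p permutes {0..<k}}"
      then have p: "p permutes {0..<k}" by simp
      have out: "\<not> a < k \<Longrightarrow> p a = a" for a using permutes_not_in[OF p] by simp
      show "(\<lambda>a. if a < k then inv_into {..<k} ?e ((\<lambda>a\<in>{..<k}. ?e (p a)) a) else a) = p"
        using pk[OF p] inv out by (intro ext) auto
      have im: "p ` {..<k} = {..<k}" using permutes_image[OF p] by (simp add: atLeast0LessThan)
      have "bij_betw (\<lambda>a. ?e (p a)) {..<k} R"
        using bij_betw_trans[OF permutes_imp_bij[OF p, unfolded atLeast0LessThan] e] by (simp add: o_def)
      then show "(\<lambda>a\<in>{..<k}. ?e (p a)) \<in> ?S R"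
        using R by (auto simp: bij_betw_def inj_on_def)
    qed
    also have "\<dots> = (\<Sum>p\<in>{p. p permutes {0..<k}}. signof p * (\<Prod>a<k. A $$ (f a, ?e (p a)))) * minor k B ?e g"
      by (simp add: sum_distrib_left sum_distrib_right mult_ac)
    also have "(\<Sum>p\<in>{p. p permutes {0..<k}}. signof p * (\<Prod>a<k. A $$ (f a, ?e (p a)))) = minor k A f ?e"
      unfolding minor_def by (subst det_def'[of _ k]) (auto simp: atLeast0LessThan pk intro!: sum.cong prod.cong)
    finally show "(\<Sum>h\<in>{h\<in>{h\<in>?F. inj_on h {..<k}}. h ` {..<k} = R}. ?t h) = minor k A f ?e * minor k B ?e g"
      by (simp add: conj_assoc)
  qed
  finally show ?thesis .
qed

lemma minor_adjoint:
  assumes "A \<in> carrier_mat m n" "\<And>a. a < k \<Longrightarrow> f a < n" "\<And>a. a < k \<Longrightarrow> g a < m"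
  shows "minor k (mat_adjoint A) f g = cnj (minor k A g f)"
proof -
  interpret cnj: comm_ring_hom cnj by unfold_locales auto
  let ?X = "mat k k (\<lambda>(a,b). A $$ (g a, f b))"
  have "mat k k (\<lambda>(a,b). mat_adjoint A $$ (f a, g b)) = transpose_mat (map_mat cnj ?X)"
    using assms by (intro eq_matI) auto
  then have "minor k (mat_adjoint A) f g = det (map_mat cnj ?X)"
    unfolding minor_def by (simp add: det_transpose[of _ k])
  then show ?thesis by (simp add: minor_def cnj.hom_det)
qed

section \<open>The compound map respects products, adjoints and powers\<close>

locale compound_mat = src: sqmat n + tgt: sqmat "length (ksubs n k)" for n k :: nat
begin

abbreviation "N \<equiv> length (ksubs n k)"
abbreviation "\<Phi> \<equiv> compound n k"
abbreviation "e i \<equiv> el (ksubs n k ! i)"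
abbreviation "pd' d i \<equiv> (\<Prod>a<k. d (e i a) :: real)"

lemma idx: assumes "i < N"
  shows "ksubs n k ! i \<subseteq> {..<n}" "card (ksubs n k ! i) = k" "finite (ksubs n k ! i)"
    "bij_betw (e i) {..<k} (ksubs n k ! i)" "\<And>a. a < k \<Longrightarrow> e i a < n"
proof -
  have "ksubs n k ! i \<in> set (ksubs n k)" using assms by simp
  then show 1: "ksubs n k ! i \<subseteq> {..<n}" "card (ksubs n k ! i) = k" unfolding set_ksubs by auto
  then show 2: "finite (ksubs n k ! i)" by (auto intro: finite_subset)
  show 3: "bij_betw (e i) {..<k} (ksubs n k ! i)" using el_bij 1 2 by blast
  show "\<And>a. a < k \<Longrightarrow> e i a < n" using 3 1 unfolding bij_betw_def by blast
qed

lemma \<Phi>_closed [simp]: "\<Phi> A \<in> tgt.M" by (simp add: compound_def)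

lemma \<Phi>_mult: assumes "A \<in> src.M" "B \<in> src.M" shows "\<Phi> (A * B) = \<Phi> A * \<Phi> B"
proof (rule eq_matI)
  fix i j assume "i < dim_row (\<Phi> A * \<Phi> B)" "j < dim_col (\<Phi> A * \<Phi> B)"
  then have ij: "i < N" "j < N" by (auto simp: compound_def)
  have "(\<Phi> A * \<Phi> B) $$ (i,j) = (\<Sum>l<N. minor k A (e i) (e l) * minor k B (e l) (e j))"
    using ij by (simp add: compound_def scalar_prod_def atLeast0LessThan)
  also have "\<dots> = (\<Sum>R\<in>set (ksubs n k). minor k A (e i) (el R) * minor k B (el R) (e j))"
    by (rule sum.reindex_bij_betw[OF bij_betw_nth[OF distinct_ksubs refl refl]])
  also have "\<dots> = minor k (A * B) (e i) (e j)"
    unfolding set_ksubs using assms ij idx by (intro cauchy_binet[symmetric]) auto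
  finally show "\<Phi> (A * B) $$ (i,j) = (\<Phi> A * \<Phi> B) $$ (i,j)" using ij by (simp add: compound_def)
qed (auto simp: compound_def)

lemma \<Phi>_adj: assumes "A \<in> src.M" shows "\<Phi> (mat_adjoint A) = mat_adjoint (\<Phi> A)"
  by (rule eq_matI) (use assms idx in \<open>auto simp: compound_def intro!: minor_adjoint\<close>)

lemma \<Phi>_dg: "\<Phi> (src.dg d) = tgt.dg (pd' d)"
proof (rule eq_matI)
  fix i j assume "i < dim_row (tgt.dg (pd' d))" "j < dim_col (tgt.dg (pd' d))"
  then have ij: "i < N" "j < N" by (auto simp: mat_diag_def)
  have l: "\<Phi> (src.dg d) $$ (i,j) = det (mat k k (\<lambda>(a,b). if e i a = e j b then complex_of_real (d (e j b)) else 0))"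
    using ij idx(5)[OF ij(1)] idx(5)[OF ij(2)] unfolding compound_def minor_def
    by (auto simp: mat_diag_def intro!: arg_cong[of _ _ det] eq_matI)
  show "\<Phi> (src.dg d) $$ (i,j) = tgt.dg (pd' d) $$ (i,j)"
  proof (cases "i = j")
    case True
    have "e j a = e j b \<longleftrightarrow> a = b" if "a < k" "b < k" for a b
      using idx(4)[OF ij(2)] that by (auto simp: bij_betw_def inj_on_def)
    then have "mat k k (\<lambda>(a,b). if e i a = e j b then complex_of_real (d (e j b)) else 0)
       = mat_diag k (\<lambda>b. complex_of_real (d (e j b)))"
      unfolding True mat_diag_def by (intro eq_matI) auto
    also have "det \<dots> = (\<Prod>a<k. complex_of_real (d (e j a)))"
      by (subst det_upper_triangular[of _ k])
         (auto simp: mat_diag_def diag_mat_def prod.list_conv_set_nth atLeast0LessThan)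
    finally show ?thesis unfolding l using ij True by (simp add: mat_diag_def)
  next
    case False
    then have "ksubs n k ! i \<noteq> ksubs n k ! j" using ij distinct_ksubs[of n k] by (simp add: nth_eq_iff_index_eq)
    \<comment> \<open>Equal cardinality makes distinct subsets incomparable, so some row of this
      minor of the diagonal matrix is zero.\<close>
    then have "\<not> ksubs n k ! i \<subseteq> ksubs n k ! j" using card_subset_eq[OF idx(3)[OF ij(2)]] idx(2)[OF ij(1)] idx(2)[OF ij(2)] by metis
    then obtain x where x: "x \<in> ksubs n k ! i" "x \<notin> ksubs n k ! j" by auto
    then obtain a where a: "a < k" "e i a \<notin> ksubs n k ! j" using idx(4)[OF ij(1)] by (force simp: bij_betw_def)
    then have "e i a \<noteq> e j b" if "b < k" for b using idx(4)[OF ij(2)] that by (auto simp: bij_betw_def)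
    then have z: "(\<Prod>b<k. if e i b = e j (p b) then complex_of_real (d (e j (p b))) else 0) = 0"
      if "p permutes {0..<k}" for p using a permutes_in_image[OF that, of a] by (intro prod_zero) auto
    have "det (mat k k (\<lambda>(a,b). if e i a = e j b then complex_of_real (d (e j b)) else 0)) = 0"
    proof (subst det_def'[of _ k], simp, rule sum.neutral, intro ballI)
      fix p assume "p \<in> {p. p permutes {0..<k}}"
      then have p: "p permutes {0..<k}" by simp
      have "(\<Prod>b = 0..<k. mat k k (\<lambda>(a,b). if e i a = e j b then complex_of_real (d (e j b)) else 0) $$ (b, p b))
         = (\<Prod>b<k. if e i b = e j (p b) then complex_of_real (d (e j (p b))) else 0)"
        using permutes_in_image[OF p] by (intro prod.cong) (auto simp: atLeast0LessThan)
      then show "signof p * (\<Prod>b = 0..<k. mat k k (\<lambda>(a,b). if e i a = e j b then complex_of_real (d (e j b)) else 0) $$ (b, p b)) = 0"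
        using z[OF p] by simp
    qed
    then show ?thesis unfolding l using ij False by (simp add: mat_diag_def)
  qed
qed (auto simp: compound_def mat_diag_def)

lemma \<Phi>_one: "\<Phi> (1\<^sub>m n) = 1\<^sub>m N" using \<Phi>_dg[of "\<lambda>_. 1"] by simp

lemma \<Phi>_unitary: "src.unitary U \<Longrightarrow> tgt.unitary (\<Phi> U)"
  unfolding tgt.unitary_def using \<Phi>_mult[of U "mat_adjoint U"] \<Phi>_adj[of U] \<Phi>_one by simp

lemma \<Phi>_ud: "src.unitary U \<Longrightarrow> \<Phi> (src.ud U d) = tgt.ud (\<Phi> U) (pd' d)"
  unfolding src.ud_def tgt.ud_def by (simp add: \<Phi>_mult \<Phi>_adj \<Phi>_dg)

lemma \<Phi>_psd: "A \<in> psd n \<Longrightarrow> \<Phi> A \<in> psd N"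
  by (erule src.psd_spectral) (simp add: \<Phi>_ud \<Phi>_unitary tgt.psd_ud prod_nonneg)

lemma \<Phi>_pd: "A \<in> pd n \<Longrightarrow> \<Phi> A \<in> pd N"
  by (erule src.pd_spectral) (simp add: \<Phi>_ud \<Phi>_unitary tgt.pd_ud prod_pos)

text \<open>The eigenvalues of the compound are k-fold products, and real powers are multiplicative
  on nonnegative numbers.\<close>

lemma \<Phi>_pw: assumes "A \<in> psd n" shows "\<Phi> (mat_rpow A r) = mat_rpow (\<Phi> A) r"
proof -
  obtain U d where U: "src.unitary U" "A = src.ud U d" "\<And>i. 0 \<le> d i" using src.psd_spectral[OF assms] by metis
  then show ?thesis
    by (simp add: src.pw_ud \<Phi>_ud tgt.pw_ud \<Phi>_unitary prod_nonneg prod_powr_distrib)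
qed

text \<open>The largest eigenvalue of the compound is the product of the k largest eigenvalues. This
  turns each partial product in \<open>log_maj\<close> into a single operator bound.\<close>

lemma \<Phi>_le_sc:
  assumes A: "A \<in> psd n" and k: "k \<le> n"
  shows "tgt.le (\<Phi> A) (tgt.sc c) \<longleftrightarrow> (\<Prod>i<k. eigs_desc A ! i) \<le> c"
proof -
  obtain U d where U: "src.unitary U" "A = src.ud U d" "\<And>i. 0 \<le> d i"
    and mono: "\<And>i j. i \<le> j \<Longrightarrow> j < n \<Longrightarrow> d j \<le> d i" using src.psd_spectral_sorted[OF A] by metis
  have "eigs_desc A = map d [0..<n]" unfolding U(2) by (rule src.eigs_desc_ud[OF U(1) mono])
  then have eig: "(\<Prod>i<k. eigs_desc A ! i) = (\<Prod>i<k. d i)"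
    using k by (intro prod.cong) auto
  have le: "tgt.le (\<Phi> A) (tgt.sc c) \<longleftrightarrow> (\<forall>i<N. pd' d i \<le> c)"
    unfolding U(2) \<Phi>_ud[OF U(1)] using tgt.ud_le[OF \<Phi>_unitary[OF U(1)], of "pd' d" "\<lambda>_. c"]
    by (simp add: tgt.ud_const[OF \<Phi>_unitary[OF U(1)]])
  have top: "pd' d i \<le> (\<Prod>a<k. d a)" if "i < N" for i
    using idx[OF that] U mono el_ge[of "ksubs n k ! i"] by (intro prod_mono) auto
  have "{..<k} \<in> set (ksubs n k)" unfolding set_ksubs using k by auto
  then obtain i where i: "i < N" "ksubs n k ! i = {..<k}" by (auto simp: in_set_conv_nth)
  have "sorted_list_of_set {..<k} = [0..<k]" by (simp flip: atLeast0LessThan)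
  then have "pd' d i = (\<Prod>a<k. d a)" unfolding i el_def by (intro prod.cong) auto
  then show ?thesis unfolding le eig using i(1) top by (metis order_trans)
qed

end

section \<open>The two means\<close>

context sqmat begin

declare psd_conj [simp]

lemma G_mean_eq:
  assumes "A \<in> psd n" "B \<in> psd n"
  shows "G_mean \<alpha> p A B = mat_rpow (mat_rpow A (p/2) *
     (mat_rpow (mat_rpow A (-p/2) * (mat_rpow B p * mat_rpow A (-p/2))) \<alpha> * mat_rpow A (p/2))) (1/p)"
  using assms by (simp add: G_mean_def geo_mean_def)

lemma SG_mean_eq:
  fixes \<alpha> p :: real
  assumes "A \<in> psd n" "B \<in> psd n"
  defines "R \<equiv> mat_rpow (mat_rpow A (-p/2) *
     (mat_rpow (mat_rpow A (p/2) * (mat_rpow B p * mat_rpow A (p/2))) \<alpha> * mat_rpow A (-p/2))) (1/2)"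
  shows "SG_mean \<alpha> p A B = mat_rpow (R * (mat_rpow A (2 * (1 - \<alpha>) * p) * R)) (1/p)"
  using assms by (simp add: SG_mean_def geo_mean_def Let_def)

lemma G_mean_psd: "A \<in> psd n \<Longrightarrow> B \<in> psd n \<Longrightarrow> G_mean \<alpha> p A B \<in> psd n"
  by (simp add: G_mean_eq)

lemma SG_mean_psd: "A \<in> psd n \<Longrightarrow> B \<in> psd n \<Longrightarrow> SG_mean \<alpha> p A B \<in> psd n"
  by (simp add: SG_mean_eq)

lemma pw_le_sc:
  assumes "W \<in> psd n" "0 < s" "0 \<le> c"
  shows "mat_rpow W s \<preceq> sc (c powr s) \<longleftrightarrow> W \<preceq> sc c"
proof -
  obtain U d where U: "unitary U" "W = ud U d" "\<And>i. 0 \<le> d i" using psd_spectral[OF assms(1)] by metis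
  have "d i powr s \<le> c powr s \<longleftrightarrow> d i \<le> c" for i
    using powr_mono2[of s "d i" c] powr_less_mono2[of s c "d i"] U(3)[of i] assms by linarith
  then show ?thesis using U by (simp add: pw_ud ud_le_sc)
qed

lemma sc_mono: "a \<le> b \<Longrightarrow> sc a \<preceq> sc b"
  unfolding le_def by (auto simp: qf_sc nsq_nonneg intro!: mult_right_mono)

lemma G_mean_le:
  assumes A: "A \<in> psd n" and B: "B \<in> psd n" and q: "0 < q" and c: "0 \<le> c"
    and le: "mat_rpow A (q/2) * (mat_rpow (mat_rpow A (-q/2) * (mat_rpow B q * mat_rpow A (-q/2))) \<alpha> * mat_rpow A (q/2)) \<preceq> sc (c powr q)"
  shows "G_mean \<alpha> q A B \<preceq> sc c"
proof -
  have "G_mean \<alpha> q A B \<preceq> sc ((c powr q) powr (1/q))"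
    unfolding G_mean_eq[OF A B] by (subst pw_le_sc) (use A B q le in simp_all)
  then show ?thesis using q c by (simp add: powr_powr)
qed

text \<open>SG is a power of K^H K for K = A^((1-\<alpha>)p) T^(1/2). Swapping to K K^H removes the
  square root and leaves A^((1-\<alpha>)p) T A^((1-\<alpha>)p), after which all powers of
  \<open>A\<close> can be moved to the right-hand side.\<close>

lemma SG_mean_leD:
  assumes A: "A \<in> pd n" and B: "B \<in> psd n" and p: "0 < p" and c: "0 \<le> c"
    and le: "SG_mean \<alpha> p A B \<preceq> sc c"
  shows "mat_rpow (mat_rpow A (p/2) * (mat_rpow B p * mat_rpow A (p/2))) \<alpha>
     \<preceq> complex_of_real (c powr p) \<cdot>\<^sub>m mat_rpow A ((2 * \<alpha> - 1) * p)"
proof -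
  have A': "A \<in> psd n" using A by simp
  define Y where "Y = mat_rpow (mat_rpow A (p/2) * (mat_rpow B p * mat_rpow A (p/2))) \<alpha>"
  have Y [simp]: "Y \<in> psd n" using A' B by (simp add: Y_def)
  define T where "T = mat_rpow A (-p/2) * (Y * mat_rpow A (-p/2))"
  have T [simp]: "T \<in> psd n" using A' by (simp add: T_def)
  define x where "x = (1 - \<alpha>) * p"
  define K where "K = mat_rpow A x * mat_rpow T (1/2)"
  have K: "K \<in> M" using A' by (simp add: K_def)
  have e: "2 * (1 - \<alpha>) * p = x + x" by (simp add: x_def)
  have SG: "SG_mean \<alpha> p A B = mat_rpow (mat_adjoint K * K) (1/p)"
    unfolding SG_mean_eq[OF A' B] Y_def[symmetric] T_def[symmetric] e using A' by (simp add: K_def)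
  have "mat_rpow (mat_adjoint K * K) (1/p) \<preceq> sc ((c powr p) powr (1/p))"
    using le p c unfolding SG by (simp add: powr_powr)
  then have "mat_adjoint K * K \<preceq> sc (c powr p)" using p psd_gram1[OF K] by (simp add: pw_le_sc)
  then have "K * mat_adjoint K \<preceq> sc (c powr p)" by (intro contraction_swap K) simp_all
  then have 1: "mat_rpow A x * (T * mat_rpow A x) \<preceq> sc (c powr p)" using A' by (simp add: K_def)
  define y where "y = p/2 - x"
  have y: "x + - p/2 = - y" "- p/2 + x = - y" by (simp_all add: y_def)
  from le_conj_herm[OF 1, of "mat_rpow A y"]
  have "mat_rpow A y * ((mat_rpow A x * (T * mat_rpow A x)) * mat_rpow A y) \<preceq> mat_rpow A y * (sc (c powr p) * mat_rpow A y)"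
    using A' by simp
  also have "mat_rpow A x * (T * mat_rpow A x) = mat_rpow A (x + - p/2) * (Y * mat_rpow A (- p/2 + x))"
    using A' by (simp add: T_def)
  also have "mat_rpow A y * ((mat_rpow A (x + - p/2) * (Y * mat_rpow A (- p/2 + x))) * mat_rpow A y) = Y"
    unfolding y using A A' by simp
  also have "mat_rpow A y * (sc (c powr p) * mat_rpow A y) = complex_of_real (c powr p) \<cdot>\<^sub>m mat_rpow A (y + y)"
    using A' by simp
  also have "y + y = (2 * \<alpha> - 1) * p" by (simp add: y_def x_def algebra_simps)
  finally show ?thesis by (simp add: Y_def)
qed

text \<open>
  The implication from \<open>SG \<le> k < 1\<close> to \<open>G \<le> 1\<close>, in terms of \<open>A\<^sup>p\<close> and \<open>B\<^sup>p\<close>. The strictness leaves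
  room to make a singular \<open>B\<close> definite.
\<close>

definition unit_bound_transfer :: "real \<Rightarrow> real \<Rightarrow> bool" where
  "unit_bound_transfer \<alpha> r \<longleftrightarrow> (\<forall>A B k. A \<in> pd n \<longrightarrow> B \<in> psd n \<longrightarrow> 0 \<le> k \<longrightarrow> k < 1 \<longrightarrow>
     mat_rpow (mat_rpow A (1/2) * (B * mat_rpow A (1/2))) \<alpha> \<preceq> complex_of_real k \<cdot>\<^sub>m mat_rpow A (2 * \<alpha> - 1) \<longrightarrow>
     mat_rpow (mat_rpow A (-r/2) * (mat_rpow B r * mat_rpow A (-r/2))) \<alpha> \<preceq> mat_rpow A (- r))"

lemma unit_bound_transfer_le_half: "0 < \<alpha> \<Longrightarrow> \<alpha> \<le> 1/2 \<Longrightarrow> 0 < r \<Longrightarrow> unit_bound_transfer \<alpha> r"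
  unfolding unit_bound_transfer_def by (intro allI impI unit_bound_le_half)

lemma unit_bound_transfer_gt_one: "1 < \<alpha> \<Longrightarrow> 0 < r \<Longrightarrow> r \<le> min (1/2) ((\<alpha> - 1) / \<alpha>) \<Longrightarrow> unit_bound_transfer \<alpha> r"
  unfolding unit_bound_transfer_def by (intro allI impI unit_bound_gt_one) simp_all

lemma psd_smult [simp]: "A \<in> psd n \<Longrightarrow> 0 \<le> c \<Longrightarrow> complex_of_real c \<cdot>\<^sub>m A \<in> psd n"
  by (erule psd_spectral) (simp add: ud_smult psd_ud)

lemma smult_smult: "a \<cdot>\<^sub>m (b \<cdot>\<^sub>m X) = (a * b) \<cdot>\<^sub>m (X :: complex mat)"
  by (rule eq_matI) auto

text \<open>Both means have degree \<alpha> in \<open>B\<close>, so scaling \<open>B\<close> by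
  c^(-1/\<alpha>) divides both by \<open>c\<close>. The bound on SG becomes c0/c < 1, whose p-th
  power is \<open>k\<close>, and the bound wanted for G becomes 1.\<close>

lemma SG_le_imp_G_le:
  assumes core: "unit_bound_transfer \<alpha> (q / p)" and \<alpha>: "0 < \<alpha>" and p: "0 < p" and q: "0 < q"
    and A: "A \<in> pd n" and B: "B \<in> psd n"
    and c: "0 < c0" "c0 < c" and le: "SG_mean \<alpha> p A B \<preceq> sc c0"
  shows "G_mean \<alpha> q A B \<preceq> sc c"
proof -
  have A': "A \<in> psd n" using A by simp
  define t where "t = c powr (- p / \<alpha>)"
  have t: "0 < t" "t powr \<alpha> = c powr (- p)" "t powr (q/p) = c powr (- q / \<alpha>)" "(t powr (q/p)) powr \<alpha> = c powr (- q)"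
    using c \<alpha> p by (simp_all add: t_def powr_powr)
  define k where "k = c powr (- p) * c0 powr p"
  have k: "0 \<le> k" "k < 1"
  proof -
    have "c0 powr p < c powr p" using c p by (intro powr_less_mono2) auto
    then have "c powr (- p) * c0 powr p < c powr (- p) * c powr p" using c by simp
    also have "\<dots> = 1" using c by (simp flip: powr_add)
    finally show "k < 1" by (simp add: k_def)
  qed (simp add: k_def)
  define Y where "Y = mat_rpow A (p/2) * (mat_rpow B p * mat_rpow A (p/2))"
  have Y [simp]: "Y \<in> psd n" using A' B by (simp add: Y_def)
  have 1: "mat_rpow Y \<alpha> \<preceq> complex_of_real (c0 powr p) \<cdot>\<^sub>m mat_rpow A ((2 * \<alpha> - 1) * p)"
    unfolding Y_def by (rule SG_mean_leD[OF A B p _ le]) (use c in simp)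
  define a where "a = mat_rpow A p"
  define b where "b = complex_of_real t \<cdot>\<^sub>m mat_rpow B p"
  have ab: "a \<in> pd n" "b \<in> psd n" using A B t by (simp_all add: a_def b_def)
  have "mat_rpow a (1/2) * (b * mat_rpow a (1/2)) = complex_of_real t \<cdot>\<^sub>m Y"
    using A' B by (simp add: a_def b_def Y_def)
  then have "mat_rpow (mat_rpow a (1/2) * (b * mat_rpow a (1/2))) \<alpha> = complex_of_real (c powr (- p)) \<cdot>\<^sub>m mat_rpow Y \<alpha>"
    using t by (simp add: pw_smult)
  also have "\<dots> \<preceq> complex_of_real (c powr (- p)) \<cdot>\<^sub>m (complex_of_real (c0 powr p) \<cdot>\<^sub>m mat_rpow A ((2 * \<alpha> - 1) * p))"
    by (rule le_smult[OF 1]) simp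
  also have "\<dots> = complex_of_real k \<cdot>\<^sub>m mat_rpow a (2 * \<alpha> - 1)"
    using A' by (simp add: smult_smult k_def a_def mult.commute)
  finally have "mat_rpow (mat_rpow a (-(q/p)/2) * (mat_rpow b (q/p) * mat_rpow a (-(q/p)/2))) \<alpha> \<preceq> mat_rpow a (- (q/p))"
    using core ab k unfolding unit_bound_transfer_def by blast
  moreover have "mat_rpow a (-(q/p)/2) = mat_rpow A (-q/2)" "mat_rpow a (-(q/p)) = mat_rpow A (- q)"
    "mat_rpow b (q/p) = complex_of_real (t powr (q/p)) \<cdot>\<^sub>m mat_rpow B q"
    using A' B p t by (simp_all add: a_def b_def pw_smult)
  ultimately have "mat_rpow (complex_of_real (t powr (q/p)) \<cdot>\<^sub>m (mat_rpow A (-q/2) * (mat_rpow B q * mat_rpow A (-q/2)))) \<alpha> \<preceq> mat_rpow A (- q)"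
    using A' B by simp
  then have 2: "complex_of_real (c powr (- q)) \<cdot>\<^sub>m mat_rpow (mat_rpow A (-q/2) * (mat_rpow B q * mat_rpow A (-q/2))) \<alpha> \<preceq> mat_rpow A (- q)"
    using A' B t by (subst (asm) pw_smult) simp_all
  define X where "X = mat_rpow (mat_rpow A (-q/2) * (mat_rpow B q * mat_rpow A (-q/2))) \<alpha>"
  have X [simp]: "X \<in> psd n" using A' B by (simp add: X_def)
  have cc: "c powr q * c powr (- q) = 1" using c by (simp flip: powr_add)
  have one: "complex_of_real 1 \<cdot>\<^sub>m X = X" by (rule eq_matI) auto
  have "complex_of_real (c powr q) \<cdot>\<^sub>m (complex_of_real (c powr (- q)) \<cdot>\<^sub>m X) \<preceq> complex_of_real (c powr q) \<cdot>\<^sub>m mat_rpow A (- q)"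
    using 2 unfolding X_def by (rule le_smult) simp
  then have "X \<preceq> complex_of_real (c powr q) \<cdot>\<^sub>m mat_rpow A (- q)"
    unfolding smult_smult of_real_mult[symmetric] cc one .
  from le_conj_herm[OF this, of "mat_rpow A (q/2)"]
  have "mat_rpow A (q/2) * (X * mat_rpow A (q/2)) \<preceq> complex_of_real (c powr q) \<cdot>\<^sub>m 1\<^sub>m n" using A A' by simp
  then show ?thesis using c q A' B by (intro G_mean_le) (simp_all add: X_def sc_def)
qed

section \<open>Determinants of the means\<close>

definition dt :: "complex mat \<Rightarrow> real" where "dt A = Re (det A)"

lemma det_ud: "unitary U \<Longrightarrow> det (ud U d) = complex_of_real (\<Prod>i<n. d i)"
proof -
  assume U: "unitary U"
  have "det (ud U d) = det U * det (dg d) * det (mat_adjoint U)"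
    unfolding ud_def using U by (simp add: det_mult[of _ n] del: massoc)
  also have "\<dots> = det (U * mat_adjoint U) * det (dg d)" using U by (simp add: det_mult[of _ n] del: unitaryD(2))
  also have "\<dots> = det (dg d)" using U by simp
  also have "\<dots> = complex_of_real (\<Prod>i<n. d i)"
    by (subst det_upper_triangular[of _ n])
       (auto simp: mat_diag_def diag_mat_def prod.list_conv_set_nth atLeast0LessThan)
  finally show ?thesis .
qed

lemma dt_ud: "unitary U \<Longrightarrow> dt (ud U d) = (\<Prod>i<n. d i)"
  by (simp only: dt_def det_ud Re_complex_of_real)

lemma dt_nonneg: "A \<in> psd n \<Longrightarrow> 0 \<le> dt A"
  by (erule psd_spectral) (simp add: dt_ud prod_nonneg)
lemma dt_pos: "A \<in> pd n \<Longrightarrow> 0 < dt A"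
  by (erule pd_spectral) (simp add: dt_ud prod_pos)
lemma dt_pw: "A \<in> psd n \<Longrightarrow> dt (mat_rpow A r) = dt A powr r"
  by (erule psd_spectral) (simp add: pw_ud dt_ud prod_powr_distrib)

lemma dt_conj: "K \<in> psd n \<Longrightarrow> X \<in> psd n \<Longrightarrow> dt (K * (X * K)) = dt K * (dt X * dt K)"
proof -
  assume K: "K \<in> psd n" and X: "X \<in> psd n"
  obtain U d where U: "unitary U" "K = ud U d" using psd_spectral[OF K] by metis
  obtain V e where V: "unitary V" "X = ud V e" using psd_spectral[OF X] by metis
  have "det (K * (X * K)) = det K * (det X * det K)" using K X by (simp add: det_mult[of _ n])
  then show ?thesis unfolding dt_def U(2) V(2) det_ud[OF U(1)] det_ud[OF V(1)]
    by (simp only: Re_complex_of_real flip: of_real_mult)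
qed

lemma eigs_prod: assumes "A \<in> psd n" shows "(\<Prod>i<n. eigs_desc A ! i) = dt A"
proof -
  obtain U d where U: "unitary U" "A = ud U d"
    and mono: "\<And>i j. i \<le> j \<Longrightarrow> j < n \<Longrightarrow> d j \<le> d i" using psd_spectral_sorted[OF assms] by metis
  have "eigs_desc A = map d [0..<n]" unfolding U(2) by (rule eigs_desc_ud[OF U(1) mono])
  then show ?thesis using U by (simp add: dt_ud)
qed

lemma eigs_nonneg: assumes "A \<in> psd n" "i < n" shows "0 \<le> eigs_desc A ! i"
proof -
  obtain U d where U: "unitary U" "A = ud U d" "\<And>i. 0 \<le> d i"
    and mono: "\<And>i j. i \<le> j \<Longrightarrow> j < n \<Longrightarrow> d j \<le> d i" using psd_spectral_sorted[OF assms(1)] by metis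
  have "eigs_desc A = map d [0..<n]" unfolding U(2) by (rule eigs_desc_ud[OF U(1) mono])
  then show ?thesis using U assms by simp
qed

text \<open>Both determinants equal (det A)^(1-\<alpha>) (det B)^\<alpha>, checked in logarithms; if
  det B = 0, both vanish by \<open>0 powr x = 0\<close>.\<close>

lemma dt_means:
  assumes A: "A \<in> pd n" and B: "B \<in> psd n" and p: "0 < p" "0 < q"
  shows "dt (G_mean \<alpha> q A B) = dt (SG_mean \<alpha> p A B)"
proof -
  have A': "A \<in> psd n" using A by simp
  define a where "a = dt A"
  define b where "b = dt B"
  have a: "0 < a" and b: "0 \<le> b" using dt_pos[OF A] dt_nonneg[OF B] by (simp_all add: a_def b_def)
  have G: "dt (G_mean \<alpha> q A B) = (a powr (q/2) * ((a powr (-q/2) * (b powr q * a powr (-q/2))) powr \<alpha> * a powr (q/2))) powr (1/q)"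
    unfolding G_mean_eq[OF A' B] using A' B by (simp add: dt_pw dt_conj a_def b_def)
  have SG: "dt (SG_mean \<alpha> p A B) = (let m = (a powr (-p/2) * ((a powr (p/2) * (b powr p * a powr (p/2))) powr \<alpha> * a powr (-p/2))) powr (1/2)
      in (m * (a powr (2 * (1 - \<alpha>) * p) * m)) powr (1/p))"
    unfolding SG_mean_eq[OF A' B] using A' B by (simp add: dt_pw dt_conj a_def b_def Let_def)
  show ?thesis
  proof (cases "b = 0")
    case False
    define s where "s = ln a"
    define t where "t = ln b"
    have st: "a = exp s" "b = exp t" using a b False by (simp_all add: s_def t_def)
    have ep: "exp x powr y = exp (y * x)" for x y :: real by (simp add: powr_def)
    have "dt (G_mean \<alpha> q A B) = exp ((1 - \<alpha>) * s + \<alpha> * t)"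
      unfolding G st ep exp_add[symmetric] using p by (simp add: field_simps)
    moreover have "dt (SG_mean \<alpha> p A B) = exp ((1 - \<alpha>) * s + \<alpha> * t)"
      unfolding SG Let_def st ep exp_add[symmetric] using p by (simp add: field_simps)
    ultimately show ?thesis by simp
  qed (simp add: G SG Let_def)
qed

section \<open>Support projections and singular A\<close>

lemma qf_diff: "A \<in> M \<Longrightarrow> B \<in> M \<Longrightarrow> v \<in> carrier_vec n \<Longrightarrow> qf (A - B) v = qf A v - qf B v"
  unfolding qf_def by (simp add: minus_mult_distrib_mat_vec[of _ n n] minus_scalar_prod_distrib[of _ n])

lemma mat_eq_vecI:
  assumes "A \<in> M" "B \<in> M" "\<And>v. v \<in> carrier_vec n \<Longrightarrow> A *\<^sub>v v = B *\<^sub>v v"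
  shows "A = B"
proof (rule eq_matI)
  fix i j assume "i < dim_row B" "j < dim_col B"
  then have ij: "i < n" "j < n" using assms by auto
  have "C $$ (i,j) = (C *\<^sub>v unit_vec n j) $ i" if "C \<in> M" for C using that ij by simp
  then show "A $$ (i,j) = B $$ (i,j)" using assms by simp
qed (use assms in auto)

lemma vec_diff_0: "v \<in> carrier_vec n \<Longrightarrow> w \<in> carrier_vec n \<Longrightarrow> v - w = 0\<^sub>v n \<Longrightarrow> v = (w :: complex vec)"
  by (metis minus_add_minus_vec minus_zero_vec eq_vecI carrier_vecD index_minus_vec(1) index_zero_vec(1) right_minus_eq)

text \<open>\<open>v - Q v\<close> lies in the kernel of \<open>Q\<close>, hence in that of
  \<open>P\<close>.\<close>

lemma proj_eq_of_kernel_subset: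
  assumes P: "P \<in> M" and Q: "Q \<in> M" "Q * Q = Q"
    and ker: "\<And>v. v \<in> carrier_vec n \<Longrightarrow> Q *\<^sub>v v = 0\<^sub>v n \<Longrightarrow> P *\<^sub>v v = 0\<^sub>v n"
  shows "P * Q = P"
proof (rule mat_eq_vecI)
  fix v :: "complex vec" assume v: "v \<in> carrier_vec n"
  have Qv: "Q *\<^sub>v v \<in> carrier_vec n" using Q v by simp
  have "Q *\<^sub>v (v - Q *\<^sub>v v) = Q *\<^sub>v v - (Q * Q) *\<^sub>v v"
    using Q(1) v Qv by (simp add: mult_minus_distrib_mat_vec[of _ n n])
  also have "\<dots> = 0\<^sub>v n" unfolding Q(2) using Qv by simp
  finally have "P *\<^sub>v (v - Q *\<^sub>v v) = 0\<^sub>v n" using v Qv by (intro ker) simp_all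
  then have "P *\<^sub>v v - P *\<^sub>v (Q *\<^sub>v v) = 0\<^sub>v n" using P v Qv by (simp add: mult_minus_distrib_mat_vec[of _ n n])
  then show "(P * Q) *\<^sub>v v = P *\<^sub>v v" using P Q v Qv vec_diff_0[of "P *\<^sub>v v" "P *\<^sub>v (Q *\<^sub>v v)"] by simp
qed (use P Q in simp_all)

text \<open>Uniqueness: projections P, S with the same kernel satisfy P S = P and S P = S, and
  taking adjoints identifies them.\<close>

lemma supp_proj_ud:
  assumes U: "unitary U"
  shows "supp_proj (ud U d) = ud U (\<lambda>i. if d i = 0 then 0 else 1)"
proof -
  define S where "S = ud U (\<lambda>i. if d i = 0 then 0 else 1)"
  have dim: "dim_row (ud U d) = n" "dim_col (ud U d) = n" using ud_closed[OF U, of d] by auto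
  have S: "S \<in> M" "mat_adjoint S = S" "S * S = S"
    using U herm_ud[OF U] by (auto simp: S_def intro!: ud_cong)
  have AS: "ud U d * S = ud U d" "ud U (\<lambda>i. inverse (d i)) * ud U d = S"
    using U by (auto simp: S_def intro!: ud_cong)
  have kerS: "S *\<^sub>v v = 0\<^sub>v n \<longleftrightarrow> ud U d *\<^sub>v v = 0\<^sub>v n" if "v \<in> carrier_vec n" for v
  proof
    assume "S *\<^sub>v v = 0\<^sub>v n"
    then have "(ud U d * S) *\<^sub>v v = 0\<^sub>v n" using S U that mat_zero_vec by simp
    then show "ud U d *\<^sub>v v = 0\<^sub>v n" unfolding AS .
  next
    assume "ud U d *\<^sub>v v = 0\<^sub>v n"
    then have "(ud U (\<lambda>i. inverse (d i)) * ud U d) *\<^sub>v v = 0\<^sub>v n"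
      using U that mat_zero_vec by (subst mvec_assoc) simp_all
    then show "S *\<^sub>v v = 0\<^sub>v n" unfolding AS .
  qed
  show ?thesis unfolding supp_proj_def dim S_def[symmetric]
  proof (rule the_equality)
    show "S \<in> M \<and> mat_adjoint S = S \<and> S * S = S \<and> mat_kernel S = mat_kernel (ud U d)"
      using S dim kerS by (auto simp: mat_kernel_def)
    fix P assume "P \<in> M \<and> mat_adjoint P = P \<and> P * P = P \<and> mat_kernel P = mat_kernel (ud U d)"
    then have P: "P \<in> M" "mat_adjoint P = P" "P * P = P" and k: "mat_kernel P = mat_kernel (ud U d)" by auto
    have kerP: "P *\<^sub>v v = 0\<^sub>v n \<longleftrightarrow> S *\<^sub>v v = 0\<^sub>v n" if "v \<in> carrier_vec n" for v
      using k that P(1) dim kerS[OF that] by (auto simp: mat_kernel_def)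
    have "P * S = P" "S * P = S" using kerP P S by (auto intro!: proj_eq_of_kernel_subset)
    then show "P = S" using adjm[OF P(1) S(1)] P S by simp
  qed
qed

text \<open>Since X^t = X X^(t-1) for every real t, each power inherits the support of
  \<open>X\<close>.\<close>

lemma pw_absorb:
  assumes X: "X \<in> psd n" and S: "herm S" "S * X = X"
  shows "S * mat_rpow X t = mat_rpow X t" "mat_rpow X t * S = mat_rpow X t"
proof -
  have e: "mat_rpow X t = X * mat_rpow X (t - 1)" using X by simp
  show 1: "S * mat_rpow X t = mat_rpow X t" unfolding e by (rule mult_collapse) (use X S in simp_all)
  have "mat_adjoint (S * mat_rpow X t) = mat_adjoint (mat_rpow X t)" unfolding 1 ..
  then show "mat_rpow X t * S = mat_rpow X t" using X S by simp
qed

text \<open>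
  Replacing the eigenvalue 0 of \<open>A\<close> by 1 changes neither mean, because \<open>B\<close> lives on the support
  of \<open>A\<close>.
\<close>

lemma means_supp:
  assumes A: "A \<in> psd n" and B: "B \<in> psd n" and le: "loewner_le (supp_proj B) (supp_proj A)"
  obtains A' where "A' \<in> pd n" "\<And>\<alpha> q. G_mean \<alpha> q A B = G_mean \<alpha> q A' B"
    "\<And>\<alpha> p. SG_mean \<alpha> p A B = SG_mean \<alpha> p A' B"
proof -
  obtain U d where U: "unitary U" "A = ud U d" "\<And>i. 0 \<le> d i" using psd_spectral[OF A] by metis
  obtain V e where V: "unitary V" "B = ud V e" "\<And>i. 0 \<le> e i" using psd_spectral[OF B] by metis
  define S where "S = supp_proj A"
  have S_eq: "S = ud U (\<lambda>i. if d i = 0 then 0 else 1)" unfolding S_def U(2) by (rule supp_proj_ud[OF U(1)])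
  define T where "T = supp_proj B"
  have T_eq: "T = ud V (\<lambda>i. if e i = 0 then 0 else 1)" unfolding T_def V(2) by (rule supp_proj_ud[OF V(1)])
  have S [simp]: "herm S" and SS: "S * S = S" using U by (auto simp: S_eq intro!: ud_cong)
  have T [simp]: "herm T" and TT: "mat_adjoint T * T = T" and BT: "B * T = B" using V by (auto simp: T_eq intro!: ud_cong)
  have ST: "S - T \<in> psd n" using le carrier_matD[OF hermD(1)[OF S]] unfolding loewner_le_def S_def[symmetric] T_def[symmetric] by simp
  \<comment> \<open>On the kernel of \<open>S\<close> the order \<open>T \<le> S\<close> forces the
    form of \<open>T\<close>, hence \<open>T\<close> itself, to vanish there, and B = B T.\<close>
  have "B * S = B"
  proof (rule proj_eq_of_kernel_subset)
    fix w :: "complex vec" assume w: "w \<in> carrier_vec n" "S *\<^sub>v w = 0\<^sub>v n"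
    have "0 \<le> qf (S - T) w" using ST w by (simp add: psd_iff)
    also have "\<dots> = - qf T w" using w by (simp add: qf_diff) (simp add: qf_def)
    also have "qf T w = nsq (T *\<^sub>v w)" using qf_gram[of T w] w by (simp add: TT[simplified])
    finally have "T *\<^sub>v w = 0\<^sub>v n" using nsq_pos[of "T *\<^sub>v w" n] w by force
    then have "(B * T) *\<^sub>v w = 0\<^sub>v n" using w B mat_zero_vec by simp
    then show "B *\<^sub>v w = 0\<^sub>v n" unfolding BT .
  qed (use B SS in simp_all)
  then have SB: "S * B = B" using adjm[of B S] B by simp
  define A' where "A' = ud U (\<lambda>i. if d i = 0 then 1 else d i)"
  have A': "A' \<in> pd n" unfolding A'_def using U by (simp add: pd_ud order_less_le)
  have A'' [simp]: "A' \<in> psd n" using A' by simp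
  have AS: "mat_rpow A r = mat_rpow A' r * S" "S * mat_rpow A' r = mat_rpow A' r * S" for r
  proof -
    have A'pw: "mat_rpow A' r = ud U (\<lambda>i. (if d i = 0 then 1 else d i) powr r)"
      unfolding A'_def using U by (simp add: pw_ud)
    show "mat_rpow A r = mat_rpow A' r * S" "S * mat_rpow A' r = mat_rpow A' r * S"
      unfolding A'pw S_eq using U by (auto simp: pw_ud intro!: ud_cong)
  qed
  \<comment> \<open>Powers of \<open>A\<close> are powers of \<open>A'\<close> times
    \<open>S\<close>, and \<open>Y\<close> absorbs \<open>S\<close>. The second equation says that
    the sandwich absorbs \<open>S\<close> again, so the argument passes through the nested layers of
    the means.\<close>
  have sand: "mat_rpow A x * (Y * mat_rpow A x) = mat_rpow A' x * (Y * mat_rpow A' x)"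
    "S * (mat_rpow A' x * (Y * mat_rpow A' x)) = mat_rpow A' x * (Y * mat_rpow A' x)"
    if Y: "Y \<in> psd n" "S * Y = Y" for Y x
  proof -
    have YS: "Y * S = Y" using pw_absorb(2)[OF Y(1) S Y(2), of 1] Y by simp
    note c = mult_collapse[OF YS] mult_collapse[OF Y(2)] mult_collapse[OF AS(2)]
    have "mat_rpow A x * (Y * mat_rpow A x) = (mat_rpow A' x * S) * (Y * (S * mat_rpow A' x))"
      by (simp only: AS)
    also have "\<dots> = mat_rpow A' x * (Y * mat_rpow A' x)" using Y by (simp add: c)
    finally show "mat_rpow A x * (Y * mat_rpow A x) = mat_rpow A' x * (Y * mat_rpow A' x)" .
    show "S * (mat_rpow A' x * (Y * mat_rpow A' x)) = mat_rpow A' x * (Y * mat_rpow A' x)"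
      using Y by (simp add: c)
  qed
  have G: "G_mean \<alpha> q A B = G_mean \<alpha> q A' B" for \<alpha> q
  proof -
    define X where "X = mat_rpow A' (-q/2) * (mat_rpow B q * mat_rpow A' (-q/2))"
    have X: "X \<in> psd n" using B by (simp add: X_def)
    have 1: "mat_rpow A (-q/2) * (mat_rpow B q * mat_rpow A (-q/2)) = X" "S * X = X"
      unfolding X_def using sand[of "mat_rpow B q" "-q/2"] pw_absorb(1)[OF B S SB] B by auto
    have 2: "mat_rpow A (q/2) * (mat_rpow X \<alpha> * mat_rpow A (q/2)) = mat_rpow A' (q/2) * (mat_rpow X \<alpha> * mat_rpow A' (q/2))"
      using sand(1)[of "mat_rpow X \<alpha>" "q/2"] pw_absorb(1)[OF X S 1(2)] X by simp
    show ?thesis unfolding G_mean_eq[OF A B] G_mean_eq[OF A'' B] 1 X_def[symmetric] 2 ..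
  qed
  have SG: "SG_mean \<alpha> p A B = SG_mean \<alpha> p A' B" for \<alpha> p
  proof -
    define X where "X = mat_rpow A' (p/2) * (mat_rpow B p * mat_rpow A' (p/2))"
    have X: "X \<in> psd n" using B by (simp add: X_def)
    have 1: "mat_rpow A (p/2) * (mat_rpow B p * mat_rpow A (p/2)) = X" "S * X = X"
      unfolding X_def using sand[of "mat_rpow B p" "p/2"] pw_absorb(1)[OF B S SB] B by auto
    define Y where "Y = mat_rpow A' (-p/2) * (mat_rpow X \<alpha> * mat_rpow A' (-p/2))"
    have Y: "Y \<in> psd n" using X by (simp add: Y_def)
    have 2: "mat_rpow A (-p/2) * (mat_rpow X \<alpha> * mat_rpow A (-p/2)) = Y" "S * Y = Y"
      unfolding Y_def using sand[of "mat_rpow X \<alpha>" "-p/2"] pw_absorb(1)[OF X S 1(2)] X by auto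
    let ?M = "mat_rpow Y (1/2)"
    have 3: "?M * (mat_rpow A z * ?M) = ?M * (mat_rpow A' z * ?M)" for z
      using pw_absorb(1)[OF Y S 2(2)] Y by (simp add: AS(1))
    show ?thesis unfolding SG_mean_eq[OF A B] SG_mean_eq[OF A'' B] 1 X_def[symmetric] 2 Y_def[symmetric] 3 ..
  qed
  show ?thesis using that[OF A' G SG] .
qed

end

section \<open>Assembling the log-majorization\<close>

context compound_mat begin

lemma \<Phi>_conj: "A \<in> psd n \<Longrightarrow> B \<in> psd n \<Longrightarrow> \<Phi> (mat_rpow A x * (B * mat_rpow A x)) = mat_rpow (\<Phi> A) x * (\<Phi> B * mat_rpow (\<Phi> A) x)"
  by (simp add: \<Phi>_mult \<Phi>_pw)

lemma \<Phi>_G: "A \<in> psd n \<Longrightarrow> B \<in> psd n \<Longrightarrow> \<Phi> (G_mean \<alpha> q A B) = G_mean \<alpha> q (\<Phi> A) (\<Phi> B)"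
  by (simp add: src.G_mean_eq tgt.G_mean_eq \<Phi>_psd \<Phi>_pw \<Phi>_conj)

lemma \<Phi>_SG: "A \<in> psd n \<Longrightarrow> B \<in> psd n \<Longrightarrow> \<Phi> (SG_mean \<alpha> p A B) = SG_mean \<alpha> p (\<Phi> A) (\<Phi> B)"
  by (simp add: src.SG_mean_eq tgt.SG_mean_eq \<Phi>_psd \<Phi>_pw \<Phi>_conj \<Phi>_mult)

text \<open>It suffices to bound the left side by every \<open>c\<close> above the right side ?x.
  The midpoint of ?x and \<open>c\<close> serves as \<open>c0\<close>: it lies strictly below
  \<open>c\<close>, and it is positive even if ?x = 0.\<close>

lemma eigs_prod_le:
  assumes core: "tgt.unit_bound_transfer \<alpha> (q / p)" and \<alpha>: "0 < \<alpha>" and p: "0 < p" "0 < q"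
    and A: "A \<in> pd n" and B: "B \<in> psd n" and k: "k \<le> n"
  shows "(\<Prod>i<k. eigs_desc (G_mean \<alpha> q A B) ! i) \<le> (\<Prod>i<k. eigs_desc (SG_mean \<alpha> p A B) ! i)"
proof (rule dense_ge)
  let ?x = "\<Prod>i<k. eigs_desc (SG_mean \<alpha> p A B) ! i"
  fix c assume c: "?x < c"
  have A': "A \<in> psd n" using A by simp
  have x: "0 \<le> ?x" using k by (intro prod_nonneg) (auto intro!: src.eigs_nonneg src.SG_mean_psd[OF A' B])
  have "tgt.le (\<Phi> (SG_mean \<alpha> p A B)) (tgt.sc ?x)" using \<Phi>_le_sc[OF src.SG_mean_psd[OF A' B] k] by blast
  then have "tgt.le (SG_mean \<alpha> p (\<Phi> A) (\<Phi> B)) (tgt.sc ?x)" using \<Phi>_SG[OF A' B] by simp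
  moreover have "tgt.le (tgt.sc ?x) (tgt.sc ((?x + c)/2))" using c by (intro tgt.sc_mono) simp
  ultimately have "tgt.le (SG_mean \<alpha> p (\<Phi> A) (\<Phi> B)) (tgt.sc ((?x + c)/2))" by (rule tgt.le_trans)
  then have "tgt.le (G_mean \<alpha> q (\<Phi> A) (\<Phi> B)) (tgt.sc c)"
    using x c by (intro tgt.SG_le_imp_G_le[OF core \<alpha> p \<Phi>_pd[OF A] \<Phi>_psd[OF B]]) auto
  then show "(\<Prod>i<k. eigs_desc (G_mean \<alpha> q A B) ! i) \<le> c"
    using \<Phi>_le_sc[OF src.G_mean_psd[OF A' B] k] \<Phi>_G[OF A' B] by simp
qed

end

text \<open>The transfer is assumed in every dimension \<open>m\<close> because it is applied to the
  compounds, whose size varies with \<open>k\<close>.\<close>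

lemma log_maj_means:
  assumes core: "\<And>m. sqmat.unit_bound_transfer m \<alpha> (q / p)" and \<alpha>: "0 < \<alpha>" and p: "0 < p" "0 < q"
    and A: "A \<in> psd n" and B: "B \<in> psd n" and le: "loewner_le (supp_proj B) (supp_proj A)"
  shows "log_maj n (G_mean \<alpha> q A B) (SG_mean \<alpha> p A B)"
proof -
  interpret sqmat n .
  obtain A' where A': "A' \<in> pd n" and eq: "\<And>\<alpha> q. G_mean \<alpha> q A B = G_mean \<alpha> q A' B"
    "\<And>\<alpha> p. SG_mean \<alpha> p A B = SG_mean \<alpha> p A' B" using means_supp[OF A B le] by metis
  have A'': "A' \<in> psd n" using A' by simp
  have "(\<Prod>i<k. eigs_desc (G_mean \<alpha> q A' B) ! i) \<le> (\<Prod>i<k. eigs_desc (SG_mean \<alpha> p A' B) ! i)" if "k \<le> n" for k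
  proof -
    interpret compound_mat n k .
    show ?thesis by (rule eigs_prod_le[OF core \<alpha> p A' B that])
  qed
  moreover have "(\<Prod>i<n. eigs_desc (G_mean \<alpha> q A' B) ! i) = (\<Prod>i<n. eigs_desc (SG_mean \<alpha> p A' B) ! i)"
    unfolding eigs_prod[OF G_mean_psd[OF A'' B]] eigs_prod[OF SG_mean_psd[OF A'' B]] by (rule dt_means[OF A' B p])
  ultimately show ?thesis unfolding log_maj_def eq by auto
qed

section \<open>Counterexamples in dimension two\<close>

context sqmat begin

lemma le_sc_eigs: assumes A: "A \<in> psd n" and n: "0 < n" shows "A \<preceq> sc c \<longleftrightarrow> eigs_desc A ! 0 \<le> c"
proof -
  obtain U d where U: "unitary U" "A = ud U d"
    and mono: "\<And>i j. i \<le> j \<Longrightarrow> j < n \<Longrightarrow> d j \<le> d i" using psd_spectral_sorted[OF A] by metis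
  have "eigs_desc A = map d [0..<n]" unfolding U(2) by (rule eigs_desc_ud[OF U(1) mono])
  moreover have "A \<preceq> sc c \<longleftrightarrow> d 0 \<le> c" unfolding U(2) ud_le_sc[OF U(1)] using mono n order_trans by blast
  ultimately show ?thesis using n by simp
qed

lemma qf_smult_vec: "X \<in> M \<Longrightarrow> v \<in> carrier_vec n \<Longrightarrow> qf X (complex_of_real c \<cdot>\<^sub>v v) = c\<^sup>2 * qf X v"
  unfolding qf_def by (simp add: mult_mat_vec[of _ n n] conjugate_smult_vec power2_eq_square)

lemma qf_conj_eigen:
  assumes K: "herm K" and X: "X \<in> M" and v: "v \<in> carrier_vec n" and ev: "K *\<^sub>v v = complex_of_real c \<cdot>\<^sub>v v"
  shows "qf (K * (X * K)) v = c\<^sup>2 * qf X v"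
  using qf_conj[of K X v] assms by (simp add: qf_smult_vec)

end

interpretation two: sqmat 2 .

text \<open>X^\<alpha> is estimated without eigenvectors. On the two eigenvalues \<nu> \<ge> \<mu>
  the function x^\<alpha> lies between \<nu>^(\<alpha>-1) (x - \<mu>) and \<nu>^(\<alpha>-1) x +
  \<mu>^\<alpha>. In the applications \<nu> is bounded below by a diagonal entry, and \<mu> is then
  bounded above through the determinant.\<close>

lemma two_spectrum:
  assumes X: "X \<in> psd 2"
  obtains \<nu> \<mu> where "0 \<le> \<mu>" "\<mu> \<le> \<nu>" "two.dt X = \<nu> * \<mu>"
    "two.le X (two.sc \<nu>)"
    "\<And>\<alpha> v. 0 < \<alpha> \<Longrightarrow> 0 < \<nu> \<Longrightarrow> v \<in> carrier_vec 2 \<Longrightarrow>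
       \<nu> powr (\<alpha> - 1) * (qf X v - \<mu> * nsq v) \<le> qf (mat_rpow X \<alpha>) v"
    "\<And>\<alpha> v. 0 < \<alpha> \<Longrightarrow> 0 < \<nu> \<Longrightarrow> v \<in> carrier_vec 2 \<Longrightarrow>
       qf (mat_rpow X \<alpha>) v \<le> \<nu> powr (\<alpha> - 1) * qf X v + \<mu> powr \<alpha> * nsq v"
proof -
  obtain U d where U: "two.unitary U" "X = two.ud U d" "\<And>i. 0 \<le> d i"
    and mono: "\<And>i j. i \<le> j \<Longrightarrow> j < 2 \<Longrightarrow> d j \<le> d i" using two.psd_spectral_sorted[OF X] by metis
  define \<nu> where "\<nu> = d 0"
  define \<mu> where "\<mu> = d 1"
  have all: "(\<forall>i<2. P (d i)) \<longleftrightarrow> P \<nu> \<and> P \<mu>" for P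
    by (auto simp: \<nu>_def \<mu>_def less_2_cases_iff)
  have 1: "0 \<le> \<mu>" "\<mu> \<le> \<nu>" using U(3) mono[of 0 1] by (auto simp: \<nu>_def \<mu>_def)
  have lam: "\<nu> powr (\<alpha> - 1) * \<nu> = \<nu> powr \<alpha>" if "0 < \<nu>" for \<alpha>
    using that by (simp add: powr_mult_base mult.commute[of _ \<nu>])
  have 2: "two.dt X = \<nu> * \<mu>" unfolding U(2) two.dt_ud[OF U(1)] by (simp add: \<nu>_def \<mu>_def numeral_2_eq_2)
  have 3: "two.le X (two.sc \<nu>)" unfolding U(2) two.ud_le_sc[OF U(1)] all[of "\<lambda>x. x \<le> \<nu>"] using 1 by simp
  have 4: "\<nu> powr (\<alpha> - 1) * (qf X v - \<mu> * nsq v) \<le> qf (mat_rpow X \<alpha>) v"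
    if "0 < \<alpha>" "0 < \<nu>" "v \<in> carrier_vec 2" for \<alpha> v
  proof -
    have "two.le (two.ud U (\<lambda>i. \<nu> powr (\<alpha> - 1) * (d i + - \<mu>))) (two.ud U (\<lambda>i. d i powr \<alpha>))"
      unfolding two.ud_le[OF U(1)] all[of "\<lambda>x. \<nu> powr (\<alpha> - 1) * (x + - \<mu>) \<le> x powr \<alpha>"]
      using 1 lam[OF that(2), of \<alpha>] by (simp add: algebra_simps)
    also have "two.ud U (\<lambda>i. \<nu> powr (\<alpha> - 1) * (d i + - \<mu>)) = complex_of_real (\<nu> powr (\<alpha> - 1)) \<cdot>\<^sub>m (X + two.sc (- \<mu>))"
      unfolding U(2) two.ud_const[OF U(1), symmetric] two.ud_add[OF U(1)] two.ud_smult[OF U(1)] ..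
    also have "two.ud U (\<lambda>i. d i powr \<alpha>) = mat_rpow X \<alpha>" using U by (simp add: two.pw_ud)
    finally have "qf (complex_of_real (\<nu> powr (\<alpha> - 1)) \<cdot>\<^sub>m (X + two.sc (- \<mu>))) v \<le> qf (mat_rpow X \<alpha>) v"
      using that by (auto simp: two.le_def)
    then show ?thesis using that X by (simp add: two.qf_smult two.qf_add two.qf_sc)
  qed
  have 5: "qf (mat_rpow X \<alpha>) v \<le> \<nu> powr (\<alpha> - 1) * qf X v + \<mu> powr \<alpha> * nsq v"
    if "0 < \<alpha>" "0 < \<nu>" "v \<in> carrier_vec 2" for \<alpha> v
  proof -
    have "two.le (two.ud U (\<lambda>i. d i powr \<alpha>)) (two.ud U (\<lambda>i. \<nu> powr (\<alpha> - 1) * d i + \<mu> powr \<alpha>))"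
      unfolding two.ud_le[OF U(1)] all[of "\<lambda>x. x powr \<alpha> \<le> \<nu> powr (\<alpha> - 1) * x + \<mu> powr \<alpha>"]
      using 1 lam[OF that(2), of \<alpha>] by simp
    also have "two.ud U (\<lambda>i. \<nu> powr (\<alpha> - 1) * d i + \<mu> powr \<alpha>) = complex_of_real (\<nu> powr (\<alpha> - 1)) \<cdot>\<^sub>m X + two.sc (\<mu> powr \<alpha>)"
      unfolding U(2) two.ud_smult[OF U(1)] two.ud_const[OF U(1), symmetric] two.ud_add[OF U(1)] ..
    also have "two.ud U (\<lambda>i. d i powr \<alpha>) = mat_rpow X \<alpha>" using U by (simp add: two.pw_ud)
    finally have "qf (mat_rpow X \<alpha>) v \<le> qf (complex_of_real (\<nu> powr (\<alpha> - 1)) \<cdot>\<^sub>m X + two.sc (\<mu> powr \<alpha>)) v"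
      using that by (auto simp: two.le_def)
    then show ?thesis using that X by (simp add: two.qf_smult two.qf_add two.qf_sc)
  qed
  show ?thesis using that[OF 1 2 3 4 5] .
qed

section \<open>The two-parameter family of examples\<close>

text \<open>
  For \<open>\<epsilon> = 0\<close> and \<open>a \<rightarrow> 0\<close> the largest eigenvalue of \<open>G\<close> has order \<open>a\<^sup>1\<^sup>-\<^sup>\<alpha>\<close>, while that of \<open>SG\<close>
  has order 1 if \<open>\<alpha> < 1\<close> and order \<open>a\<^sup>2\<^sup>-\<^sup>2\<^sup>\<alpha>\<close> if \<open>\<alpha> > 1\<close>. A small \<open>\<epsilon> > 0\<close> makes \<open>exB\<close> definite.
\<close>

definition exA :: "real \<Rightarrow> complex mat" where
  "exA a = two.ud (1\<^sub>m 2) (\<lambda>i. if i = 0 then a else 1)"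

definition hadamard :: "complex mat" where
  "hadamard = mat 2 2 (\<lambda>(i,j). complex_of_real (if i = 1 \<and> j = 1 then - 1 / sqrt 2 else 1 / sqrt 2))"

definition exB :: "real \<Rightarrow> complex mat" where
  "exB \<epsilon> = two.ud hadamard (\<lambda>i. if i = 0 then 1 else \<epsilon>)"

lemma hadamard_unitary: "two.unitary hadamard"
  unfolding two.unitary_def
proof
  show H: "hadamard \<in> carrier_mat 2 2" by (simp add: hadamard_def)
  have s: "complex_of_real (sqrt 2) * complex_of_real (sqrt 2) = 2" by (simp flip: of_real_mult)
  show "hadamard * mat_adjoint hadamard = 1\<^sub>m 2"
    by (rule eq_matI) (auto simp: hadamard_def scalar_prod_def less_2_cases_iff atLeast0LessThan numeral_2_eq_2 s[unfolded numeral_2_eq_2] field_simps)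
qed

lemma one_unitary: "two.unitary (1\<^sub>m 2)" by (simp add: two.unitary_def)

lemma exA_pd: "0 < a \<Longrightarrow> exA a \<in> pd 2" unfolding exA_def by (simp add: two.pd_ud one_unitary)
lemma exB_pd: "0 < \<epsilon> \<Longrightarrow> exB \<epsilon> \<in> pd 2" unfolding exB_def by (simp add: two.pd_ud hadamard_unitary)

lemma exA_herm [simp]: "two.herm (exA a)" unfolding exA_def by (rule two.herm_ud[OF one_unitary])

lemma exA_pw: "0 < a \<Longrightarrow> mat_rpow (exA a) r = exA (a powr r)"
  unfolding exA_def by (subst two.pw_ud[OF one_unitary]) (auto intro!: two.ud_cong)
lemma exB_pw: "0 < \<epsilon> \<Longrightarrow> mat_rpow (exB \<epsilon>) r = exB (\<epsilon> powr r)"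
  unfolding exB_def by (subst two.pw_ud[OF hadamard_unitary]) (auto intro!: two.ud_cong)

lemma exA_le: "a \<le> 1 \<Longrightarrow> two.le (exA a) (two.sc 1)"
  "1 \<le> a \<Longrightarrow> two.le (exA a) (two.sc a)"
  unfolding exA_def by (simp_all add: two.ud_le_sc one_unitary)
lemma exB_le: "\<epsilon> \<le> 1 \<Longrightarrow> two.le (exB \<epsilon>) (two.sc 1)"
  unfolding exB_def by (simp add: two.ud_le_sc hadamard_unitary)

lemma exA_dt: "two.dt (exA a) = a"
  unfolding exA_def two.dt_ud[OF one_unitary] by (simp add: numeral_2_eq_2)
lemma exB_dt: "two.dt (exB a) = a"
  unfolding exB_def two.dt_ud[OF hadamard_unitary] by (simp add: numeral_2_eq_2)

lemma exA_vec: "exA a *\<^sub>v unit_vec 2 0 = complex_of_real a \<cdot>\<^sub>v unit_vec 2 0"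
  "exA a *\<^sub>v unit_vec 2 1 = complex_of_real 1 \<cdot>\<^sub>v unit_vec 2 1"
  using two.qf_ud_col(4)[OF one_unitary, of 0 "\<lambda>i. if i = 0 then a else 1"]
    two.qf_ud_col(4)[OF one_unitary, of 1 "\<lambda>i. if i = 0 then a else 1"]
  unfolding exA_def by simp_all

lemma exA_qf: "qf (exA a) (unit_vec 2 0) = a" "qf (exA a) (unit_vec 2 1) = 1"
  using two.qf_ud_col(1)[OF one_unitary, of 0 "\<lambda>i. if i = 0 then a else 1"]
    two.qf_ud_col(1)[OF one_unitary, of 1 "\<lambda>i. if i = 0 then a else 1"]
  unfolding exA_def by simp_all

lemma exB_qf: assumes "i < 2" "0 < \<epsilon>" shows "1/2 \<le> qf (exB \<epsilon>) (unit_vec 2 i)"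
proof -
  have "(mat_adjoint hadamard *\<^sub>v unit_vec 2 i) $ l = cnj (hadamard $$ (i,l))" if "l < 2" for l
    using that assms by (simp add: hadamard_def)
  moreover have "(cmod (hadamard $$ (i,l)))\<^sup>2 = 1/2" if "l < 2" for l
    using that assms by (auto simp: hadamard_def norm_divide power_divide)
  ultimately have "qf (exB \<epsilon>) (unit_vec 2 i) = (\<Sum>l<2::nat. (if l = 0 then 1 else \<epsilon>) * (1/2))"
    unfolding exB_def by (subst two.qf_ud[OF hadamard_unitary]) (auto intro!: sum.cong)
  then show ?thesis using assms by (simp add: numeral_2_eq_2)
qed

lemma nsq_unit: "i < 2 \<Longrightarrow> nsq (unit_vec 2 i) = 1"
  using two.qf_ud_col(2)[OF one_unitary, of i] by simp

text \<open>The number \<open>g\<close> separates the largest eigenvalues, so the condition for k =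
  1 already fails.\<close>

lemma counterexample_aux:
  assumes a: "0 < a" and \<epsilon>: "0 < \<epsilon>" and SG: "\<not> two.le (SG_mean \<alpha> p (exA a) (exB \<epsilon>)) (two.sc g)"
    and G: "two.le (G_mean \<alpha> q (exA a) (exB \<epsilon>)) (two.sc g)"
  shows "\<exists>A \<in> pd 2. \<exists>B \<in> pd 2. \<not> log_maj 2 (SG_mean \<alpha> p A B) (G_mean \<alpha> q A B)"
proof (intro bexI)
  have p: "exA a \<in> psd 2" "exB \<epsilon> \<in> psd 2" using two.pd_psd[OF exA_pd[OF a]] two.pd_psd[OF exB_pd[OF \<epsilon>]] .
  show "\<not> log_maj 2 (SG_mean \<alpha> p (exA a) (exB \<epsilon>)) (G_mean \<alpha> q (exA a) (exB \<epsilon>))"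
  proof
    assume "log_maj 2 (SG_mean \<alpha> p (exA a) (exB \<epsilon>)) (G_mean \<alpha> q (exA a) (exB \<epsilon>))"
    then have "eigs_desc (SG_mean \<alpha> p (exA a) (exB \<epsilon>)) ! 0 \<le> eigs_desc (G_mean \<alpha> q (exA a) (exB \<epsilon>)) ! 0"
      unfolding log_maj_def by (auto dest!: bspec[where x = 1])
    then show False using SG G
      two.le_sc_eigs[OF two.SG_mean_psd[OF p]] two.le_sc_eigs[OF two.G_mean_psd[OF p]] by auto
  qed
qed (use exA_pd[OF a] exB_pd[OF \<epsilon>] in auto)

text \<open>\<open>g\<close> is fixed first, independently of a and \<epsilon>. If SG \<le> g, then
  Y^\<alpha> has second diagonal entry at most g^p = 1/4; but 0 \<le> Y \<le> 1 and \<alpha> < 1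
  give Y \<le> Y^\<alpha>, and that entry of Y is at least 1/2. It remains to choose a and
  \<epsilon> so small that G \<le> g.\<close>

lemma counterexample_lt_one:
  assumes \<alpha>: "0 < \<alpha>" "\<alpha> < 1" and p: "0 < p" and q: "0 < q"
  shows "\<exists>A \<in> pd 2. \<exists>B \<in> pd 2. \<not> log_maj 2 (SG_mean \<alpha> p A B) (G_mean \<alpha> q A B)"
proof -
  define g where "g = (1/4::real) powr (1/p)"
  have g: "0 < g" "g powr p = 1/4" "g \<le> 1" using p by (auto simp: g_def powr_powr intro!: powr_le1)
  \<comment> \<open>The form of G^q is at most \<nu>^(\<alpha>-1) + \<mu>^\<alpha> times the squared
    norm; \<tau> is the share of g^q granted to each term.\<close>
  define \<tau> where "\<tau> = g powr q / 2"
  have \<tau>: "0 < \<tau>" "\<tau> \<le> 1" "\<tau> + \<tau> = g powr q" using g q powr_le1[of q g] by (auto simp: \<tau>_def)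
  \<comment> \<open>The constants are solved backwards. E = \<epsilon>^q makes \<mu> \<le> 2E give
    \<mu>^\<alpha> \<le> \<tau>. L makes \<nu> \<ge> L give \<nu>^(\<alpha>-1) \<le> \<tau>. Finally
    a^(-q) = 2L puts a diagonal entry of at least L into \<open>X\<close>, and det X = 2LE then
    yields \<mu> \<le> 2E.\<close>
  define E where "E = \<tau> powr (1/\<alpha>) / 2"
  have E: "0 < E" "E \<le> 1" "(2 * E) powr \<alpha> = \<tau>"
    using \<tau> \<alpha> powr_le1[of "1/\<alpha>" \<tau>] by (auto simp: E_def powr_powr)
  define L where "L = \<tau> powr (- 1 / (1 - \<alpha>))"
  have L: "1 \<le> L" "L powr (\<alpha> - 1) = \<tau>"
  proof -
    have "- 1 / (1 - \<alpha>) * (\<alpha> - 1) = 1" using \<alpha> by (simp add: field_simps)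
    then show "L powr (\<alpha> - 1) = \<tau>" using \<tau> by (simp add: L_def powr_powr)
    have "\<tau> powr 0 \<le> \<tau> powr (- 1 / (1 - \<alpha>))" using \<tau> \<alpha> by (intro powr_mono') auto
    then show "1 \<le> L" using \<tau> by (simp add: L_def)
  qed
  define \<epsilon> where "\<epsilon> = E powr (1/q)"
  have \<epsilon>: "0 < \<epsilon>" "\<epsilon> powr q = E" "\<epsilon> \<le> 1" using E q by (auto simp: \<epsilon>_def powr_powr intro!: powr_le1)
  define a where "a = (2 * L) powr (- 1/q)"
  have a: "0 < a" "a powr (- q) = 2 * L" "a powr q = 1 / (2 * L)" "a \<le> 1"
  proof -
    show a0: "0 < a" and aq: "a powr (- q) = 2 * L" using L q by (auto simp: a_def powr_powr)
    have "a powr q * a powr (- q) = 1" using a0 by (simp flip: powr_add)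
    then show "a powr q = 1 / (2 * L)" unfolding aq using L by (simp add: field_simps)
    have "(2 * L) powr (- 1/q) \<le> (2 * L) powr 0" using L q by (intro powr_mono) auto
    then show "a \<le> 1" using L by (simp add: a_def)
  qed
  let ?A = "exA a" and ?B = "exB \<epsilon>"
  note pA = two.pd_psd[OF exA_pd[OF a(1)]] and pB = two.pd_psd[OF exB_pd[OF \<epsilon>(1)]]
  note u0 = unit_vec_carrier[of 2 0] and u1 = unit_vec_carrier[of 2 1]
  have G: "two.le (G_mean \<alpha> q ?A ?B) (two.sc g)"
  proof (rule two.G_mean_le[OF pA pB q])
    define X where "X = mat_rpow ?A (-q/2) * (mat_rpow ?B q * mat_rpow ?A (-q/2))"
    have X: "X \<in> psd 2" unfolding X_def by (intro two.psd_conj two.pw_psd pA pB)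
    obtain \<nu> \<mu> where sp: "0 \<le> \<mu>" "\<mu> \<le> \<nu>" "two.dt X = \<nu> * \<mu>" "two.le X (two.sc \<nu>)"
      "\<And>\<alpha> v. 0 < \<alpha> \<Longrightarrow> 0 < \<nu> \<Longrightarrow> v \<in> carrier_vec 2 \<Longrightarrow>
        qf (mat_rpow X \<alpha>) v \<le> \<nu> powr (\<alpha> - 1) * qf X v + \<mu> powr \<alpha> * nsq v" using two_spectrum[OF X] by metis
    have "qf X (unit_vec 2 0) = (a powr (-q/2))\<^sup>2 * qf (exB E) (unit_vec 2 0)"
      unfolding X_def exB_pw[OF \<epsilon>(1)] \<epsilon>(2) using pA two.pd_psd[OF exB_pd[OF E(1)]]
      by (intro two.qf_conj_eigen) (simp_all add: exA_pw[OF a(1)] exA_vec)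
    moreover have "(a powr (-q/2))\<^sup>2 = 2 * L" using a by (simp add: power2_eq_square flip: powr_add)
    ultimately have "2 * L * (1/2) \<le> qf X (unit_vec 2 0)" using exB_qf[of 0 E] E L by simp
    also have "\<dots> \<le> qf (two.sc \<nu>) (unit_vec 2 0)" using sp(4) u0 unfolding two.le_def by blast
    also have "\<dots> = \<nu>" using nsq_unit[of 0] u0 by (simp add: two.qf_sc)
    finally have \<nu>: "L \<le> \<nu>" by simp
    have "two.dt X = a powr (-q/2) * (E * a powr (-q/2))" unfolding X_def
      using pA pB by (simp add: two.dt_conj two.dt_pw exA_dt exB_dt \<epsilon>)
    also have "\<dots> = 2 * L * E" using a by (simp flip: powr_add)
    finally have "L * \<mu> \<le> L * (2 * E)" using sp \<nu> mult_right_mono[OF \<nu> sp(1)] by simp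
    then have \<mu>: "\<mu> \<le> 2 * E" using L by simp
    have "two.le (mat_rpow ?A (q/2) * (mat_rpow X \<alpha> * mat_rpow ?A (q/2))) (two.sc (g powr q))"
      unfolding two.le_def
    proof (intro conjI ballI)
      fix v :: "complex vec" assume v: "v \<in> carrier_vec 2"
      let ?w = "mat_rpow ?A (q/2) *\<^sub>v v"
      have w: "?w \<in> carrier_vec 2" using pA v by simp
      have c: "qf (mat_rpow ?A (q/2) * (Y * mat_rpow ?A (q/2))) v = qf Y ?w" if "Y \<in> carrier_mat 2 2" for Y
        using two.qf_conj[of "mat_rpow ?A (q/2)" Y v] that pA v by simp
      have "qf (mat_rpow ?A (q/2) * (mat_rpow X \<alpha> * mat_rpow ?A (q/2))) v \<le> \<nu> powr (\<alpha> - 1) * qf X ?w + \<mu> powr \<alpha> * nsq ?w"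
        using sp(5)[OF \<alpha>(1) _ w] \<nu> L X by (simp add: c)
      also have "qf X ?w = qf (mat_rpow ?B q) v"
        using X c[of X] pA pB exA_pd[OF a(1)] by (simp add: X_def)
      also have "nsq ?w = qf (mat_rpow ?A q) v"
        using c[of "1\<^sub>m 2"] pA w by (simp add: qf_def nsq_def)
      also have "\<nu> powr (\<alpha> - 1) * qf (mat_rpow ?B q) v + \<mu> powr \<alpha> * qf (mat_rpow ?A q) v
        \<le> \<tau> * nsq v + \<tau> * nsq v"
      proof (intro add_mono mult_mono)
        have "\<nu> powr (\<alpha> - 1) \<le> L powr (\<alpha> - 1)" using \<nu> L \<alpha> by (intro powr_mono2') auto
        then show "\<nu> powr (\<alpha> - 1) \<le> \<tau>" using L by simp
        have "\<mu> powr \<alpha> \<le> (2 * E) powr \<alpha>" using \<mu> sp \<alpha> by (intro powr_mono2) auto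
        then show "\<mu> powr \<alpha> \<le> \<tau>" using E by simp
        show "qf (mat_rpow ?B q) v \<le> nsq v" using exB_le[of E] E v by (auto simp: exB_pw \<epsilon> two.le_def two.qf_sc)
        have "a powr q \<le> 1" using L by (simp add: a)
        then show "qf (mat_rpow ?A q) v \<le> nsq v" using exA_le(1)[of "a powr q"] v a(1) by (auto simp: exA_pw two.le_def two.qf_sc)
        show "0 \<le> qf (mat_rpow ?B q) v" "0 \<le> qf (mat_rpow ?A q) v"
          using two.pw_psd[OF pB, of q] two.pw_psd[OF pA, of q] v unfolding two.psd_iff by auto
      qed (use \<tau> in auto)
      also have "\<dots> = qf (two.sc (g powr q)) v" using v \<tau>(3) by (simp add: two.qf_sc flip: distrib_right)
      finally show "qf (mat_rpow ?A (q/2) * (mat_rpow X \<alpha> * mat_rpow ?A (q/2))) v \<le> qf (two.sc (g powr q)) v" .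
    qed (use X pA in \<open>simp_all add: two.psd_conj\<close>)
    then show "two.le (mat_rpow ?A (q/2) * (mat_rpow (mat_rpow ?A (-q/2) * (mat_rpow ?B q * mat_rpow ?A (-q/2))) \<alpha> * mat_rpow ?A (q/2))) (two.sc (g powr q))"
      by (simp add: X_def)
  qed (use g in simp)
  moreover have "\<not> two.le (SG_mean \<alpha> p ?A ?B) (two.sc g)"
  proof
    assume "two.le (SG_mean \<alpha> p ?A ?B) (two.sc g)"
    from two.SG_mean_leD[OF exA_pd[OF a(1)] pB p less_imp_le[OF g(1)] this]
    have le: "two.le (mat_rpow (mat_rpow ?A (p/2) * (mat_rpow ?B p * mat_rpow ?A (p/2))) \<alpha>)
      (complex_of_real (g powr p) \<cdot>\<^sub>m mat_rpow ?A ((2 * \<alpha> - 1) * p))" .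
    define Y where "Y = mat_rpow ?A (p/2) * (mat_rpow ?B p * mat_rpow ?A (p/2))"
    have Y: "Y \<in> psd 2" unfolding Y_def by (intro two.psd_conj two.pw_psd pA pB)
    have "\<epsilon> powr p \<le> 1" "a powr p \<le> 1" using \<epsilon> a p by (auto intro!: powr_le1)
    have "two.le Y (mat_rpow ?A (p/2) * (two.sc 1 * mat_rpow ?A (p/2)))"
      unfolding Y_def using exB_le[OF \<open>\<epsilon> powr p \<le> 1\<close>] pA by (intro two.le_conj_herm) (simp_all add: exB_pw \<epsilon>)
    also have "\<dots> = mat_rpow ?A p" using pA by (simp add: two.sc_one)
    also have "two.le \<dots> (two.sc 1)" using exA_le(1)[OF \<open>a powr p \<le> 1\<close>] by (simp add: exA_pw a)
    finally have Y1: "two.le Y (two.sc 1)" .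
    obtain U d where U: "two.unitary U" "Y = two.ud U d" "\<And>i. 0 \<le> d i" using two.psd_spectral[OF Y] by metis
    have "two.le Y (mat_rpow Y \<alpha>)"
    proof -
      have "d i \<le> d i powr \<alpha>" if "i < 2" for i
      proof (cases "d i = 0")
        case False
        then have "0 < d i" "d i \<le> 1" using U(3)[of i] Y1 that by (auto simp: U(2) two.ud_le_sc[OF U(1)])
        then show ?thesis using powr_mono'[of \<alpha> 1 "d i"] \<alpha> by simp
      qed simp
      then show ?thesis using U by (simp add: two.pw_ud two.ud_le)
    qed
    then have "qf Y (unit_vec 2 1) \<le> qf (mat_rpow Y \<alpha>) (unit_vec 2 1)" by (simp add: two.le_def)
    also have "\<dots> \<le> g powr p * qf (mat_rpow ?A ((2 * \<alpha> - 1) * p)) (unit_vec 2 1)"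
      using le pA unfolding Y_def[symmetric] two.le_def by (auto simp: two.qf_smult dest!: bspec[OF _ u1])
    also have "\<dots> = 1/4" by (simp add: g exA_pw[OF a(1)] exA_qf[unfolded One_nat_def])
    finally have 1: "qf Y (unit_vec 2 1) \<le> 1/4" .
    have "qf Y (unit_vec 2 1) = 1\<^sup>2 * qf (exB (\<epsilon> powr p)) (unit_vec 2 1)"
      unfolding Y_def exB_pw[OF \<epsilon>(1)] using pA two.pd_psd[OF exB_pd[of "\<epsilon> powr p"]] \<epsilon>
      by (intro two.qf_conj_eigen) (simp_all add: exA_pw[OF a(1)] exA_vec[unfolded One_nat_def])
    then show False using 1 exB_qf[of 1 "\<epsilon> powr p"] \<epsilon> by simp
  qed
  ultimately show ?thesis using counterexample_aux[OF a(1) \<epsilon>(1)] by blast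
qed

text \<open>Here \<open>g\<close> is a^(1-\<alpha>). G \<le> g follows from X \<le> a^(-q), which
  linearises X^\<alpha> to a multiple of X. If also SG \<le> g, the first diagonal entry of
  Y^\<alpha> would be at most a^(\<alpha>p), whereas \<open>two_spectrum\<close> bounds it below by
  a constant times a^p, which is larger for small a.\<close>

lemma counterexample_gt_one:
  assumes \<alpha>: "1 < \<alpha>" and p: "0 < p" and q: "0 < q"
  shows "\<exists>A \<in> pd 2. \<exists>B \<in> pd 2. \<not> log_maj 2 (SG_mean \<alpha> p A B) (G_mean \<alpha> q A B)"
proof -
  \<comment> \<open>Chosen so that the lower bound (1/2)^(\<alpha>-1) a^p/4 obtained below is
    exactly twice the upper bound a^(\<alpha>p).\<close>
  define a where "a = (2::real) powr (- (\<alpha> + 2) / ((\<alpha> - 1) * p))"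
  have a: "0 < a" "a \<le> 1" "a powr (- (\<alpha> - 1) * p) = 2 powr (\<alpha> + 2)"
  proof -
    show "a powr (- (\<alpha> - 1) * p) = 2 powr (\<alpha> + 2)" 
    proof -
      define D where "D = (\<alpha> - 1) * p"
      have D: "0 < D" "- (\<alpha> - 1) * p = - D" using \<alpha> p by (simp_all add: D_def algebra_simps)
      show ?thesis unfolding a_def powr_powr D(2) unfolding D_def[symmetric] using D(1) by (simp add: add.commute)
    qed
    have "(2::real) powr (- (\<alpha> + 2) / ((\<alpha> - 1) * p)) \<le> 2 powr 0"
      using \<alpha> p by (intro powr_mono) (auto simp: divide_nonpos_pos)
    then show "a \<le> 1" by (simp add: a_def)
  qed (simp add: a_def)
  \<comment> \<open>With \<epsilon>^p = 1/8 and \<nu> \<ge> 1/2 the determinant gives \<mu> \<le>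
    a^p/4, half of the lower bound a^p/2 for the first diagonal entry of \<open>Y\<close>.\<close>
  define \<epsilon> where "\<epsilon> = (1/8::real) powr (1/p)"
  have \<epsilon>: "0 < \<epsilon>" "\<epsilon> \<le> 1" "\<epsilon> powr p = 1/8" using p by (auto simp: \<epsilon>_def powr_powr intro!: powr_le1)
  define g where "g = a powr (1 - \<alpha>)"
  have g: "0 < g" using a by (simp add: g_def)
  let ?A = "exA a" and ?B = "exB \<epsilon>"
  note pA = two.pd_psd[OF exA_pd[OF a(1)]] and pB = two.pd_psd[OF exB_pd[OF \<epsilon>(1)]]
  note u0 = unit_vec_carrier[of 2 0] and u1 = unit_vec_carrier[of 2 1]
  have G: "two.le (G_mean \<alpha> q ?A ?B) (two.sc g)"
  proof (rule two.G_mean_le[OF pA pB q])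
    define X where "X = mat_rpow ?A (-q/2) * (mat_rpow ?B q * mat_rpow ?A (-q/2))"
    have X: "X \<in> psd 2" unfolding X_def by (intro two.psd_conj two.pw_psd pA pB)
    define l where "l = a powr (- q)"
    have l: "1 \<le> l" "l powr (\<alpha> - 1) = g powr q"
      using a q \<alpha> powr_mono'[of "- q" 0 a] by (auto simp: l_def g_def powr_powr algebra_simps)
    have "\<epsilon> powr q \<le> 1" using \<epsilon> q by (auto intro!: powr_le1)
    then have B1: "two.le (mat_rpow ?B q) (two.sc 1)" using exB_le by (simp add: exB_pw \<epsilon>)
    have "two.le X (mat_rpow ?A (-q/2) * (two.sc 1 * mat_rpow ?A (-q/2)))"
      unfolding X_def using B1 pA by (intro two.le_conj_herm) simp_all
    also have "\<dots> = mat_rpow ?A (- q)" using pA by (simp add: two.sc_one)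
    also have "two.le \<dots> (two.sc l)" using exA_le(2)[OF l(1)] by (simp add: exA_pw a l_def)
    finally have Xl: "two.le X (two.sc l)" .
    obtain U d where U: "two.unitary U" "X = two.ud U d" "\<And>i. 0 \<le> d i" using two.psd_spectral[OF X] by metis
    have "two.le (mat_rpow X \<alpha>) (complex_of_real (l powr (\<alpha> - 1)) \<cdot>\<^sub>m X)"
    proof -
      have "d i powr \<alpha> \<le> l powr (\<alpha> - 1) * d i" if "i < 2" for i
      proof -
        have dl: "d i \<le> l" using Xl that by (auto simp: U(2) two.ud_le_sc[OF U(1)])
        have "d i powr \<alpha> = d i powr (\<alpha> - 1) * d i"
          using powr_mult_base[OF U(3)[of i], of "\<alpha> - 1"] by (simp add: mult.commute)
        also have "\<dots> \<le> l powr (\<alpha> - 1) * d i" using dl U(3)[of i] \<alpha> by (intro mult_right_mono powr_mono2) auto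
        finally show ?thesis .
      qed
      then show ?thesis using U by (simp add: two.pw_ud two.ud_le two.ud_smult)
    qed
    then have "two.le (mat_rpow ?A (q/2) * (mat_rpow X \<alpha> * mat_rpow ?A (q/2)))
       (mat_rpow ?A (q/2) * ((complex_of_real (l powr (\<alpha> - 1)) \<cdot>\<^sub>m X) * mat_rpow ?A (q/2)))"
      by (rule two.le_conj_herm) (use pA in simp)
    also have "\<dots> = complex_of_real (g powr q) \<cdot>\<^sub>m mat_rpow ?B q"
      using X pA pB exA_pd[OF a(1)] unfolding l by (simp add: X_def)
    also have "two.le \<dots> (complex_of_real (g powr q) \<cdot>\<^sub>m two.sc 1)" by (rule two.le_smult[OF B1]) simp
    also have "complex_of_real (g powr q) \<cdot>\<^sub>m two.sc 1 = two.sc (g powr q)" by (simp add: two.sc_def two.smult_smult)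
    finally show "two.le (mat_rpow ?A (q/2) * (mat_rpow (mat_rpow ?A (-q/2) * (mat_rpow ?B q * mat_rpow ?A (-q/2))) \<alpha> * mat_rpow ?A (q/2))) (two.sc (g powr q))"
      by (simp add: X_def)
  qed (use g in simp)
  moreover have "\<not> two.le (SG_mean \<alpha> p ?A ?B) (two.sc g)"
  proof
    assume "two.le (SG_mean \<alpha> p ?A ?B) (two.sc g)"
    from two.SG_mean_leD[OF exA_pd[OF a(1)] pB p less_imp_le[OF g(1)] this]
    have le: "two.le (mat_rpow (mat_rpow ?A (p/2) * (mat_rpow ?B p * mat_rpow ?A (p/2))) \<alpha>)
      (complex_of_real (g powr p) \<cdot>\<^sub>m mat_rpow ?A ((2 * \<alpha> - 1) * p))" .
    define Y where "Y = mat_rpow ?A (p/2) * (mat_rpow ?B p * mat_rpow ?A (p/2))"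
    have Y: "Y \<in> psd 2" unfolding Y_def by (intro two.psd_conj two.pw_psd pA pB)
    obtain \<nu> \<mu> where sp: "0 \<le> \<mu>" "\<mu> \<le> \<nu>" "two.dt Y = \<nu> * \<mu>" "two.le Y (two.sc \<nu>)"
      "\<And>\<alpha> v. 0 < \<alpha> \<Longrightarrow> 0 < \<nu> \<Longrightarrow> v \<in> carrier_vec 2 \<Longrightarrow>
       \<nu> powr (\<alpha> - 1) * (qf Y v - \<mu> * nsq v) \<le> qf (mat_rpow Y \<alpha>) v" using two_spectrum[OF Y] by metis
    have B8: "mat_rpow ?B p = exB (1/8)" unfolding exB_pw[OF \<epsilon>(1)] \<epsilon>(3) ..
    have pB8: "exB (1/8) \<in> psd 2" using two.pd_psd[OF exB_pd[of "1/8"]] by simp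
    have "qf Y (unit_vec 2 1) = 1\<^sup>2 * qf (exB (1/8)) (unit_vec 2 1)"
      unfolding Y_def B8 using pA pB8
      by (intro two.qf_conj_eigen) (simp_all add: exA_pw[OF a(1)] exA_vec[unfolded One_nat_def])
    then have "1/2 \<le> qf Y (unit_vec 2 1)" using exB_qf[of 1 "1/8"] by simp
    also have "\<dots> \<le> qf (two.sc \<nu>) (unit_vec 2 1)" using sp(4) u1 unfolding two.le_def by blast
    also have "\<dots> = \<nu>" using nsq_unit[of 1] u1 by (simp add: two.qf_sc)
    finally have \<nu>: "1/2 \<le> \<nu>" .
    have ap: "a powr (p/2) * a powr (p/2) = a powr p" by (simp flip: powr_add)
    have "two.dt Y = a powr (p/2) * (1/8 * a powr (p/2))" unfolding Y_def
      using pA pB by (simp add: two.dt_conj two.dt_pw exA_dt exB_dt \<epsilon>)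
    also have "\<dots> = a powr p / 8" using ap by simp
    finally have "1/2 * \<mu> \<le> a powr p / 8" using sp mult_right_mono[OF \<nu> sp(1)] by simp
    then have \<mu>: "\<mu> \<le> a powr p / 4" by simp
    have "qf Y (unit_vec 2 0) = (a powr (p/2))\<^sup>2 * qf (exB (1/8)) (unit_vec 2 0)"
      unfolding Y_def B8 using pA pB8
      by (intro two.qf_conj_eigen) (simp_all add: exA_pw[OF a(1)] exA_vec)
    then have "qf Y (unit_vec 2 0) = a powr p * qf (exB (1/8)) (unit_vec 2 0)" by (simp add: power2_eq_square ap)
    moreover have "a powr p * (1/2) \<le> a powr p * qf (exB (1/8)) (unit_vec 2 0)"
      by (rule mult_left_mono) (use exB_qf[of 0 "1/8"] in auto)
    ultimately have Y0: "a powr p / 2 \<le> qf Y (unit_vec 2 0)" by simp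
    have "(1/2) powr (\<alpha> - 1) * (a powr p / 4) \<le> \<nu> powr (\<alpha> - 1) * (qf Y (unit_vec 2 0) - \<mu> * nsq (unit_vec 2 0))"
      using \<nu> \<mu> Y0 \<alpha> nsq_unit[of 0] by (intro mult_mono powr_mono2) auto
    also have "\<dots> \<le> qf (mat_rpow Y \<alpha>) (unit_vec 2 0)" using \<nu> \<alpha> by (intro sp(5)) auto
    also have "\<dots> \<le> g powr p * qf (mat_rpow ?A ((2 * \<alpha> - 1) * p)) (unit_vec 2 0)"
      using le pA unfolding Y_def[symmetric] two.le_def by (auto simp: two.qf_smult dest!: bspec[OF _ u0])
    also have "\<dots> = a powr ((1 - \<alpha>) * p) * a powr ((2 * \<alpha> - 1) * p)"
      by (simp add: exA_pw[OF a(1)] exA_qf g_def powr_powr)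
    also have "\<dots> = a powr (\<alpha> * p)" by (simp add: algebra_simps flip: powr_add)
    finally have 1: "(1/2) powr (\<alpha> - 1) * (a powr p / 4) \<le> a powr (\<alpha> * p)" .
    have "a powr p = a powr (- (\<alpha> - 1) * p) * a powr (\<alpha> * p)" by (simp add: algebra_simps flip: powr_add)
    then have "a powr p = 2 powr (\<alpha> + 2) * a powr (\<alpha> * p)" using a by simp
    moreover have "(1/2::real) powr (\<alpha> - 1) * 2 powr (\<alpha> + 2) = 8"
    proof -
      have "(1/2::real) powr (\<alpha> - 1) = 2 powr (1 - \<alpha>)" by (simp add: powr_divide powr_minus_divide[symmetric] flip: powr_minus)
      then have "(1/2::real) powr (\<alpha> - 1) * 2 powr (\<alpha> + 2) = 2 powr 3" by (simp flip: powr_add)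
      then show ?thesis by simp
    qed
    then have "(1/2::real) powr (\<alpha> - 1) * (2 powr (\<alpha> + 2) * a powr (\<alpha> * p)) = 8 * a powr (\<alpha> * p)"
      by (simp only: mult.assoc[symmetric])
    ultimately have "(1/2) powr (\<alpha> - 1) * (a powr p / 4) = 2 * a powr (\<alpha> * p)" by (simp only: times_divide_eq_right)
    then have "2 * a powr (\<alpha> * p) \<le> a powr (\<alpha> * p)" using 1 by linarith
    moreover have "0 < a powr (\<alpha> * p)" using a by simp
    ultimately show False by simp
  qed
  ultimately show ?thesis using counterexample_aux[OF a(1) \<epsilon>(1)] by blast
qed

theorem proposition3p14:
  shows "(\<forall>\<alpha> p q :: real. 0 < \<alpha> \<and> \<alpha> \<noteq> 1 \<and> 0 < p \<and> 0 < q \<longrightarrow>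
            (\<exists>A \<in> pd 2. \<exists>B \<in> pd 2. \<not> log_maj 2 (SG_mean \<alpha> p A B) (G_mean \<alpha> q A B)))
       \<and> (\<forall>\<alpha> p q :: real. 0 < \<alpha> \<and> \<alpha> \<le> 1/2 \<and> 0 < p \<and> 0 < q \<longrightarrow>
            (\<forall>n. \<forall>A \<in> psd n. \<forall>B \<in> psd n. loewner_le (supp_proj B) (supp_proj A) \<longrightarrow>
               log_maj n (G_mean \<alpha> q A B) (SG_mean \<alpha> p A B)))
       \<and> (\<forall>\<alpha> p q :: real. 1 < \<alpha> \<and> 0 < p \<and> 0 < q \<and> q / p \<le> min (1/2) ((\<alpha> - 1) / \<alpha>) \<longrightarrow>
            (\<forall>n. \<forall>A \<in> psd n. \<forall>B \<in> psd n. loewner_le (supp_proj B) (supp_proj A) \<longrightarrow>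
               log_maj n (G_mean \<alpha> q A B) (SG_mean \<alpha> p A B)))"
proof (intro conjI allI impI ballI)
  fix \<alpha> p q :: real assume "0 < \<alpha> \<and> \<alpha> \<noteq> 1 \<and> 0 < p \<and> 0 < q"
  then show "\<exists>A \<in> pd 2. \<exists>B \<in> pd 2. \<not> log_maj 2 (SG_mean \<alpha> p A B) (G_mean \<alpha> q A B)"
    using counterexample_lt_one[of \<alpha> p q] counterexample_gt_one[of \<alpha> p q] by linarith
next
  fix \<alpha> p q :: real and n A B
  assume h: "0 < \<alpha> \<and> \<alpha> \<le> 1/2 \<and> 0 < p \<and> 0 < q" "A \<in> psd n" "B \<in> psd n" "loewner_le (supp_proj B) (supp_proj A)"
  then show "log_maj n (G_mean \<alpha> q A B) (SG_mean \<alpha> p A B)"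
    by (intro log_maj_means sqmat.unit_bound_transfer_le_half) auto
next
  fix \<alpha> p q :: real and n A B
  assume h: "1 < \<alpha> \<and> 0 < p \<and> 0 < q \<and> q / p \<le> min (1/2) ((\<alpha> - 1) / \<alpha>)" "A \<in> psd n" "B \<in> psd n" "loewner_le (supp_proj B) (supp_proj A)"
  then show "log_maj n (G_mean \<alpha> q A B) (SG_mean \<alpha> p A B)"
    by (intro log_maj_means sqmat.unit_bound_transfer_gt_one) auto
qed

end
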